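(* Let $(M,g)$ be a generalized gravitational wave spacetime (see context), with Lorentzian distance $d:M\times M\to[0,+\infty]$ and classical least action $S:E\times E\to[-\infty,+\infty]$. Let $x_0=(e_0,y_0)$, $x_1=(e_1,y_1)\in M$, with $e_i=(t_i,q_i)$. If $x_1\in J^+(x_0)$ then $$d(x_0,x_1)=\sqrt{2\,[\,y_1-y_0-S(e_0,e_1)\,]\,(t_1-t_0)} .$$ In particular, $S(e_0,e_1)=-\infty$ if and only if $d(x_0,x_1)=+\infty$.
   Context: Setting. $r\ge 2$; $Q$ is a connected $d$-dimensional ($C^{r+1}$, Hausdorff, paracompact, boundaryless) manifold; $T\subset\mathbb{R}$ is a connected interval, open because spacetimes are without boundary; $E=T\times Q$ with points $e=(t,q)$. On $Q$ there are given a time-dependent Riemannian metric $a_t$, a time-dependent 1-form $b_t$ and a function $V(t,q)$, all $C^r$ in $(t,q)\in E$. The Lagrangian is $L(t,q,v)=\frac12 a_t(v,v)+b_t(v)-V(t,q)$. The generalized gravitational wave spacetime is $M=T\times Q\times\mathbb{R}$ with points $x=(t,q,y)=(e,y)$ and Lorentzian metric (signature $(-,+,\dots,+)$) $g=a_t-dt\otimes(dy-b_t)-(dy-b_t)\otimes dt-2V\,dt^2$, time oriented by the timelike vector field $W=\partial_t-(V-\tfrac12)\partial_y$. Least action. For $e_0=(t_0,q_0)$, $e_1=(t_1,q_1)$ with $t_0<t_1$, $C^1_{e_0,e_1}$ is the set of $C^1$ curves $q:[t_0,t_1]\to Q$ with $q(t_0)=q_0$, $q(t_1)=q_1$, and $\mathcal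 S_{e_0,e_1}[q]=\int_{t_0}^{t_1}L(t,q(t),\dot q(t))\,dt$. Define $S(e_0,e_1)=\inf_{q\in C^1_{e_0,e_1}}\mathcal S_{e_0,e_1}[q]$ if $t_0<t_1$; $S(e_0,e_1)=0$ if $e_0=e_1$; $S(e_0,e_1)=+\infty$ otherwise. $J^+(x_0)$ is the set of points $x_1$ such that $x_1=x_0$ or there is a future directed causal curve from $x_0$ to $x_1$. The Lorentzian distance $d(x_0,x_1)$ is the supremum of the Lorentzian lengths $l(\gamma)=\int\sqrt{-g(\gamma',\gamma')}$ of the future directed causal curves from $x_0$ to $x_1$ (and $0$ if there are none). *)

theory Defs
  imports "HOL-Analysis.Analysis"
begin

section \<open>Manifolds\<close>

text \<open>
  Maps of class \<open>C^k\<close> on an open subset of a finite-dimensional normed space. In finite dimension,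
  continuity of the iterated directional derivatives is continuity of the iterated differentials.
\<close>

primrec Ck_on ::
  "nat \<Rightarrow> ('a::real_normed_vector \<Rightarrow> 'b::real_normed_vector) \<Rightarrow> 'a set \<Rightarrow> bool" where
  "Ck_on 0 f S \<longleftrightarrow> continuous_on S f"
| "Ck_on (Suc k) f S \<longleftrightarrow>
     (\<forall>x\<in>S. f differentiable (at x)) \<and> (\<forall>v. Ck_on k (\<lambda>x. frechet_derivative f (at x) v) S)"

definition paracompact_on_type :: "'m::topological_space itself \<Rightarrow> bool" where
  "paracompact_on_type _ \<longleftrightarrow>
     (\<forall>\<U>::'m set set. (\<forall>U\<in>\<U>. open U) \<and> \<Union>\<U> = UNIV \<longrightarrow>
        (\<exists>\<V>. (\<forall>V\<in>\<V>. open V) \<and> \<Union>\<V> = UNIV \<and> (\<forall>V\<in>\<V>. \<exists>U\<in>\<U>. V \<subseteq> U) \<and>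
             locally_finite_in euclidean \<V>))"

text \<open>
  An atlas is given as a family of charts indexed by the points of the manifold, \<open>ch p\<close> being a
  chart around \<open>p\<close>; every atlas contains such a family, and that family defines the same
  differentiable structure. The family also fixes a model of the tangent spaces: the tangent space
  at \<open>p\<close> is the model vector space \<open>'v\<close>, a vector being represented by its components in the chart
  \<open>ch p\<close>. Components in another chart \<open>ch p'\<close> are related to these by the differential of
  the transition map (see \<open>tangent_of_components\<close> below).
\<close>

type_synonym ('m, 'v) chart = "'m set \<times> ('m \<Rightarrow> 'v)"

abbreviation chart_dom :: "('m, 'v) chart \<Rightarrow> 'm set" where
  "chart_dom \<equiv> fst"

abbreviation chart_map :: "('m, 'v) chart \<Rightarrow> 'm \<Rightarrow> 'v" where
  "chart_map \<equiv> snd"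

abbreviation chart_inv :: "('m, 'v) chart \<Rightarrow> 'v \<Rightarrow> 'm" where
  "chart_inv c \<equiv> inv_into (chart_dom c) (chart_map c)"

text \<open>
  The model space is an inner product space of finite dimension \<open>d\<close> rather than a type of class
  \<open>euclidean_space\<close>, because the latter excludes \<open>d = 0\<close>. The Hausdorff property is the class
  \<open>t2_space\<close>; there is no boundary because charts have open images.
\<close>

definition Ck_manifold ::
  "nat \<Rightarrow> nat \<Rightarrow> ('m::t2_space \<Rightarrow> ('m, 'v::real_inner) chart) \<Rightarrow> bool" where
  "Ck_manifold d k ch \<longleftrightarrow>
     (\<exists>B::'v set. finite B \<and> card B = d \<and> independent B \<and> span B = UNIV) \<and>
     paracompact_on_type TYPE('m) \<and>
     (\<forall>p. p \<in> chart_dom (ch p) \<and> open (chart_dom (ch p)) \<and>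
          open (chart_map (ch p) ` chart_dom (ch p)) \<and>
          homeomorphism (chart_dom (ch p)) (chart_map (ch p) ` chart_dom (ch p))
            (chart_map (ch p)) (chart_inv (ch p))) \<and>
     (\<forall>p p'. Ck_on k (chart_map (ch p') \<circ> chart_inv (ch p))
               (chart_map (ch p) ` (chart_dom (ch p) \<inter> chart_dom (ch p'))))"

text \<open>The tangent vector at \<open>q\<close> whose components in the chart \<open>ch p\<close> are \<open>u\<close>.\<close>

definition tangent_of_components ::
  "('m \<Rightarrow> ('m, 'v::real_normed_vector) chart) \<Rightarrow> 'm \<Rightarrow> 'm \<Rightarrow> 'v \<Rightarrow> 'v" where
  "tangent_of_components ch p q u =
     frechet_derivative (chart_map (ch q) \<circ> chart_inv (ch p)) (at (chart_map (ch p) q)) u"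

text \<open>
  Velocity at the parameter \<open>s\<close> of a curve with parameter interval \<open>I\<close> (one-sided at end points).
\<close>

definition velocity ::
  "('m \<Rightarrow> ('m, 'v::real_normed_vector) chart) \<Rightarrow> real set \<Rightarrow> (real \<Rightarrow> 'm) \<Rightarrow> real \<Rightarrow> 'v" where
  "velocity ch I \<gamma> s = vector_derivative (chart_map (ch (\<gamma> s)) \<circ> \<gamma>) (at s within I)"

definition C1_curve ::
  "'m::topological_space set \<Rightarrow> ('m \<Rightarrow> ('m, 'v::real_normed_vector) chart) \<Rightarrow>
   real \<Rightarrow> real \<Rightarrow> (real \<Rightarrow> 'm) \<Rightarrow> bool" where
  "C1_curve M ch \<alpha> \<beta> \<gamma> \<longleftrightarrow>
     \<gamma> ` {\<alpha>..\<beta>} \<subseteq> M \<and> continuous_on {\<alpha>..\<beta>} \<gamma> \<and>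
     (\<forall>p\<in>M. let S = {s\<in>{\<alpha>..\<beta>}. \<gamma> s \<in> chart_dom (ch p)}; f = chart_map (ch p) \<circ> \<gamma> in
        (\<forall>s\<in>S. f differentiable (at s within {\<alpha>..\<beta>})) \<and>
        continuous_on S (\<lambda>s. vector_derivative f (at s within {\<alpha>..\<beta>})))"


section \<open>Causality and Lorentzian distance\<close>

text \<open>
  A spacetime is given by its point set \<open>M\<close>, charts \<open>ch\<close>, metric \<open>g\<close> (signature \<open>(-,+,...,+)\<close>) and
  a timelike vector field \<open>W\<close> defining the time orientation.
\<close>

definition future_causal_vector ::
  "('m \<Rightarrow> 'v::real_vector \<Rightarrow> 'v \<Rightarrow> real) \<Rightarrow> ('m \<Rightarrow> 'v) \<Rightarrow> 'm \<Rightarrow> 'v \<Rightarrow> bool" where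
  "future_causal_vector g W x X \<longleftrightarrow> X \<noteq> 0 \<and> g x X X \<le> 0 \<and> g x (W x) X < 0"

text \<open>
  Causal curves are piecewise \<open>C^1\<close>, and at the break points both one-sided velocities are future
  directed causal.
\<close>

definition future_causal_curve ::
  "'m::topological_space set \<Rightarrow> ('m \<Rightarrow> ('m, 'v::real_normed_vector) chart) \<Rightarrow>
   ('m \<Rightarrow> 'v \<Rightarrow> 'v \<Rightarrow> real) \<Rightarrow> ('m \<Rightarrow> 'v) \<Rightarrow> real \<Rightarrow> real \<Rightarrow> (real \<Rightarrow> 'm) \<Rightarrow> bool" where
  "future_causal_curve M ch g W \<alpha> \<beta> \<gamma> \<longleftrightarrow>
     \<alpha> < \<beta> \<and>
     (\<exists>n \<sigma>. \<sigma> 0 = \<alpha> \<and> \<sigma> n = \<beta> \<and>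
        (\<forall>i<n. \<sigma> i < \<sigma> (Suc i) \<and> C1_curve M ch (\<sigma> i) (\<sigma> (Suc i)) \<gamma> \<and>
           (\<forall>s\<in>{\<sigma> i..\<sigma> (Suc i)}.
              future_causal_vector g W (\<gamma> s) (velocity ch {\<sigma> i..\<sigma> (Suc i)} \<gamma> s))))"

definition future_causal_curves_between ::
  "'m::topological_space set \<Rightarrow> ('m \<Rightarrow> ('m, 'v::real_normed_vector) chart) \<Rightarrow>
   ('m \<Rightarrow> 'v \<Rightarrow> 'v \<Rightarrow> real) \<Rightarrow> ('m \<Rightarrow> 'v) \<Rightarrow> 'm \<Rightarrow> 'm \<Rightarrow> (real \<times> real \<times> (real \<Rightarrow> 'm)) set" where
  "future_causal_curves_between M ch g W x0 x1 =
     {(\<alpha>, \<beta>, \<gamma>). future_causal_curve M ch g W \<alpha> \<beta> \<gamma> \<and> \<gamma> \<alpha> = x0 \<and> \<gamma> \<beta> = x1}"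

definition causal_future ::
  "'m::topological_space set \<Rightarrow> ('m \<Rightarrow> ('m, 'v::real_normed_vector) chart) \<Rightarrow>
   ('m \<Rightarrow> 'v \<Rightarrow> 'v \<Rightarrow> real) \<Rightarrow> ('m \<Rightarrow> 'v) \<Rightarrow> 'm \<Rightarrow> 'm set" where
  "causal_future M ch g W x0 =
     {x1\<in>M. x1 = x0 \<or> future_causal_curves_between M ch g W x0 x1 \<noteq> {}}"

text \<open>The velocity below is meaningless at break points, of which there are finitely many.\<close>

definition lorentzian_length ::
  "('m \<Rightarrow> ('m, 'v::real_normed_vector) chart) \<Rightarrow> ('m \<Rightarrow> 'v \<Rightarrow> 'v \<Rightarrow> real) \<Rightarrow>
   real \<Rightarrow> real \<Rightarrow> (real \<Rightarrow> 'm) \<Rightarrow> real" where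
  "lorentzian_length ch g \<alpha> \<beta> \<gamma> =
     integral {\<alpha>..\<beta>}
       (\<lambda>s. sqrt (- g (\<gamma> s) (velocity ch {\<alpha>..\<beta>} \<gamma> s) (velocity ch {\<alpha>..\<beta>} \<gamma> s)))"

definition lorentzian_distance ::
  "'m::topological_space set \<Rightarrow> ('m \<Rightarrow> ('m, 'v::real_normed_vector) chart) \<Rightarrow>
   ('m \<Rightarrow> 'v \<Rightarrow> 'v \<Rightarrow> real) \<Rightarrow> ('m \<Rightarrow> 'v) \<Rightarrow> 'm \<Rightarrow> 'm \<Rightarrow> ereal" where
  "lorentzian_distance M ch g W x0 x1 =
     (if future_causal_curves_between M ch g W x0 x1 = {} then 0
      else SUP (\<alpha>, \<beta>, \<gamma>) \<in> future_causal_curves_between M ch g W x0 x1.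
             ereal (lorentzian_length ch g \<alpha> \<beta> \<gamma>))"


section \<open>Generalized gravitational wave spacetimes\<close>

text \<open>
  \<open>a t q\<close> and \<open>b t q\<close> act on the tangent space at \<open>q\<close>. Their regularity is that of the components,
  and of \<open>V\<close>, as functions of \<open>(t, x)\<close>, \<open>x\<close> being the coordinates of \<open>q\<close> in any chart.
\<close>

definition gw_data ::
  "nat \<Rightarrow> nat \<Rightarrow> ('q::t2_space \<Rightarrow> ('q, 'v::real_inner) chart) \<Rightarrow> real set \<Rightarrow>
   (real \<Rightarrow> 'q \<Rightarrow> 'v \<Rightarrow> 'v \<Rightarrow> real) \<Rightarrow> (real \<Rightarrow> 'q \<Rightarrow> 'v \<Rightarrow> real) \<Rightarrow> (real \<Rightarrow> 'q \<Rightarrow> real) \<Rightarrow> bool" where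
  "gw_data d r ch T a b V \<longleftrightarrow>
     Ck_manifold d (r + 1) ch \<and> connected (UNIV :: 'q set) \<and>
     open T \<and> is_interval T \<and>
     (\<forall>t\<in>T. \<forall>q. bilinear (a t q) \<and> (\<forall>u w. a t q u w = a t q w u) \<and> (\<forall>u. u \<noteq> 0 \<longrightarrow> 0 < a t q u u)) \<and>
     (\<forall>t\<in>T. \<forall>q. linear (b t q)) \<and>
     (\<forall>p. let D = T \<times> chart_map (ch p) ` chart_dom (ch p);
              pt = chart_inv (ch p);
              vec = (\<lambda>x. tangent_of_components ch p (chart_inv (ch p) x))
          in (\<forall>u w. Ck_on r (\<lambda>(t, x). a t (pt x) (vec x u) (vec x w)) D) \<and>
             (\<forall>u. Ck_on r (\<lambda>(t, x). b t (pt x) (vec x u)) D) \<and>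
             Ck_on r (\<lambda>(t, x). V t (pt x)) D)"

definition gw_points :: "real set \<Rightarrow> (real \<times> 'q \<times> real) set" where
  "gw_points T = T \<times> UNIV \<times> UNIV"

definition gw_chart ::
  "('q \<Rightarrow> ('q, 'v) chart) \<Rightarrow> real set \<Rightarrow>
   real \<times> 'q \<times> real \<Rightarrow> (real \<times> 'q \<times> real, real \<times> 'v \<times> real) chart" where
  "gw_chart ch T = (\<lambda>(t, q, y).
     (T \<times> chart_dom (ch q) \<times> UNIV, \<lambda>(t', q', y'). (t', chart_map (ch q) q', y')))"

text \<open>
  \<open>g = a - dt \<otimes> (dy - b) - (dy - b) \<otimes> dt - 2 V dt\<^sup>2\<close> evaluated on the tangent vectors
  \<open>\<tau> \<partial>\<^sub>t + v + \<eta> \<partial>\<^sub>y\<close> and \<open>\<tau>' \<partial>\<^sub>t + v' + \<eta>' \<partial>\<^sub>y\<close>.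
\<close>

definition gw_metric ::
  "(real \<Rightarrow> 'q \<Rightarrow> 'v \<Rightarrow> 'v \<Rightarrow> real) \<Rightarrow> (real \<Rightarrow> 'q \<Rightarrow> 'v \<Rightarrow> real) \<Rightarrow> (real \<Rightarrow> 'q \<Rightarrow> real) \<Rightarrow>
   real \<times> 'q \<times> real \<Rightarrow> real \<times> 'v \<times> real \<Rightarrow> real \<times> 'v \<times> real \<Rightarrow> real" where
  "gw_metric a b V = (\<lambda>(t, q, y) (\<tau>, v, \<eta>) (\<tau>', v', \<eta>').
     a t q v v' - \<tau> * (\<eta>' - b t q v') - (\<eta> - b t q v) * \<tau>' - 2 * V t q * \<tau> * \<tau>')"

definition gw_orientation ::
  "(real \<Rightarrow> 'q \<Rightarrow> real) \<Rightarrow> real \<times> 'q \<times> real \<Rightarrow> real \<times> 'v::zero \<times> real" where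
  "gw_orientation V = (\<lambda>(t, q, y). (1, 0, - (V t q - 1/2)))"

abbreviation gw_causal_future ::
  "('q::t2_space \<Rightarrow> ('q, 'v::real_inner) chart) \<Rightarrow> real set \<Rightarrow>
   (real \<Rightarrow> 'q \<Rightarrow> 'v \<Rightarrow> 'v \<Rightarrow> real) \<Rightarrow> (real \<Rightarrow> 'q \<Rightarrow> 'v \<Rightarrow> real) \<Rightarrow> (real \<Rightarrow> 'q \<Rightarrow> real) \<Rightarrow>
   real \<times> 'q \<times> real \<Rightarrow> (real \<times> 'q \<times> real) set" where
  "gw_causal_future ch T a b V \<equiv>
     causal_future (gw_points T) (gw_chart ch T) (gw_metric a b V) (gw_orientation V)"

abbreviation gw_distance ::
  "('q::t2_space \<Rightarrow> ('q, 'v::real_inner) chart) \<Rightarrow> real set \<Rightarrow>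
   (real \<Rightarrow> 'q \<Rightarrow> 'v \<Rightarrow> 'v \<Rightarrow> real) \<Rightarrow> (real \<Rightarrow> 'q \<Rightarrow> 'v \<Rightarrow> real) \<Rightarrow> (real \<Rightarrow> 'q \<Rightarrow> real) \<Rightarrow>
   real \<times> 'q \<times> real \<Rightarrow> real \<times> 'q \<times> real \<Rightarrow> ereal" where
  "gw_distance ch T a b V \<equiv>
     lorentzian_distance (gw_points T) (gw_chart ch T) (gw_metric a b V) (gw_orientation V)"


section \<open>Least action\<close>

definition lagrangian ::
  "(real \<Rightarrow> 'q \<Rightarrow> 'v \<Rightarrow> 'v \<Rightarrow> real) \<Rightarrow> (real \<Rightarrow> 'q \<Rightarrow> 'v \<Rightarrow> real) \<Rightarrow> (real \<Rightarrow> 'q \<Rightarrow> real) \<Rightarrow>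
   real \<Rightarrow> 'q \<Rightarrow> 'v \<Rightarrow> real" where
  "lagrangian a b V t q v = 1/2 * a t q v v + b t q v - V t q"

definition C1_paths ::
  "('q::t2_space \<Rightarrow> ('q, 'v::real_inner) chart) \<Rightarrow> real \<times> 'q \<Rightarrow> real \<times> 'q \<Rightarrow> (real \<Rightarrow> 'q) set" where
  "C1_paths ch e0 e1 =
     {q. C1_curve UNIV ch (fst e0) (fst e1) q \<and> q (fst e0) = snd e0 \<and> q (fst e1) = snd e1}"

definition action ::
  "('q::t2_space \<Rightarrow> ('q, 'v::real_inner) chart) \<Rightarrow>
   (real \<Rightarrow> 'q \<Rightarrow> 'v \<Rightarrow> 'v \<Rightarrow> real) \<Rightarrow> (real \<Rightarrow> 'q \<Rightarrow> 'v \<Rightarrow> real) \<Rightarrow> (real \<Rightarrow> 'q \<Rightarrow> real) \<Rightarrow>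
   real \<Rightarrow> real \<Rightarrow> (real \<Rightarrow> 'q) \<Rightarrow> real" where
  "action ch a b V t0 t1 q =
     integral {t0..t1} (\<lambda>t. lagrangian a b V t (q t) (velocity ch {t0..t1} q t))"

definition least_action ::
  "('q::t2_space \<Rightarrow> ('q, 'v::real_inner) chart) \<Rightarrow>
   (real \<Rightarrow> 'q \<Rightarrow> 'v \<Rightarrow> 'v \<Rightarrow> real) \<Rightarrow> (real \<Rightarrow> 'q \<Rightarrow> 'v \<Rightarrow> real) \<Rightarrow> (real \<Rightarrow> 'q \<Rightarrow> real) \<Rightarrow>
   real \<times> 'q \<Rightarrow> real \<times> 'q \<Rightarrow> ereal" where
  "least_action ch a b V e0 e1 =
     (if fst e0 < fst e1
        then INF q \<in> C1_paths ch e0 e1. ereal (action ch a b V (fst e0) (fst e1) q)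
      else if e0 = e1 then 0
      else \<infinity>)"

text \<open>
  Square root on the extended reals. Negative arguments are mapped to negative values (as \<open>sqrt\<close> does
  on the reals), so that an identity \<open>d = ereal_sqrt z\<close> with \<open>0 \<le> d\<close> includes \<open>0 \<le> z\<close>.
\<close>

definition ereal_sqrt :: "ereal \<Rightarrow> ereal" where
  "ereal_sqrt z = (case z of ereal x \<Rightarrow> ereal (sqrt x) | PInfty \<Rightarrow> \<infinity> | MInfty \<Rightarrow> - \<infinity>)"

end

theory Submission
  imports Defs
begin

text \<open>
  For a tangent vector \<open>\<tau> \<partial>\<^sub>t + v + \<eta> \<partial>\<^sub>y\<close> put \<open>P = \<eta> - b(v) + V \<tau>\<close>; then \<open>- g = 2 \<tau> P - a(v, v)\<close>, and the vector
  is future causal iff it is nonzero, \<open>\<tau> \<ge> 0\<close>, \<open>P \<ge> 0\<close> and \<open>a(v, v) \<le> 2 \<tau> P\<close>. If \<open>t\<close> is the parameter, this gives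
  \<open>- g = 2 (\<eta> - L)\<close>, so that the Cauchy-Schwarz inequality bounds \<open>l\<^sup>2\<close> by \<open>2 (t\<^sub>1 - t\<^sub>0) (y\<^sub>1 - y\<^sub>0 - \<S>[q])\<close>, with
  equality for the lift of \<open>q\<close> along which \<open>\<eta> - L\<close> is constant. The lifts give the lower bound for the
  distance.

  For the upper bound, a causal curve need not be a graph over \<open>t\<close>, since \<open>\<tau>\<close> may vanish, and it is only
  piecewise \<open>C\<^sup>1\<close>. It is first reparametrized so that it stops at the break points, which makes it \<open>C\<^sup>1\<close>.
  Then \<open>t\<close> is replaced by a nearby function with positive derivative. As \<open>v\<close> is controlled by
  \<open>a(v, v) \<le> 2 \<tau> P\<close>, this changes the action by an arbitrarily small amount, and Cauchy-Schwarz is used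
  in the form \<open>\<mu> l' \<le> l'\<^sup>2 / (2 \<tau>) + \<mu>\<^sup>2 \<tau> / 2\<close> with \<open>\<mu> = l / (t\<^sub>1 - t\<^sub>0)\<close>.
\<close>

section \<open>Finite-dimensional normed spaces\<close>

text \<open>The least action ranges over \<open>C^1\<close> curves, whereas causal curves may have
  corners, so the corners must be removed without loss of length. Stopping there does this but
  creates new zeros of \<open>\<tau>\<close>; others are unavoidable because
  \<open>\<partial>\<^sub>y\<close> is itself causal. The perturbation of t treats both kinds at
  once. Only the curve on Q and the end values of t enter the action, so the perturbed curve need
  not lift to a causal one.

  The delicate term is the kinetic one, in which a(v, v) is divided by a time derivative that may be
  as small as the perturbation. Causality bounds the quotient by P, so a relative error of the
  metric is harmless where an additive error would be magnified. The terms of b and V are not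
  divided, and additive errors suffice.

  The length is carried as a coordinate next to t and y, so that it follows reparametrizations and
  concatenations as y does. The inequality with \<mu> is linear in the derivative of l and therefore
  integrates to end values.

  Tangent spaces come with a finite basis only; bounded coordinates and a substitute for the unit
  sphere are built from it.\<close>

lemma compact_box_combinations:
  fixes B :: "'v::real_normed_vector set"
  assumes "finite B"
  shows "compact {\<Sum>b\<in>B. c b *\<^sub>R b | c. \<forall>b\<in>B. \<bar>c b\<bar> \<le> (1::real)}"
  using assms
proof (induction B)
  case empty
  then show ?case by simp
next
  case (insert x B)
  let ?S = "{\<Sum>b\<in>B. c b *\<^sub>R b | c. \<forall>b\<in>B. \<bar>c b\<bar> \<le> (1::real)}"
  have "{\<Sum>b\<in>insert x B. c b *\<^sub>R b | c. \<forall>b\<in>insert x B. \<bar>c b\<bar> \<le> (1::real)} =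
      (\<lambda>(r, u). r *\<^sub>R x + u) ` ({-1..1} \<times> ?S)" (is "?L = ?R")
  proof
    show "?L \<subseteq> ?R"
    proof
      fix u assume "u \<in> ?L"
      then obtain c where c: "u = (\<Sum>b\<in>insert x B. c b *\<^sub>R b)" "\<forall>b\<in>insert x B. \<bar>c b\<bar> \<le> 1"
        by blast
      have "u = (\<lambda>(r, u). r *\<^sub>R x + u) (c x, \<Sum>b\<in>B. c b *\<^sub>R b)"
        using c insert by simp
      moreover have "(c x, \<Sum>b\<in>B. c b *\<^sub>R b) \<in> {-1..1} \<times> ?S"
        using c by (auto simp: abs_le_iff)
      ultimately show "u \<in> ?R" by blast
    qed
    show "?R \<subseteq> ?L"
    proof
      fix u assume "u \<in> ?R"
      then obtain r c where c: "u = r *\<^sub>R x + (\<Sum>b\<in>B. c b *\<^sub>R b)" "\<bar>r\<bar> \<le> 1"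
          "\<forall>b\<in>B. \<bar>c b\<bar> \<le> 1"
        by (auto simp: abs_le_iff)
      have "(\<Sum>b\<in>B. (c(x := r)) b *\<^sub>R b) = (\<Sum>b\<in>B. c b *\<^sub>R b)"
        using insert by (intro sum.cong) auto
      then have "u = (\<Sum>b\<in>insert x B. (c(x := r)) b *\<^sub>R b)"
        using c insert by simp
      then show "u \<in> ?L" using c by (intro CollectI exI[of _ "c(x := r)"]) auto
    qed
  qed
  moreover have "compact ?R"
    using insert
    by (intro compact_continuous_image compact_Times) (auto simp: case_prod_unfold intro!: continuous_intros)
  ultimately show ?case by simp
qed

text \<open>\<open>F\<close> is the boundary of the coordinate cube; it plays the role of the unit sphere.\<close>

lemma compact_transversal:
  fixes B :: "'v::real_normed_vector set"
  assumes "finite B" "independent B" "span B = UNIV"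
  obtains F where "compact F" "0 \<notin> F" "\<And>u. u \<noteq> 0 \<Longrightarrow> \<exists>k>0. \<exists>f\<in>F. u = k *\<^sub>R f"
    "\<And>f b. f \<in> F \<Longrightarrow> b \<in> B \<Longrightarrow> \<bar>representation B f b\<bar> \<le> 1"
proof -
  define X where "X b = {\<Sum>b\<in>B - {b}. c b *\<^sub>R b | c. \<forall>b\<in>B - {b}. \<bar>c b\<bar> \<le> (1::real)}" for b
  \<comment> \<open>One face of the cube for each basis vector and sign: compactness is immediate in
    this form, while \<open>F_iff\<close> describes the same set by the condition that the largest
    coefficient has modulus 1.\<close>
  define F where "F = (\<Union>b\<in>B. \<Union>\<sigma>\<in>{1, -1::real}. (\<lambda>u. \<sigma> *\<^sub>R b + u) ` X b)"
  have F_iff: "f \<in> F \<longleftrightarrow> (\<exists>c. f = (\<Sum>b\<in>B. c b *\<^sub>R b) \<and> (\<forall>b\<in>B. \<bar>c b\<bar> \<le> 1) \<and> (\<exists>b\<in>B. \<bar>c b\<bar> = 1))"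
    (is "_ \<longleftrightarrow> ?P f") for f
  proof
    assume "f \<in> F"
    then obtain b \<sigma> x where b: "b \<in> B" "\<sigma> \<in> {1, -1}" "f = \<sigma> *\<^sub>R b + x" "x \<in> X b"
      unfolding F_def by blast
    then obtain c where "x = (\<Sum>b\<in>B - {b}. c b *\<^sub>R b)" "\<forall>b\<in>B - {b}. \<bar>c b\<bar> \<le> 1"
      unfolding X_def by blast
    with b have c: "b \<in> B" "\<bar>\<sigma>\<bar> = 1" "f = \<sigma> *\<^sub>R b + (\<Sum>b\<in>B - {b}. c b *\<^sub>R b)"
        "\<forall>b\<in>B - {b}. \<bar>c b\<bar> \<le> 1"
      by auto
    have "(\<Sum>e\<in>B - {b}. (c(b := \<sigma>)) e *\<^sub>R e) = (\<Sum>e\<in>B - {b}. c e *\<^sub>R e)"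
      by (intro sum.cong) auto
    then have "f = (\<Sum>e\<in>B. (c(b := \<sigma>)) e *\<^sub>R e)"
      using c assms by (simp add: sum.remove[of B b])
    then show "?P f" using c by (intro exI[of _ "c(b := \<sigma>)"]) auto
  next
    assume "?P f"
    then obtain c b where c: "f = (\<Sum>b\<in>B. c b *\<^sub>R b)" "\<forall>b\<in>B. \<bar>c b\<bar> \<le> 1" "b \<in> B" "\<bar>c b\<bar> = 1" by blast
    have "f = c b *\<^sub>R b + (\<Sum>b\<in>B - {b}. c b *\<^sub>R b)"
      using c assms by (simp add: sum.remove)
    moreover have "(\<Sum>b\<in>B - {b}. c b *\<^sub>R b) \<in> X b" using c by (auto simp: X_def)
    moreover have "c b \<in> {1, -1}" using c by auto
    ultimately show "f \<in> F" unfolding F_def using c(3) by blast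
  qed
  have rep: "representation B (\<Sum>e\<in>B. c e *\<^sub>R e) b = c b" if "b \<in> B" for c b
  proof -
    let ?u = "\<Sum>e\<in>B. c e *\<^sub>R e"
    have "(\<Sum>e\<in>B. representation B ?u e *\<^sub>R e) = ?u"
      using assms by (intro real_vector.sum_representation_eq) auto
    then have "(\<Sum>e\<in>B. (representation B ?u e - c e) *\<^sub>R e) = 0"
      by (simp add: scaleR_diff_left sum_subtractf)
    from independentD[OF assms(2,1) order_refl this that] show ?thesis by simp
  qed
  show thesis
  proof
    have "compact (X b)" for b unfolding X_def using assms by (intro compact_box_combinations) auto
    then show "compact F" unfolding F_def using assms
      by (intro compact_UN compact_continuous_image) (auto intro!: continuous_intros)
    show "\<bar>representation B f b\<bar> \<le> 1" if "f \<in> F" "b \<in> B" for f b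
      using that rep by (auto simp: F_iff)
    show "0 \<notin> F"
    proof
      assume "0 \<in> F"
      then obtain c b where c: "0 = (\<Sum>b\<in>B. c b *\<^sub>R b)" "b \<in> B" "\<bar>c b\<bar> = 1" by (auto simp: F_iff)
      then show False using rep[of b c] by (simp add: real_vector.representation_zero)
    qed
    show "\<exists>k>0. \<exists>f\<in>F. u = k *\<^sub>R f" if "u \<noteq> 0" for u
    proof -
      define c where "c = representation B u"
      have u: "u = (\<Sum>b\<in>B. c b *\<^sub>R b)"
        using assms by (simp add: c_def real_vector.sum_representation_eq)
      have "\<exists>b\<in>B. c b \<noteq> 0"
      proof (rule ccontr)
        assume "\<not> ?thesis"
        then have "(\<Sum>b\<in>B. c b *\<^sub>R b) = 0" by (intro sum.neutral) auto
        with u that show False by simp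
      qed
      then obtain b where b: "b \<in> B" "c b \<noteq> 0" by blast
      \<comment> \<open>The maximum norm of the coordinates; dividing by it moves \<open>u\<close>
        to the boundary of the cube.\<close>
      define k where "k = Max ((\<lambda>b. \<bar>c b\<bar>) ` B)"
      have le: "\<bar>c b\<bar> \<le> k" if "b \<in> B" for b unfolding k_def using that assms by auto
      have "k \<in> (\<lambda>b. \<bar>c b\<bar>) ` B" unfolding k_def using assms b by (intro Max_in) auto
      then obtain b' where b': "b' \<in> B" "\<bar>c b'\<bar> = k" by auto
      have k: "k > 0" using le[OF b(1)] b(2) by linarith
      have "u = k *\<^sub>R (\<Sum>b\<in>B. (c b / k) *\<^sub>R b)"
        by (subst u) (use k in \<open>simp add: scaleR_sum_right\<close>)
      moreover have "(\<Sum>b\<in>B. (c b / k) *\<^sub>R b) \<in> F"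
        unfolding F_iff using b' k le by (intro exI[of _ "\<lambda>b. c b / k"]) auto
      ultimately show ?thesis using k by blast
    qed
  qed
qed

text \<open>On \<open>F\<close> the coordinates are bounded by 1 and the norm by some m > 0 from
  below. Scaling extends the resulting bound 1/m to all vectors.\<close>

lemma bounded_linear_representation:
  fixes B :: "'v::real_normed_vector set"
  assumes "finite B" "independent B" "span B = UNIV"
  shows "bounded_linear (\<lambda>u. representation B u b)"
proof (cases "b \<in> B")
  case False
  then have "(\<lambda>u. representation B u b) = (\<lambda>u. 0)"
    using real_vector.representation_ne_zero by fastforce
  then show ?thesis by simp
next
  case True
  obtain F where F: "compact F" "0 \<notin> F" "\<And>u. u \<noteq> 0 \<Longrightarrow> \<exists>k>0. \<exists>f\<in>F. u = k *\<^sub>R f"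
    "\<And>f b. f \<in> F \<Longrightarrow> b \<in> B \<Longrightarrow> \<bar>representation B f b\<bar> \<le> 1"
    using compact_transversal[OF assms] by metis
  have "\<exists>m>0. \<forall>f\<in>F. m \<le> norm f"
  proof (cases "F = {}")
    case False
    then obtain f0 where "f0 \<in> F" "\<forall>f\<in>F. norm f0 \<le> norm f"
      using continuous_attains_inf[OF F(1), of norm] continuous_on_norm_id by blast
    then show ?thesis using F(2) by (intro exI[of _ "norm f0"]) auto
  qed (auto intro: exI[of _ 1])
  then obtain m where m: "m > 0" "\<And>f. f \<in> F \<Longrightarrow> m \<le> norm f" by blast
  have scale: "representation B (k *\<^sub>R u) b = k * representation B u b" for k u
    using assms by (simp add: real_vector.representation_scale)
  show ?thesis
  proof (rule bounded_linear_intro[of _ "1 / m"])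
    show "representation B (x + y) b = representation B x b + representation B y b" for x y
      using assms by (simp add: real_vector.representation_add)
    show "representation B (k *\<^sub>R u) b = k *\<^sub>R representation B u b" for k u
      using scale by simp
    show "norm (representation B x b) \<le> norm x * (1 / m)" for x
    proof (cases "x = 0")
      case True then show ?thesis by (simp add: real_vector.representation_zero)
    next
      case False
      then obtain k f where k: "k > 0" "f \<in> F" "x = k *\<^sub>R f" using F(3) by blast
      have "\<bar>representation B x b\<bar> * m \<le> k * 1 * norm f"
        unfolding k(3) scale abs_mult using k m F(4)[OF k(2) True]
        by (intro mult_mono) auto
      then show ?thesis using k m by (simp add: field_simps)
    qed
  qed
qed

text \<open>Expanding \<open>g x\<close> in the basis turns the value into a finite sum of products
  of continuous functions, so continuity on fixed vectors is enough.\<close>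

lemma continuous_on_linear_family:
  fixes f :: "'x::topological_space \<Rightarrow> 'v::real_normed_vector \<Rightarrow> real"
  assumes B: "finite B" "independent B" "span B = (UNIV :: 'v set)"
    and lin: "\<And>x. x \<in> X \<Longrightarrow> linear (f x)"
    and cont: "\<And>u. continuous_on X (\<lambda>x. f x u)"
    and g: "continuous_on X g"
  shows "continuous_on X (\<lambda>x. f x (g x))"
proof -
  have "f x (g x) = (\<Sum>b\<in>B. representation B (g x) b * f x b)" if "x \<in> X" for x
  proof -
    have "f x (g x) = f x (\<Sum>b\<in>B. representation B (g x) b *\<^sub>R b)"
      using B by (simp add: real_vector.sum_representation_eq)
    then show ?thesis
      using lin[OF that] by (simp add: linear_sum linear_cmul)
  qed
  moreover have "continuous_on X (\<lambda>x. \<Sum>b\<in>B. representation B (g x) b * f x b)"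
    using bounded_linear.continuous_on[OF bounded_linear_representation[OF B] g] cont
    by (intro continuous_intros) auto
  ultimately show ?thesis by (simp cong: continuous_on_cong)
qed

section \<open>Curves of class \<open>C\<^sup>1\<close>\<close>

text \<open>Two sets are needed: derivatives are taken within the parameter interval
  \<open>I\<close>, hence one-sided at its ends, but only at the parameters in \<open>S\<close>
  where the curve lies in a given chart.\<close>

definition C1_on :: "real set \<Rightarrow> real set \<Rightarrow> (real \<Rightarrow> 'b::real_normed_vector) \<Rightarrow> bool" where
  "C1_on I S f \<longleftrightarrow> (\<forall>s\<in>S. f differentiable (at s within I)) \<and>
     continuous_on S (\<lambda>s. vector_derivative f (at s within I))"

lemma C1_curve_iff:
  "C1_curve M ch \<alpha> \<beta> \<gamma> \<longleftrightarrow> \<gamma> ` {\<alpha>..\<beta>} \<subseteq> M \<and> continuous_on {\<alpha>..\<beta>} \<gamma> \<and>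
     (\<forall>p\<in>M. C1_on {\<alpha>..\<beta>} {s\<in>{\<alpha>..\<beta>}. \<gamma> s \<in> chart_dom (ch p)} (chart_map (ch p) \<circ> \<gamma>))"
  by (simp add: C1_curve_def C1_on_def Let_def)

lemma vector_derivative_within_Icc:
  assumes "\<alpha> < \<beta>" "s \<in> {\<alpha>..\<beta>}" "(f has_vector_derivative w) (at s within {\<alpha>..\<beta>})"
  shows "vector_derivative f (at s within {\<alpha>..\<beta>}) = w"
  using vector_derivative_within_cbox[of \<alpha> \<beta> s f w] assms by simp

lemma vector_derivative_within_cong:
  assumes "\<And>x. x \<in> I \<Longrightarrow> f x = g x" "s \<in> I"
  shows "vector_derivative f (at s within I) = vector_derivative g (at s within I)"
proof -
  have "(f has_vector_derivative w) (at s within I) \<longleftrightarrow> (g has_vector_derivative w) (at s within I)" for w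
    using assms by (metis has_vector_derivative_transform)
  then show ?thesis by (simp add: vector_derivative_def)
qed

lemma C1_onI:
  assumes "\<alpha> < \<beta>" "S \<subseteq> {\<alpha>..\<beta>}"
    "\<And>s. s \<in> S \<Longrightarrow> (f has_vector_derivative w s) (at s within {\<alpha>..\<beta>})" "continuous_on S w"
  shows "C1_on {\<alpha>..\<beta>} S f"
proof -
  have "vector_derivative f (at s within {\<alpha>..\<beta>}) = w s" if "s \<in> S" for s
    using vector_derivative_within_Icc[OF assms(1) _ assms(3)[OF that]] assms(2) that by blast
  moreover have "f differentiable (at s within {\<alpha>..\<beta>})" if "s \<in> S" for s
    using assms(3)[OF that] differentiableI_vector by blast
  ultimately show ?thesis
    using assms(4) by (simp add: C1_on_def cong: continuous_on_cong)
qed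

lemma C1_on_has_vector_derivative:
  assumes "C1_on I S f" "s \<in> S"
  shows "(f has_vector_derivative vector_derivative f (at s within I)) (at s within I)"
  using assms vector_derivative_works by (auto simp: C1_on_def)

lemma C1_on_cong:
  assumes "\<And>s. s \<in> {\<alpha>..\<beta>} \<Longrightarrow> f s = g s" "S \<subseteq> {\<alpha>..\<beta>}" "\<alpha> < \<beta>" "C1_on {\<alpha>..\<beta>} S f"
  shows "C1_on {\<alpha>..\<beta>} S g"
proof (rule C1_onI[where w = "\<lambda>s. vector_derivative f (at s within {\<alpha>..\<beta>})"])
  show "(g has_vector_derivative vector_derivative f (at s within {\<alpha>..\<beta>})) (at s within {\<alpha>..\<beta>})"
    if "s \<in> S" for s
    by (rule has_vector_derivative_transform[OF _ _ C1_on_has_vector_derivative[OF assms(4) that]])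
      (use assms(1,2) that in auto)
qed (use assms in \<open>auto simp: C1_on_def\<close>)

lemma C1_on_subset: "C1_on I S f \<Longrightarrow> R \<subseteq> S \<Longrightarrow> C1_on I R f"
  by (auto simp: C1_on_def intro: continuous_on_subset)

lemma C1_on_compose:
  assumes "C1_on I S f" "\<alpha> < \<beta>" "h ` {\<alpha>..\<beta>} \<subseteq> I" "C1_on {\<alpha>..\<beta>} {\<alpha>..\<beta>} h"
  shows "C1_on {\<alpha>..\<beta>} {u\<in>{\<alpha>..\<beta>}. h u \<in> S} (f \<circ> h)"
    and "u \<in> {\<alpha>..\<beta>} \<Longrightarrow> h u \<in> S \<Longrightarrow> vector_derivative (f \<circ> h) (at u within {\<alpha>..\<beta>}) =
      vector_derivative h (at u within {\<alpha>..\<beta>}) *\<^sub>R vector_derivative f (at (h u) within I)"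
proof -
  let ?h' = "\<lambda>u. vector_derivative h (at u within {\<alpha>..\<beta>})"
  let ?f' = "\<lambda>s. vector_derivative f (at s within I)"
  have *: "((f \<circ> h) has_vector_derivative ?h' u *\<^sub>R ?f' (h u)) (at u within {\<alpha>..\<beta>})"
    if "u \<in> {\<alpha>..\<beta>}" "h u \<in> S" for u
  proof (rule vector_diff_chain_within)
    show "(h has_vector_derivative ?h' u) (at u within {\<alpha>..\<beta>})"
      using C1_on_has_vector_derivative[OF assms(4)] that by blast
    show "(f has_vector_derivative ?f' (h u)) (at (h u) within h ` {\<alpha>..\<beta>})"
      using C1_on_has_vector_derivative[OF assms(1) that(2)] assms(3)
        has_vector_derivative_within_subset by blast
  qed
  have "continuous_on {\<alpha>..\<beta>} h"
    using C1_on_has_vector_derivative[OF assms(4)]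
    by (meson continuous_on_eq_continuous_within has_vector_derivative_continuous)
  then have "continuous_on {u\<in>{\<alpha>..\<beta>}. h u \<in> S} h" by (rule continuous_on_subset) auto
  then have "continuous_on {u\<in>{\<alpha>..\<beta>}. h u \<in> S} (\<lambda>u. ?f' (h u))"
    using assms(1) by (intro continuous_on_compose2[of S ?f' _ h]) (auto simp: C1_on_def)
  moreover have "continuous_on {u\<in>{\<alpha>..\<beta>}. h u \<in> S} ?h'"
    using assms(4) by (auto simp: C1_on_def intro: continuous_on_subset)
  ultimately show "C1_on {\<alpha>..\<beta>} {u\<in>{\<alpha>..\<beta>}. h u \<in> S} (f \<circ> h)"
    using * by (intro C1_onI[OF assms(2), where w = "\<lambda>u. ?h' u *\<^sub>R ?f' (h u)"] continuous_intros) auto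
  show "vector_derivative (f \<circ> h) (at u within {\<alpha>..\<beta>}) = ?h' u *\<^sub>R ?f' (h u)"
    if "u \<in> {\<alpha>..\<beta>}" "h u \<in> S"
    using vector_derivative_within_Icc[OF assms(2) that(1) *[OF that]] .
qed

lemma C1_on_imp_continuous_on: "C1_on I S f \<Longrightarrow> S \<subseteq> I \<Longrightarrow> continuous_on S f"
  by (metis C1_on_has_vector_derivative continuous_on_eq_continuous_within continuous_within_subset
      has_vector_derivative_continuous)

lemma C1_curve_compose:
  assumes "C1_curve M ch \<alpha> \<beta> \<gamma>" "\<alpha>' < \<beta>'" "h ` {\<alpha>'..\<beta>'} \<subseteq> {\<alpha>..\<beta>}" "C1_on {\<alpha>'..\<beta>'} {\<alpha>'..\<beta>'} h"
  shows "C1_curve M ch \<alpha>' \<beta>' (\<gamma> \<circ> h)"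
  unfolding C1_curve_iff
proof (intro conjI ballI)
  show "(\<gamma> \<circ> h) ` {\<alpha>'..\<beta>'} \<subseteq> M" using assms by (fastforce simp: C1_curve_iff)
  have "continuous_on {\<alpha>'..\<beta>'} h" using C1_on_imp_continuous_on[OF assms(4)] by simp
  then show "continuous_on {\<alpha>'..\<beta>'} (\<gamma> \<circ> h)"
    using assms by (intro continuous_on_compose) (auto simp: C1_curve_iff intro: continuous_on_subset)
  fix p assume "p \<in> M"
  then have 1: "C1_on {\<alpha>..\<beta>} {s\<in>{\<alpha>..\<beta>}. \<gamma> s \<in> chart_dom (ch p)} (chart_map (ch p) \<circ> \<gamma>)"
    using assms by (auto simp: C1_curve_iff)
  have "{u\<in>{\<alpha>'..\<beta>'}. (\<gamma> \<circ> h) u \<in> chart_dom (ch p)} =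
      {u\<in>{\<alpha>'..\<beta>'}. h u \<in> {s\<in>{\<alpha>..\<beta>}. \<gamma> s \<in> chart_dom (ch p)}}"
    using assms(3) by (auto simp: image_subset_iff)
  then show "C1_on {\<alpha>'..\<beta>'} {u\<in>{\<alpha>'..\<beta>'}. (\<gamma> \<circ> h) u \<in> chart_dom (ch p)} (chart_map (ch p) \<circ> (\<gamma> \<circ> h))"
    using C1_on_compose(1)[OF 1 assms(2-4)] by (simp add: comp_assoc)
qed

text \<open>Both velocities are read in the chart at the same point of the manifold, so no
  transition map enters the chain rule.\<close>

lemma velocity_compose:
  assumes "C1_curve M ch \<alpha> \<beta> \<gamma>" "\<alpha>' < \<beta>'" "h ` {\<alpha>'..\<beta>'} \<subseteq> {\<alpha>..\<beta>}" "C1_on {\<alpha>'..\<beta>'} {\<alpha>'..\<beta>'} h"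
    and "u \<in> {\<alpha>'..\<beta>'}" "\<gamma> (h u) \<in> chart_dom (ch (\<gamma> (h u)))"
  shows "velocity ch {\<alpha>'..\<beta>'} (\<gamma> \<circ> h) u =
    vector_derivative h (at u within {\<alpha>'..\<beta>'}) *\<^sub>R velocity ch {\<alpha>..\<beta>} \<gamma> (h u)"
proof -
  let ?p = "\<gamma> (h u)"
  have "?p \<in> M" using assms by (auto simp: C1_curve_iff image_subset_iff)
  then have 1: "C1_on {\<alpha>..\<beta>} {s\<in>{\<alpha>..\<beta>}. \<gamma> s \<in> chart_dom (ch ?p)} (chart_map (ch ?p) \<circ> \<gamma>)"
    using assms by (auto simp: C1_curve_iff)
  have "h u \<in> {\<alpha>..\<beta>}" using assms(3,5) by blast
  with C1_on_compose(2)[OF 1 assms(2-4) assms(5)] assms(6) show ?thesis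
    by (simp add: velocity_def comp_assoc)
qed

section \<open>Gluing at an interior parameter, and locality of continuity\<close>

lemma has_vector_derivative_glue:
  assumes "\<alpha> \<le> m" "m \<le> \<beta>" "s \<in> {\<alpha>..\<beta>}"
    and "s \<le> m \<Longrightarrow> (f has_vector_derivative w) (at s within {\<alpha>..m})"
    and "m \<le> s \<Longrightarrow> (f has_vector_derivative w) (at s within {m..\<beta>})"
  shows "(f has_vector_derivative w) (at s within {\<alpha>..\<beta>::real})"
proof -
  consider "s < m" | "s > m" | "s = m" by linarith
  then show ?thesis
  proof cases
    case 1
    have "at s within {\<alpha>..\<beta>} = at s within {\<alpha>..m}"
      using 1 assms by (intro at_within_nhd[of s "{..<m}"]) auto
    then show ?thesis using assms 1 by simp
  next
    case 2
    have "at s within {\<alpha>..\<beta>} = at s within {m..\<beta>}"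
      using 2 assms by (intro at_within_nhd[of s "{m<..}"]) auto
    then show ?thesis using assms 2 by simp
  next
    case 3
    have "{\<alpha>..\<beta>} = {\<alpha>..m} \<union> {m..\<beta>}" using assms by auto
    moreover have "(f has_vector_derivative w) (at s within {\<alpha>..m} \<union> {m..\<beta>})"
      using 3 assms(4,5) unfolding has_vector_derivative_def has_derivative_iff_norm Lim_within_Un by simp
    ultimately show ?thesis by simp
  qed
qed

text \<open>The values agree at \<open>m\<close> because \<open>f\<close> is one function, so only
  the one-sided derivatives have to match, and only if \<open>m\<close> belongs to \<open>S\<close>;
  a chart may miss the junction.\<close>

lemma C1_on_glue:
  assumes "\<alpha> < m" "m < \<beta>" "S \<subseteq> {\<alpha>..\<beta>}"
    and f1: "C1_on {\<alpha>..m} {s\<in>S. s \<le> m} f" and f2: "C1_on {m..\<beta>} {s\<in>S. m \<le> s} f"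
    and eq: "m \<in> S \<Longrightarrow> vector_derivative f (at m within {\<alpha>..m}) = vector_derivative f (at m within {m..\<beta>})"
  shows "C1_on {\<alpha>..\<beta>} S f"
    and "s \<in> S \<Longrightarrow> s \<le> m \<Longrightarrow> vector_derivative f (at s within {\<alpha>..\<beta>}) = vector_derivative f (at s within {\<alpha>..m})"
    and "s \<in> S \<Longrightarrow> m \<le> s \<Longrightarrow> vector_derivative f (at s within {\<alpha>..\<beta>}) = vector_derivative f (at s within {m..\<beta>})"
proof -
  let ?w1 = "\<lambda>s. vector_derivative f (at s within {\<alpha>..m})"
  let ?w2 = "\<lambda>s. vector_derivative f (at s within {m..\<beta>})"
  let ?w = "\<lambda>s. if s \<le> m then ?w1 s else ?w2 s"
  have d: "(f has_vector_derivative ?w s) (at s within {\<alpha>..\<beta>})" if "s \<in> S" for s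
  proof (rule has_vector_derivative_glue[of _ m])
    show "(f has_vector_derivative ?w s) (at s within {\<alpha>..m})" if "s \<le> m"
      using C1_on_has_vector_derivative[OF f1, of s] \<open>s \<in> S\<close> that by auto
    show "(f has_vector_derivative ?w s) (at s within {m..\<beta>})" if "m \<le> s"
      using C1_on_has_vector_derivative[OF f2, of s] \<open>s \<in> S\<close> that eq by (cases "s = m") auto
  qed (use assms that in auto)
  have "continuous_on S ?w"
    using f1 f2 eq
    by (intro continuous_on_cases_le[where h = "\<lambda>s. s"]) (auto simp: C1_on_def)
  then show "C1_on {\<alpha>..\<beta>} S f"
    using d assms by (intro C1_onI[where w = ?w]) auto
  have vd: "vector_derivative f (at s within {\<alpha>..\<beta>}) = ?w s" if "s \<in> S" for s
    using vector_derivative_within_Icc[OF _ _ d[OF that]] assms that by fastforce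
  show "vector_derivative f (at s within {\<alpha>..\<beta>}) = ?w1 s" if "s \<in> S" "s \<le> m"
    using vd that by simp
  show "vector_derivative f (at s within {\<alpha>..\<beta>}) = ?w2 s" if "s \<in> S" "m \<le> s"
    using vd[OF that(1)] that eq by (cases "s = m") auto
qed

lemma continuous_on_locally:
  fixes f :: "'x::t2_space \<Rightarrow> 'y::topological_space"
  assumes "\<And>x. x \<in> X \<Longrightarrow> \<exists>U. openin (top_of_set X) U \<and> x \<in> U \<and> continuous_on U f"
  shows "continuous_on X f"
  unfolding continuous_on_eq_continuous_within
proof
  fix x assume x: "x \<in> X"
  obtain U where U: "openin (top_of_set X) U" "x \<in> U" "continuous_on U f" using assms[OF x] by blast
  then obtain W where W: "open W" "U = X \<inter> W" by (auto simp: openin_open)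
  have "at x within X = at x within U"
    using U W by (intro at_within_nhd[of x W]) auto
  then show "continuous (at x within X) f"
    using U by (metis continuous_on_eq_continuous_within)
qed

section \<open>Charts and velocities\<close>

lemma Ck_on_imp_continuous_on: "Ck_on k f S \<Longrightarrow> continuous_on S f"
  by (cases k) (auto simp: continuous_on_eq_continuous_within
      intro: continuous_at_imp_continuous_at_within differentiable_imp_continuous_within)

locale gw_spacetime =
  fixes d r :: nat
    and ch :: "'q::t2_space \<Rightarrow> ('q, 'v::real_inner) chart"
    and T :: "real set"
    and a :: "real \<Rightarrow> 'q \<Rightarrow> 'v \<Rightarrow> 'v \<Rightarrow> real"
    and b :: "real \<Rightarrow> 'q \<Rightarrow> 'v \<Rightarrow> real"
    and V :: "real \<Rightarrow> 'q \<Rightarrow> real"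
  assumes gw: "gw_data d r ch T a b V"
begin

abbreviation "cdom p \<equiv> chart_dom (ch p)"
abbreviation "cmap p \<equiv> chart_map (ch p)"
abbreviation "cinv p \<equiv> chart_inv (ch p)"
abbreviation "toc \<equiv> tangent_of_components ch"

abbreviation comp_velocity :: "'q \<Rightarrow> real set \<Rightarrow> (real \<Rightarrow> 'q) \<Rightarrow> real \<Rightarrow> 'v" where
  "comp_velocity p I \<gamma> s \<equiv> vector_derivative (cmap p \<circ> \<gamma>) (at s within I)"

lemma manifold: "Ck_manifold d (r + 1) ch"
  using gw by (simp add: gw_data_def)

lemma finite_basis: "\<exists>B::'v set. finite B \<and> independent B \<and> span B = UNIV"
  using manifold by (auto simp: Ck_manifold_def)

lemma chart_around: "p \<in> cdom p" and open_dom: "open (cdom p)"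
  and open_image: "open (cmap p ` cdom p)"
  and chart_homeo: "homeomorphism (cdom p) (cmap p ` cdom p) (cmap p) (cinv p)"
  using manifold by (auto simp: Ck_manifold_def)

lemma cinv_cmap: "q \<in> cdom p \<Longrightarrow> cinv p (cmap p q) = q"
  using chart_homeo by (auto simp: homeomorphism_def)

lemma continuous_on_cmap: "continuous_on (cdom p) (cmap p)"
  using chart_homeo by (auto simp: homeomorphism_def)

lemma transition_differentiable:
  assumes "q \<in> cdom p" "q \<in> cdom p'"
  shows "(cmap p' \<circ> cinv p) differentiable (at (cmap p q))"
proof -
  have "Ck_on (Suc r) (cmap p' \<circ> cinv p) (cmap p ` (cdom p \<inter> cdom p'))"
    using manifold by (auto simp: Ck_manifold_def)
  then show ?thesis using assms by auto
qed

lemma linear_toc: "q \<in> cdom p \<Longrightarrow> linear (toc p q)"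
  unfolding tangent_of_components_def
  using linear_frechet_derivative transition_differentiable chart_around by blast

lemma toc_self: "toc p p u = u"
proof -
  have "((\<lambda>x. x) has_derivative (\<lambda>x. x)) (at (cmap p p))" by simp
  then have "((cmap p \<circ> cinv p) has_derivative (\<lambda>x. x)) (at (cmap p p))"
    by (rule has_derivative_transform_within_open[OF _ open_image])
      (use chart_around cinv_cmap in auto)
  then have "(\<lambda>x. x) = frechet_derivative (cmap p \<circ> cinv p) (at (cmap p p))"
    by (rule frechet_derivative_at)
  then show ?thesis by (simp add: tangent_of_components_def flip: fun_cong[of "\<lambda>x. x"])
qed

lemma interval_T: "is_interval T"
  using gw by (auto simp: gw_data_def)

lemma bilinear_a: "t \<in> T \<Longrightarrow> bilinear (a t q)" and a_pos: "t \<in> T \<Longrightarrow> u \<noteq> 0 \<Longrightarrow> 0 < a t q u u"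
  and linear_b: "t \<in> T \<Longrightarrow> linear (b t q)"
  using gw by (auto simp: gw_data_def)

lemma a_scale: "t \<in> T \<Longrightarrow> a t q (c *\<^sub>R u) (c *\<^sub>R u) = c\<^sup>2 * a t q u u"
  using bilinear_lmul[OF bilinear_a] bilinear_rmul[OF bilinear_a] by (simp add: power2_eq_square)

lemma a_zero: "t \<in> T \<Longrightarrow> a t q 0 0 = 0"
  using a_scale[of t q 0 0] by simp

lemma a_nonneg: "t \<in> T \<Longrightarrow> 0 \<le> a t q u u"
  using a_pos[of t u q] a_zero[of t q] by (cases "u = 0") (auto intro: less_imp_le)

lemma b_scale: "t \<in> T \<Longrightarrow> b t q (c *\<^sub>R u) = c * b t q u"
  using linear_cmul[OF linear_b] by simp

section \<open>Continuity of metric, one-form and potential along curves\<close>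

lemma pullback_continuous:
  assumes "continuous_on X \<tau>" "continuous_on X Q" "\<tau> ` X \<subseteq> T" "Q ` X \<subseteq> cdom p"
    and "continuous_on (T \<times> cmap p ` cdom p) f"
  shows "continuous_on X (\<lambda>x. f (\<tau> x, cmap p (Q x)))"
proof -
  have "continuous_on X (\<lambda>x. cmap p (Q x))"
    using assms by (intro continuous_on_compose2[OF continuous_on_cmap]) auto
  then show ?thesis
    using assms by (intro continuous_on_compose2[OF assms(5)] continuous_intros) auto
qed

text \<open>The regularity of the data is stated for constant components in the chart
  \<open>p\<close>. Linearity of \<open>toc\<close> and of the forms lets the components vary
  continuously; for \<open>a\<close> the argument is applied to one slot at a time.\<close>

lemma
  assumes X: "continuous_on X \<tau>" "continuous_on X Q" "\<tau> ` X \<subseteq> T" "Q ` X \<subseteq> cdom p"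
  shows continuous_on_a_toc: "continuous_on X u \<Longrightarrow> continuous_on X w \<Longrightarrow>
      continuous_on X (\<lambda>x. a (\<tau> x) (Q x) (toc p (Q x) (u x)) (toc p (Q x) (w x)))"
    and continuous_on_b_toc: "continuous_on X u \<Longrightarrow>
      continuous_on X (\<lambda>x. b (\<tau> x) (Q x) (toc p (Q x) (u x)))"
    and continuous_on_V: "continuous_on X (\<lambda>x. V (\<tau> x) (Q x))"
proof -
  obtain B :: "'v set" where B: "finite B" "independent B" "span B = UNIV" using finite_basis by blast
  have reg: "Ck_on r (\<lambda>(t, x). a t (cinv p x) (toc p (cinv p x) u) (toc p (cinv p x) w)) (T \<times> cmap p ` cdom p)"
     "Ck_on r (\<lambda>(t, x). b t (cinv p x) (toc p (cinv p x) u)) (T \<times> cmap p ` cdom p)"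
     "Ck_on r (\<lambda>(t, x). V t (cinv p x)) (T \<times> cmap p ` cdom p)" for u w
    using gw by (simp_all add: gw_data_def Let_def)
  note C = pullback_continuous[OF X Ck_on_imp_continuous_on[OF reg(1)]]
    pullback_continuous[OF X Ck_on_imp_continuous_on[OF reg(2)]]
    pullback_continuous[OF X Ck_on_imp_continuous_on[OF reg(3)]]
  have Q: "cinv p (cmap p (Q x)) = Q x" "\<tau> x \<in> T" "Q x \<in> cdom p" if "x \<in> X" for x
    using X that cinv_cmap by auto
  have a0: "continuous_on X (\<lambda>x. a (\<tau> x) (Q x) (toc p (Q x) u) (toc p (Q x) w))" for u w
    using C(1)[of u w] Q by (simp cong: continuous_on_cong)
  have b0: "continuous_on X (\<lambda>x. b (\<tau> x) (Q x) (toc p (Q x) u))" for u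
    using C(2)[of u] Q by (simp cong: continuous_on_cong)
  show "continuous_on X (\<lambda>x. V (\<tau> x) (Q x))"
    using C(3) Q by (simp cong: continuous_on_cong)
  show "continuous_on X (\<lambda>x. b (\<tau> x) (Q x) (toc p (Q x) (u x)))" if "continuous_on X u"
    by (rule continuous_on_linear_family[OF B _ b0 that])
      (use Q linear_b linear_toc linear_compose[unfolded o_def] in blast)
  have lin1: "linear (\<lambda>u. a (\<tau> x) (Q x) (toc p (Q x) u) w)" "linear (\<lambda>u. a (\<tau> x) (Q x) w (toc p (Q x) u))"
    if "x \<in> X" for x w
    using linear_compose[OF linear_toc[OF Q(3)[OF that]], unfolded o_def] bilinear_a[OF Q(2)[OF that], of "Q x"]
    by (auto simp: bilinear_def)
  show "continuous_on X (\<lambda>x. a (\<tau> x) (Q x) (toc p (Q x) (u x)) (toc p (Q x) (w x)))"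
    if u: "continuous_on X u" and w: "continuous_on X w"
  proof (rule continuous_on_linear_family[OF B lin1(2) _ w])
    show "continuous_on X (\<lambda>x. a (\<tau> x) (Q x) (toc p (Q x) (u x)) (toc p (Q x) w'))" for w'
      by (rule continuous_on_linear_family[OF B lin1(1) a0 u])
  qed
qed

lemma
  assumes "C1_curve UNIV ch \<alpha> \<beta> \<gamma>"
  shows curve_continuous: "continuous_on {\<alpha>..\<beta>} \<gamma>"
    and curve_C1_on: "C1_on {\<alpha>..\<beta>} {s\<in>{\<alpha>..\<beta>}. \<gamma> s \<in> cdom p} (cmap p \<circ> \<gamma>)"
    and openin_curve_dom: "openin (top_of_set {\<alpha>..\<beta>}) {s\<in>{\<alpha>..\<beta>}. \<gamma> s \<in> cdom p}"
proof -
  show c: "continuous_on {\<alpha>..\<beta>} \<gamma>" and "C1_on {\<alpha>..\<beta>} {s\<in>{\<alpha>..\<beta>}. \<gamma> s \<in> cdom p} (cmap p \<circ> \<gamma>)"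
    using assms by (auto simp: C1_curve_iff)
  show "openin (top_of_set {\<alpha>..\<beta>}) {s\<in>{\<alpha>..\<beta>}. \<gamma> s \<in> cdom p}"
    using continuous_openin_preimage_gen[OF c open_dom, of p] by (simp add: vimage_def Int_def)
qed

lemma comp_velocity_transition:
  assumes "C1_curve UNIV ch \<alpha> \<beta> \<gamma>" "\<alpha> < \<beta>" "s \<in> {\<alpha>..\<beta>}" "\<gamma> s \<in> cdom p" "\<gamma> s \<in> cdom p'"
  shows "comp_velocity p' {\<alpha>..\<beta>} \<gamma> s =
    frechet_derivative (cmap p' \<circ> cinv p) (at (cmap p (\<gamma> s))) (comp_velocity p {\<alpha>..\<beta>} \<gamma> s)"
proof -
  let ?I = "{\<alpha>..\<beta>}"
  let ?\<phi> = "cmap p' \<circ> cinv p"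
  let ?D = "frechet_derivative ?\<phi> (at (cmap p (\<gamma> s)))"
  have "(?\<phi> has_derivative ?D) (at ((cmap p \<circ> \<gamma>) s) within (cmap p \<circ> \<gamma>) ` ?I)"
    using transition_differentiable[OF assms(4,5)]
    by (auto simp: frechet_derivative_works intro: has_derivative_at_withinI)
  moreover have "((cmap p \<circ> \<gamma>) has_vector_derivative comp_velocity p ?I \<gamma> s) (at s within ?I)"
    using C1_on_has_vector_derivative[OF curve_C1_on[OF assms(1), of p]] assms by auto
  ultimately have 1: "((?\<phi> \<circ> (cmap p \<circ> \<gamma>)) has_vector_derivative ?D (comp_velocity p ?I \<gamma> s)) (at s within ?I)"
    by (rule vector_derivative_diff_chain_within[rotated])
  \<comment> \<open>The curve may leave the chart \<open>p\<close> elsewhere, so its two chart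
    expressions are related by the transition map only near \<open>s\<close>.\<close>
  obtain e where e: "0 < e" "\<And>x. x \<in> ?I \<Longrightarrow> dist x s < e \<Longrightarrow> \<gamma> x \<in> cdom p"
  proof -
    have "s \<in> {s\<in>?I. \<gamma> s \<in> cdom p}" using assms by auto
    then show ?thesis
      using openin_curve_dom[OF assms(1), of p] that unfolding openin_euclidean_subtopology_iff
      by (metis (no_types, lifting) mem_Collect_eq)
  qed
  have "((cmap p' \<circ> \<gamma>) has_vector_derivative ?D (comp_velocity p ?I \<gamma> s)) (at s within ?I)"
    by (rule has_vector_derivative_transform_within[OF 1 e(1) assms(3)]) (simp add: e(2) cinv_cmap)
  then show ?thesis using vector_derivative_within_Icc assms by blast
qed

lemma velocity_eq_toc:
  assumes "C1_curve UNIV ch \<alpha> \<beta> \<gamma>" "\<alpha> < \<beta>" "s \<in> {\<alpha>..\<beta>}" "\<gamma> s \<in> cdom p"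
  shows "velocity ch {\<alpha>..\<beta>} \<gamma> s = toc p (\<gamma> s) (comp_velocity p {\<alpha>..\<beta>} \<gamma> s)"
  using comp_velocity_transition[OF assms chart_around] by (simp add: velocity_def tangent_of_components_def)

text \<open>The chart in which \<open>v\<close> is read changes with the point, so \<open>v\<close>
  itself may jump; the scalars do not, as is seen in a fixed chart on each set \<open>S p\<close>.
  The time of evaluation is kept independent of the curve parameter, because the perturbation
  evaluates the data at shifted times.\<close>

lemma
  assumes q: "C1_curve UNIV ch \<alpha> \<beta> \<gamma>" "\<alpha> < \<beta>"
  defines "v \<equiv> velocity ch {\<alpha>..\<beta>} \<gamma>"
  shows continuous_on_a_velocity: "continuous_on ({\<alpha>..\<beta>} \<times> T) (\<lambda>(s, t). a t (\<gamma> s) (v s) (v s))"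
    and continuous_on_b_velocity: "continuous_on ({\<alpha>..\<beta>} \<times> T) (\<lambda>(s, t). b t (\<gamma> s) (v s))"
    and continuous_on_V_curve: "continuous_on ({\<alpha>..\<beta>} \<times> T) (\<lambda>(s, t). V t (\<gamma> s))"
proof -
  define S where "S p = {s\<in>{\<alpha>..\<beta>}. \<gamma> s \<in> cdom p}" for p
  have loc: "continuous_on ({\<alpha>..\<beta>} \<times> T) f" if "\<And>p. continuous_on (S p \<times> T) f" for f :: "real \<times> real \<Rightarrow> real"
  proof (rule continuous_on_locally)
    fix x assume "x \<in> {\<alpha>..\<beta>} \<times> T"
    then have "x \<in> S (\<gamma> (fst x)) \<times> T" using chart_around by (auto simp: S_def)
    moreover have "openin (top_of_set ({\<alpha>..\<beta>} \<times> T)) (S (\<gamma> (fst x)) \<times> T)"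
      unfolding S_def by (intro openin_Times openin_curve_dom[OF q(1)]) auto
    ultimately show "\<exists>U. openin (top_of_set ({\<alpha>..\<beta>} \<times> T)) U \<and> x \<in> U \<and> continuous_on U f"
      using that by blast
  qed
  have 1: "continuous_on (S p \<times> T) (\<lambda>x. \<gamma> (fst x))" for p
    by (intro continuous_on_compose2[OF curve_continuous[OF q(1)]] continuous_intros) (auto simp: S_def)
  have 2: "continuous_on (S p \<times> T) (\<lambda>x. comp_velocity p {\<alpha>..\<beta>} \<gamma> (fst x))" for p
    using curve_C1_on[OF q(1), of p]
    by (intro continuous_on_compose2[of "S p" "comp_velocity p {\<alpha>..\<beta>} \<gamma>" _ fst] continuous_intros)
      (auto simp: S_def C1_on_def)
  have v: "v (fst x) = toc p (\<gamma> (fst x)) (comp_velocity p {\<alpha>..\<beta>} \<gamma> (fst x))" if "x \<in> S p \<times> T" for p x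
    unfolding v_def using that q by (intro velocity_eq_toc) (auto simp: S_def)
  have X: "continuous_on (S p \<times> T) snd" "snd ` (S p \<times> T) \<subseteq> T" "(\<lambda>x. \<gamma> (fst x)) ` (S p \<times> T) \<subseteq> cdom p" for p
    by (auto simp: S_def intro: continuous_intros)
  show "continuous_on ({\<alpha>..\<beta>} \<times> T) (\<lambda>(s, t). a t (\<gamma> s) (v s) (v s))"
    using continuous_on_a_toc[OF X(1) 1 X(2,3) 2 2]
    by (intro loc) (simp add: case_prod_unfold v cong: continuous_on_cong)
  show "continuous_on ({\<alpha>..\<beta>} \<times> T) (\<lambda>(s, t). b t (\<gamma> s) (v s))"
    using continuous_on_b_toc[OF X(1) 1 X(2,3) 2]
    by (intro loc) (simp add: case_prod_unfold v cong: continuous_on_cong)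
  show "continuous_on ({\<alpha>..\<beta>} \<times> T) (\<lambda>(s, t). V t (\<gamma> s))"
    using continuous_on_V[OF X(1) 1 X(2,3)]
    by (intro loc) (simp add: case_prod_unfold)
qed

end

lemma C1_on_bounded_linear:
  assumes "bounded_linear L" "C1_on {\<alpha>..\<beta>} S f" "\<alpha> < \<beta>" "S \<subseteq> {\<alpha>..\<beta>}"
  shows "C1_on {\<alpha>..\<beta>} S (\<lambda>s. L (f s))"
    and "s \<in> S \<Longrightarrow> vector_derivative (\<lambda>s. L (f s)) (at s within {\<alpha>..\<beta>}) =
      L (vector_derivative f (at s within {\<alpha>..\<beta>}))"
proof -
  note d = bounded_linear.has_vector_derivative[OF assms(1) C1_on_has_vector_derivative[OF assms(2)]]
  show "C1_on {\<alpha>..\<beta>} S (\<lambda>s. L (f s))"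
    using assms d by (intro C1_onI[OF assms(3,4) d])
      (auto simp: C1_on_def intro: bounded_linear.continuous_on)
  show "vector_derivative (\<lambda>s. L (f s)) (at s within {\<alpha>..\<beta>}) =
      L (vector_derivative f (at s within {\<alpha>..\<beta>}))" if "s \<in> S"
    using vector_derivative_within_Icc[OF assms(3) _ d[OF that]] that assms(4) by blast
qed

lemma C1_on_Pair:
  assumes "C1_on {\<alpha>..\<beta>} S f" "C1_on {\<alpha>..\<beta>} S g" "\<alpha> < \<beta>" "S \<subseteq> {\<alpha>..\<beta>}"
  shows "C1_on {\<alpha>..\<beta>} S (\<lambda>s. (f s, g s))"
    and "s \<in> S \<Longrightarrow> vector_derivative (\<lambda>s. (f s, g s)) (at s within {\<alpha>..\<beta>}) =
      (vector_derivative f (at s within {\<alpha>..\<beta>}), vector_derivative g (at s within {\<alpha>..\<beta>}))"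
proof -
  note d = has_vector_derivative_Pair[OF C1_on_has_vector_derivative[OF assms(1)] C1_on_has_vector_derivative[OF assms(2)]]
  show "C1_on {\<alpha>..\<beta>} S (\<lambda>s. (f s, g s))"
    using assms by (intro C1_onI[OF assms(3,4) d]) (auto simp: C1_on_def intro: continuous_on_Pair)
  show "vector_derivative (\<lambda>s. (f s, g s)) (at s within {\<alpha>..\<beta>}) =
      (vector_derivative f (at s within {\<alpha>..\<beta>}), vector_derivative g (at s within {\<alpha>..\<beta>}))" if "s \<in> S"
    using vector_derivative_within_Icc[OF assms(3) _ d[OF that that]] that assms(4) by blast
qed

lemma C1_on_locally:
  assumes "\<And>s. s \<in> S \<Longrightarrow> \<exists>U. openin (top_of_set S) U \<and> s \<in> U \<and> C1_on I U f"
  shows "C1_on I S f"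
  unfolding C1_on_def
proof
  show "\<forall>s\<in>S. f differentiable at s within I" using assms unfolding C1_on_def by blast
  show "continuous_on S (\<lambda>s. vector_derivative f (at s within I))"
    using assms unfolding C1_on_def by (intro continuous_on_locally) blast
qed

lemma C1_on_real:
  fixes f :: "real \<Rightarrow> real"
  assumes "\<alpha> < \<beta>" "\<And>s. s \<in> {\<alpha>..\<beta>} \<Longrightarrow> (f has_real_derivative w s) (at s within {\<alpha>..\<beta>})" "continuous_on {\<alpha>..\<beta>} w"
  shows "C1_on {\<alpha>..\<beta>} {\<alpha>..\<beta>} f"
    and "s \<in> {\<alpha>..\<beta>} \<Longrightarrow> vector_derivative f (at s within {\<alpha>..\<beta>}) = w s"
  using assms C1_onI[of \<alpha> \<beta> "{\<alpha>..\<beta>}" f w] vector_derivative_within_Icc[of \<alpha> \<beta> s f "w s"]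
  by (simp_all add: has_real_derivative_iff_has_vector_derivative)

lemma C1_curve_cong:
  assumes "C1_curve M ch \<alpha> \<beta> \<gamma>" "\<alpha> < \<beta>" "\<And>s. s \<in> {\<alpha>..\<beta>} \<Longrightarrow> \<gamma> s = \<gamma>' s"
  shows "C1_curve M ch \<alpha> \<beta> \<gamma>'"
  unfolding C1_curve_iff
proof (intro conjI ballI)
  show "\<gamma>' ` {\<alpha>..\<beta>} \<subseteq> M" "continuous_on {\<alpha>..\<beta>} \<gamma>'"
    using assms by (auto simp: C1_curve_iff image_subset_iff intro: continuous_on_eq)
  fix p assume "p \<in> M"
  then have "C1_on {\<alpha>..\<beta>} {s\<in>{\<alpha>..\<beta>}. \<gamma> s \<in> chart_dom (ch p)} (chart_map (ch p) \<circ> \<gamma>)"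
    using assms by (auto simp: C1_curve_iff)
  moreover have "{s\<in>{\<alpha>..\<beta>}. \<gamma>' s \<in> chart_dom (ch p)} = {s\<in>{\<alpha>..\<beta>}. \<gamma> s \<in> chart_dom (ch p)}"
    using assms by auto
  ultimately show "C1_on {\<alpha>..\<beta>} {s\<in>{\<alpha>..\<beta>}. \<gamma>' s \<in> chart_dom (ch p)} (chart_map (ch p) \<circ> \<gamma>')"
    using assms by (auto intro: C1_on_cong[of _ _ "chart_map (ch p) \<circ> \<gamma>"])
qed

lemma velocity_cong:
  assumes "\<And>s. s \<in> I \<Longrightarrow> \<gamma> s = \<gamma>' s" "s \<in> I"
  shows "velocity ch I \<gamma> s = velocity ch I \<gamma>' s"
  using assms by (simp add: velocity_def cong: vector_derivative_within_cong)

context gw_spacetime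
begin

section \<open>Causal curves with a length coordinate\<close>

text \<open>For the tangent vector X this is \<open>- g(N, X)\<close> with the null field
  \<open>N = \<partial>\<^sub>t - V \<partial>\<^sub>y\<close>, just as \<tau> is
  \<open>- g(\<partial>\<^sub>y, X)\<close>.\<close>

definition momentum :: "real \<Rightarrow> 'q \<Rightarrow> 'v \<Rightarrow> real \<times> real \<times> real \<Rightarrow> real" where
  "momentum t q v \<zeta> = fst (snd \<zeta>) - b t q v + V t q * fst \<zeta>"

text \<open>
  The third component of \<open>\<zeta> = (\<tau>, \<eta>, \<lambda>)\<close> is a lower bound for the Lorentzian length of the tangent
  vector \<open>\<tau> \<partial>\<^sub>t + v + \<eta> \<partial>\<^sub>y\<close>. In contrast to future causal vectors the zero vector is admitted, so that
  the condition is invariant under reparametrizations that stop.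
\<close>

definition causal_vec :: "real \<Rightarrow> 'q \<Rightarrow> 'v \<Rightarrow> real \<times> real \<times> real \<Rightarrow> bool" where
  "causal_vec t q v \<zeta> \<longleftrightarrow> 0 \<le> fst \<zeta> \<and> 0 \<le> momentum t q v \<zeta> \<and>
     a t q v v + (snd (snd \<zeta>))\<^sup>2 \<le> 2 * fst \<zeta> * momentum t q v \<zeta>"

text \<open>\<open>z\<close> collects time, y and accumulated length, which are global real
  coordinates; only \<open>q\<close> has to be treated in charts.\<close>

definition causal_C1 :: "real \<Rightarrow> real \<Rightarrow> (real \<Rightarrow> 'q) \<Rightarrow> (real \<Rightarrow> real \<times> real \<times> real) \<Rightarrow> bool" where
  "causal_C1 \<alpha> \<beta> q z \<longleftrightarrow> \<alpha> < \<beta> \<and> C1_curve UNIV ch \<alpha> \<beta> q \<and> C1_on {\<alpha>..\<beta>} {\<alpha>..\<beta>} z \<and>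
     (\<forall>s\<in>{\<alpha>..\<beta>}. fst (z s) \<in> T \<and>
       causal_vec (fst (z s)) (q s) (velocity ch {\<alpha>..\<beta>} q s) (vector_derivative z (at s within {\<alpha>..\<beta>})))"

text \<open>The momentum is homogeneous of degree 1 and the quadratic condition of degree 2. The
  factor 0 is allowed, as needed where a reparametrization stops.\<close>

lemma causal_vec_scale:
  assumes "causal_vec t q v \<zeta>" "0 \<le> c" "t \<in> T"
  shows "causal_vec t q (c *\<^sub>R v) (c *\<^sub>R \<zeta>)"
proof -
  have m: "momentum t q (c *\<^sub>R v) (c *\<^sub>R \<zeta>) = c * momentum t q v \<zeta>"
    using assms by (simp add: momentum_def b_scale algebra_simps)
  have "c\<^sup>2 * (a t q v v + (snd (snd \<zeta>))\<^sup>2) \<le> c\<^sup>2 * (2 * fst \<zeta> * momentum t q v \<zeta>)"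
    using assms by (intro mult_left_mono) (auto simp: causal_vec_def)
  with assms show ?thesis
    by (simp add: causal_vec_def m a_scale power2_eq_square algebra_simps)
qed

lemma causal_C1_compose:
  assumes q: "causal_C1 \<alpha> \<beta> q z" and h: "\<alpha>' < \<beta>'" "h ` {\<alpha>'..\<beta>'} \<subseteq> {\<alpha>..\<beta>}"
    "\<And>u. u \<in> {\<alpha>'..\<beta>'} \<Longrightarrow> (h has_real_derivative h' u) (at u within {\<alpha>'..\<beta>'})"
    "continuous_on {\<alpha>'..\<beta>'} h'" "\<And>u. u \<in> {\<alpha>'..\<beta>'} \<Longrightarrow> 0 \<le> h' u"
  shows "causal_C1 \<alpha>' \<beta>' (q \<circ> h) (z \<circ> h)"
    and "u \<in> {\<alpha>'..\<beta>'} \<Longrightarrow> velocity ch {\<alpha>'..\<beta>'} (q \<circ> h) u = h' u *\<^sub>R velocity ch {\<alpha>..\<beta>} q (h u)"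
    and "u \<in> {\<alpha>'..\<beta>'} \<Longrightarrow> vector_derivative (z \<circ> h) (at u within {\<alpha>'..\<beta>'}) =
      h' u *\<^sub>R vector_derivative z (at (h u) within {\<alpha>..\<beta>})"
proof -
  have C: "C1_on {\<alpha>'..\<beta>'} {\<alpha>'..\<beta>'} h"
    using C1_on_real(1)[OF h(1) _ h(4)] h(3) by blast
  have vd: "vector_derivative h (at u within {\<alpha>'..\<beta>'}) = h' u" if "u \<in> {\<alpha>'..\<beta>'}" for u
    using C1_on_real(2)[OF h(1) _ h(4) that] h(3) by blast
  have qC: "C1_curve UNIV ch \<alpha> \<beta> q" and zC: "C1_on {\<alpha>..\<beta>} {\<alpha>..\<beta>} z"
    using q by (auto simp: causal_C1_def)
  show 1: "velocity ch {\<alpha>'..\<beta>'} (q \<circ> h) u = h' u *\<^sub>R velocity ch {\<alpha>..\<beta>} q (h u)"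
    if "u \<in> {\<alpha>'..\<beta>'}" for u
    using velocity_compose[OF qC h(1,2) C that chart_around] vd[OF that] by simp
  show 2: "vector_derivative (z \<circ> h) (at u within {\<alpha>'..\<beta>'}) =
      h' u *\<^sub>R vector_derivative z (at (h u) within {\<alpha>..\<beta>})" if "u \<in> {\<alpha>'..\<beta>'}" for u
    using C1_on_compose(2)[OF zC h(1,2) C that] h(2) vd[OF that] that by (simp add: image_subset_iff)
  have "{u \<in> {\<alpha>'..\<beta>'}. h u \<in> {\<alpha>..\<beta>}} = {\<alpha>'..\<beta>'}" using h(2) by auto
  then have "C1_on {\<alpha>'..\<beta>'} {\<alpha>'..\<beta>'} (z \<circ> h)" using C1_on_compose(1)[OF zC h(1,2) C] by simp
  moreover have "h u \<in> {\<alpha>..\<beta>}" if "u \<in> {\<alpha>'..\<beta>'}" for u using h(2) that by blast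
  ultimately show "causal_C1 \<alpha>' \<beta>' (q \<circ> h) (z \<circ> h)"
    using q h(1,5) C1_curve_compose[OF qC h(1,2) C] causal_vec_scale by (auto simp: causal_C1_def 1 2)
qed

lemma causal_C1_cong:
  assumes "causal_C1 \<alpha> \<beta> q z" "\<And>s. s \<in> {\<alpha>..\<beta>} \<Longrightarrow> q s = q' s" "\<And>s. s \<in> {\<alpha>..\<beta>} \<Longrightarrow> z s = z' s"
  shows "causal_C1 \<alpha> \<beta> q' z'"
proof -
  have "C1_curve UNIV ch \<alpha> \<beta> q'" "C1_on {\<alpha>..\<beta>} {\<alpha>..\<beta>} z'"
    using assms C1_curve_cong[of UNIV ch \<alpha> \<beta> q q'] C1_on_cong[of \<alpha> \<beta> z z'] by (auto simp: causal_C1_def)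
  moreover have "velocity ch {\<alpha>..\<beta>} q s = velocity ch {\<alpha>..\<beta>} q' s"
      "vector_derivative z (at s within {\<alpha>..\<beta>}) = vector_derivative z' (at s within {\<alpha>..\<beta>})"
    if "s \<in> {\<alpha>..\<beta>}" for s
    using that assms velocity_cong[of "{\<alpha>..\<beta>}" q q'] vector_derivative_within_cong[of "{\<alpha>..\<beta>}" z z'] by auto
  ultimately show ?thesis
    using assms by (auto simp: causal_C1_def)
qed

section \<open>Concatenation of causal curves\<close>

lemma comp_velocity_eq_0:
  assumes "C1_curve UNIV ch \<alpha> \<beta> \<gamma>" "\<alpha> < \<beta>" "s \<in> {\<alpha>..\<beta>}" "\<gamma> s \<in> cdom p" "velocity ch {\<alpha>..\<beta>} \<gamma> s = 0"
  shows "comp_velocity p {\<alpha>..\<beta>} \<gamma> s = 0"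
proof -
  have "linear (frechet_derivative (cmap p \<circ> cinv (\<gamma> s)) (at (cmap (\<gamma> s) (\<gamma> s))))"
    using linear_frechet_derivative transition_differentiable chart_around assms(4) by blast
  then show ?thesis
    using comp_velocity_transition[OF assms(1-3) chart_around assms(4)] assms(5)
    by (simp add: velocity_def linear_0)
qed

text \<open>Zero velocity in the chart at \<open>q m\<close> is zero velocity in every chart around
  \<open>q m\<close>, because transition maps have linear differentials. Hence all chart expressions
  have matching one-sided derivatives at the junction.\<close>

lemma causal_C1_glue:
  assumes q1: "causal_C1 \<alpha> m q z" and q2: "causal_C1 m \<beta> q z"
    and v0: "velocity ch {\<alpha>..m} q m = 0" "velocity ch {m..\<beta>} q m = 0"
    and z0: "vector_derivative z (at m within {\<alpha>..m}) = 0" "vector_derivative z (at m within {m..\<beta>}) = 0"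
  shows "causal_C1 \<alpha> \<beta> q z"
proof -
  have le: "\<alpha> < m" "m < \<beta>" using q1 q2 by (auto simp: causal_C1_def)
  have qC: "C1_curve UNIV ch \<alpha> m q" "C1_curve UNIV ch m \<beta> q"
    and zC: "C1_on {\<alpha>..m} {\<alpha>..m} z" "C1_on {m..\<beta>} {m..\<beta>} z"
    using q1 q2 by (auto simp: causal_C1_def)
  have "{s \<in> {\<alpha>..\<beta>}. s \<le> m} = {\<alpha>..m}" "{s \<in> {\<alpha>..\<beta>}. m \<le> s} = {m..\<beta>}" using le by auto
  with zC z0 le have z: "C1_on {\<alpha>..m} {s \<in> {\<alpha>..\<beta>}. s \<le> m} z" "C1_on {m..\<beta>} {s \<in> {\<alpha>..\<beta>}. m \<le> s} z" by simp_all
  have zg: "C1_on {\<alpha>..\<beta>} {\<alpha>..\<beta>} z"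
      "\<And>s. s \<in> {\<alpha>..\<beta>} \<Longrightarrow> s \<le> m \<Longrightarrow> vector_derivative z (at s within {\<alpha>..\<beta>}) = vector_derivative z (at s within {\<alpha>..m})"
      "\<And>s. s \<in> {\<alpha>..\<beta>} \<Longrightarrow> m \<le> s \<Longrightarrow> vector_derivative z (at s within {\<alpha>..\<beta>}) = vector_derivative z (at s within {m..\<beta>})"
    using C1_on_glue[OF le order_refl z] z0 by auto
  define S where "S p = {s\<in>{\<alpha>..\<beta>}. q s \<in> cdom p}" for p
  have S: "{s\<in>S p. s \<le> m} = {s\<in>{\<alpha>..m}. q s \<in> cdom p}" "{s\<in>S p. m \<le> s} = {s\<in>{m..\<beta>}. q s \<in> cdom p}" for p
    using le by (auto simp: S_def)
  have qp: "C1_on {\<alpha>..m} {s\<in>S p. s \<le> m} (cmap p \<circ> q)" "C1_on {m..\<beta>} {s\<in>S p. m \<le> s} (cmap p \<circ> q)" for p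
    unfolding S using qC[THEN curve_C1_on] by auto
  have m0: "comp_velocity p {\<alpha>..m} q m = comp_velocity p {m..\<beta>} q m" if "m \<in> S p" for p
    using comp_velocity_eq_0[OF qC(1) le(1) _ _ v0(1), of p] comp_velocity_eq_0[OF qC(2) le(2) _ _ v0(2), of p]
      that le by (auto simp: S_def)
  have Ssub: "S p \<subseteq> {\<alpha>..\<beta>}" for p by (auto simp: S_def)
  note qg = C1_on_glue[OF le Ssub qp m0]
  have v: "velocity ch {\<alpha>..\<beta>} q s = velocity ch {\<alpha>..m} q s" if "s \<in> {\<alpha>..m}" for s
    unfolding velocity_def using that le chart_around by (intro qg(2)[of "q s"]) (auto simp: S_def)
  have v': "velocity ch {\<alpha>..\<beta>} q s = velocity ch {m..\<beta>} q s" if "s \<in> {m..\<beta>}" for s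
    unfolding velocity_def using that le chart_around by (intro qg(3)[of "q s"]) (auto simp: S_def)
  have eq: "{\<alpha>..\<beta>} = {\<alpha>..m} \<union> {m..\<beta>}" using le by auto
  have "continuous_on {\<alpha>..\<beta>} q"
    unfolding eq using qC[THEN curve_continuous] by (intro continuous_on_closed_Un) auto
  then have "C1_curve UNIV ch \<alpha> \<beta> q"
    using qg(1) by (auto simp: C1_curve_iff S_def)
  moreover have "fst (z s) \<in> T \<and>
       causal_vec (fst (z s)) (q s) (velocity ch {\<alpha>..\<beta>} q s) (vector_derivative z (at s within {\<alpha>..\<beta>}))"
    if "s \<in> {\<alpha>..\<beta>}" for s
  proof (cases "s \<le> m")
    case True
    then show ?thesis using that v[of s] zg(2)[of s] q1 by (auto simp: causal_C1_def)
  next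
    case False
    then show ?thesis using that v'[of s] zg(3)[of s] q2 by (auto simp: causal_C1_def)
  qed
  ultimately show ?thesis
    using zg(1) le by (auto simp: causal_C1_def)
qed

text \<open>
  Both curves are reparametrized quadratically so that they stop at the junction, where their
  velocities need not agree.
\<close>

lemma causal_C1_join:
  assumes q1: "causal_C1 \<alpha>1 \<beta>1 q1 z1" and q2: "causal_C1 \<alpha>2 \<beta>2 q2 z2"
    and eq: "q1 \<beta>1 = q2 \<alpha>2" "z1 \<beta>1 = z2 \<alpha>2"
  shows "\<exists>q z. causal_C1 (-1) 1 q z \<and> q (-1) = q1 \<alpha>1 \<and> z (-1) = z1 \<alpha>1 \<and> q 1 = q2 \<beta>2 \<and> z 1 = z2 \<beta>2"
proof -
  have le: "\<alpha>1 < \<beta>1" "\<alpha>2 < \<beta>2" using q1 q2 by (auto simp: causal_C1_def)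
  \<comment> \<open>Parabolas with vertex at 0: \<open>h1\<close> runs through the first parameter
    interval on [-1, 0], \<open>h2\<close> through the second on [0, 1], both without turning
    back.\<close>
  define h1 h2 where "h1 u = \<beta>1 - (\<beta>1 - \<alpha>1) * u\<^sup>2" and "h2 u = \<alpha>2 + (\<beta>2 - \<alpha>2) * u\<^sup>2" for u :: real
  define q where "q u = (if u \<le> 0 then (q1 \<circ> h1) u else (q2 \<circ> h2) u)" for u
  define z where "z u = (if u \<le> 0 then (z1 \<circ> h1) u else (z2 \<circ> h2) u)" for u
  have sq: "u\<^sup>2 \<le> 1" if "\<bar>u\<bar> \<le> 1" for u :: real using that by (simp add: abs_square_le_1)
  have h1: "(h1 has_real_derivative - 2 * (\<beta>1 - \<alpha>1) * u) (at u within {-1..0})"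
    and h2: "(h2 has_real_derivative 2 * (\<beta>2 - \<alpha>2) * u) (at u within {0..1})" for u
    unfolding h1_def h2_def by (auto intro!: derivative_eq_intros simp: algebra_simps)
  have r1: "h1 ` {-1..0} \<subseteq> {\<alpha>1..\<beta>1}"
  proof (rule image_subsetI)
    fix u :: real assume "u \<in> {-1..0}"
    then have "(\<beta>1 - \<alpha>1) * u\<^sup>2 \<le> \<beta>1 - \<alpha>1" "0 \<le> (\<beta>1 - \<alpha>1) * u\<^sup>2"
      using le sq[of u] by (simp_all add: mult_left_le)
    then show "h1 u \<in> {\<alpha>1..\<beta>1}" by (simp only: h1_def atLeastAtMost_iff) argo
  qed
  have r2: "h2 ` {0..1} \<subseteq> {\<alpha>2..\<beta>2}"
  proof (rule image_subsetI)
    fix u :: real assume "u \<in> {0..1}"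
    then have "(\<beta>2 - \<alpha>2) * u\<^sup>2 \<le> \<beta>2 - \<alpha>2" "0 \<le> (\<beta>2 - \<alpha>2) * u\<^sup>2"
      using le sq[of u] by (simp_all add: mult_left_le)
    then show "h2 u \<in> {\<alpha>2..\<beta>2}" by (simp only: h2_def atLeastAtMost_iff) argo
  qed
  have n1: "0 \<le> - 2 * (\<beta>1 - \<alpha>1) * u" if "u \<in> {-1..0}" for u
    using that le mult_nonpos_nonpos[of "- 2 * (\<beta>1 - \<alpha>1)" u] by simp
  have n2: "0 \<le> 2 * (\<beta>2 - \<alpha>2) * u" if "u \<in> {0..1}" for u using that le by simp
  have cont: "continuous_on {-1..0} (\<lambda>u::real. - 2 * (\<beta>1 - \<alpha>1) * u)" "continuous_on {0..1} (\<lambda>u::real. 2 * (\<beta>2 - \<alpha>2) * u)"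
    by (auto intro!: continuous_intros)
  have c1: "causal_C1 (-1) 0 (q1 \<circ> h1) (z1 \<circ> h1)"
    "(0::real) \<in> {-1..0} \<Longrightarrow> velocity ch {-1..0} (q1 \<circ> h1) 0 = (- 2 * (\<beta>1 - \<alpha>1) * 0) *\<^sub>R velocity ch {\<alpha>1..\<beta>1} q1 (h1 0)"
    "(0::real) \<in> {-1..0} \<Longrightarrow> vector_derivative (z1 \<circ> h1) (at 0 within {-1..0}) =
      (- 2 * (\<beta>1 - \<alpha>1) * 0) *\<^sub>R vector_derivative z1 (at (h1 0) within {\<alpha>1..\<beta>1})"
    by (rule causal_C1_compose[OF q1 _ r1 h1 cont(1) n1]; simp)+
  have c2: "causal_C1 0 1 (q2 \<circ> h2) (z2 \<circ> h2)"
    "(0::real) \<in> {0..1} \<Longrightarrow> velocity ch {0..1} (q2 \<circ> h2) 0 = (2 * (\<beta>2 - \<alpha>2) * 0) *\<^sub>R velocity ch {\<alpha>2..\<beta>2} q2 (h2 0)"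
    "(0::real) \<in> {0..1} \<Longrightarrow> vector_derivative (z2 \<circ> h2) (at 0 within {0..1}) =
      (2 * (\<beta>2 - \<alpha>2) * 0) *\<^sub>R vector_derivative z2 (at (h2 0) within {\<alpha>2..\<beta>2})"
    by (rule causal_C1_compose[OF q2 _ r2 h2 cont(2) n2]; simp)+
  have e1: "(q1 \<circ> h1) s = q s" "(z1 \<circ> h1) s = z s" if "s \<in> {-1..0}" for s
    using that by (auto simp: q_def z_def)
  have e2: "(q2 \<circ> h2) s = q s" "(z2 \<circ> h2) s = z s" if "s \<in> {0..1}" for s
    using that eq by (auto simp: q_def z_def h1_def h2_def)
  have "causal_C1 (-1) 1 q z"
  proof (rule causal_C1_glue[of _ 0])
    show "causal_C1 (-1) 0 q z" by (rule causal_C1_cong[OF c1(1) e1])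
    show "causal_C1 0 1 q z" by (rule causal_C1_cong[OF c2(1) e2])
    show "velocity ch {-1..0} q 0 = 0"
      using velocity_cong[of "{-1..0}" "q1 \<circ> h1" q 0 ch] e1(1) c1(2) by simp
    show "velocity ch {0..1} q 0 = 0"
      using velocity_cong[of "{0..1}" "q2 \<circ> h2" q 0 ch] e2(1) c2(2) by simp
    show "vector_derivative z (at 0 within {-1..0}) = 0"
      using vector_derivative_within_cong[of "{-1..0}" "z1 \<circ> h1" z 0] e1(2) c1(3) by simp
    show "vector_derivative z (at 0 within {0..1}) = 0"
      using vector_derivative_within_cong[of "{0..1}" "z2 \<circ> h2" z 0] e2(2) c2(3) by simp
  qed
  moreover have "q (-1) = q1 \<alpha>1" "z (-1) = z1 \<alpha>1" "q 1 = q2 \<beta>2" "z 1 = z2 \<beta>2"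
    by (simp_all add: q_def z_def h1_def h2_def)
  ultimately show ?thesis by blast
qed

text \<open>Only differences of the length coordinate matter; the shift makes the coordinates of two
  consecutive curves agree at the junction.\<close>

lemma causal_C1_shift:
  assumes "causal_C1 \<alpha> \<beta> q z"
  shows "causal_C1 \<alpha> \<beta> q (\<lambda>s. z s + (0, 0, c))"
proof -
  have le: "\<alpha> < \<beta>" and zC: "C1_on {\<alpha>..\<beta>} {\<alpha>..\<beta>} z" using assms by (auto simp: causal_C1_def)
  have d: "((\<lambda>s. z s + (0, 0, c)) has_vector_derivative vector_derivative z (at s within {\<alpha>..\<beta>})) (at s within {\<alpha>..\<beta>})"
    if "s \<in> {\<alpha>..\<beta>}" for s
    using C1_on_has_vector_derivative[OF zC that] by (auto intro!: derivative_eq_intros)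
  have "C1_on {\<alpha>..\<beta>} {\<alpha>..\<beta>} (\<lambda>s. z s + (0, 0, c))"
    using zC le d by (intro C1_onI[OF _ _ d]) (auto simp: C1_on_def)
  then show ?thesis
    using assms vector_derivative_within_Icc[OF le _ d] by (auto simp: causal_C1_def)
qed

text \<open>Taking \<open>l\<close> as a difference of end values makes it additive under
  concatenation without any change of variables in an integral.\<close>

definition joined :: "real \<times> 'q \<times> real \<Rightarrow> real \<times> 'q \<times> real \<Rightarrow> real \<Rightarrow> bool" where
  "joined x0 x1 l \<longleftrightarrow> (\<exists>\<alpha> \<beta> q z. causal_C1 \<alpha> \<beta> q z \<and> x0 = (fst (z \<alpha>), q \<alpha>, fst (snd (z \<alpha>))) \<and>
     x1 = (fst (z \<beta>), q \<beta>, fst (snd (z \<beta>))) \<and> l = snd (snd (z \<beta>)) - snd (snd (z \<alpha>)))"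

lemma joined_trans:
  assumes "joined x0 x1 l" "joined x1 x2 l'"
  shows "joined x0 x2 (l + l')"
proof -
  obtain \<alpha>1 \<beta>1 q1 z1 where 1: "causal_C1 \<alpha>1 \<beta>1 q1 z1" "x0 = (fst (z1 \<alpha>1), q1 \<alpha>1, fst (snd (z1 \<alpha>1)))"
     "x1 = (fst (z1 \<beta>1), q1 \<beta>1, fst (snd (z1 \<beta>1)))" "l = snd (snd (z1 \<beta>1)) - snd (snd (z1 \<alpha>1))"
    using assms(1) by (auto simp: joined_def)
  obtain \<alpha>2 \<beta>2 q2 z2 where 2: "causal_C1 \<alpha>2 \<beta>2 q2 z2" "x1 = (fst (z2 \<alpha>2), q2 \<alpha>2, fst (snd (z2 \<alpha>2)))"
     "x2 = (fst (z2 \<beta>2), q2 \<beta>2, fst (snd (z2 \<beta>2)))" "l' = snd (snd (z2 \<beta>2)) - snd (snd (z2 \<alpha>2))"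
    using assms(2) by (auto simp: joined_def)
  define c where "c = snd (snd (z1 \<beta>1)) - snd (snd (z2 \<alpha>2))"
  obtain q z where "causal_C1 (-1) 1 q z" "q (-1) = q1 \<alpha>1" "z (-1) = z1 \<alpha>1" "q 1 = q2 \<beta>2"
      "z 1 = z2 \<beta>2 + (0, 0, c)"
    using causal_C1_join[OF 1(1) causal_C1_shift[OF 2(1), of c]] 1(3) 2(2)
    by (auto simp: c_def prod_eq_iff)
  then show ?thesis
    unfolding joined_def using 1 2
    by (intro exI[of _ "-1"] exI[of _ 1] exI[of _ q] exI[of _ z]) (simp add: c_def)
qed

end

section \<open>Perturbation of causal curves\<close>

lemma mean_value_within:
  fixes g :: "real \<Rightarrow> real"
  assumes d: "\<And>s. s \<in> {\<alpha>..\<beta>} \<Longrightarrow> (g has_real_derivative g' s) (at s within {\<alpha>..\<beta>})"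
    and xy: "\<alpha> \<le> x" "x < y" "y \<le> \<beta>"
  obtains z where "z \<in> {x<..<y}" "g y - g x = g' z * (y - x)"
proof -
  have "\<exists>z\<in>{x<..<y}. g y - g x = (\<lambda>h. g' z * h) (y - x)"
  proof (rule mvt_simple[OF xy(2)])
    fix z assume "x \<le> z" "z \<le> y"
    then show "(g has_derivative (\<lambda>h. g' z * h)) (at z within {x..y})"
      using d[of z] xy has_derivative_subset[of g _ z "{\<alpha>..\<beta>}" "{x..y}"]
      by (auto simp: has_field_derivative_def)
  qed
  with that show thesis by blast
qed

lemma nondecreasing_within:
  fixes g :: "real \<Rightarrow> real"
  assumes d: "\<And>s. s \<in> {\<alpha>..\<beta>} \<Longrightarrow> (g has_real_derivative g' s) (at s within {\<alpha>..\<beta>})"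
    and pos: "\<And>s. s \<in> {\<alpha>..\<beta>} \<Longrightarrow> 0 \<le> g' s" and xy: "\<alpha> \<le> x" "x \<le> y" "y \<le> \<beta>"
  shows "g x \<le> g y"
proof (cases "x = y")
  case False
  then have "x < y" using xy by simp
  obtain z where z: "z \<in> {x<..<y}" "g y - g x = g' z * (y - x)"
    by (rule mean_value_within[OF d xy(1) \<open>x < y\<close> xy(3)])
  have "0 \<le> g' z * (y - x)" using z xy by (intro mult_nonneg_nonneg pos) auto
  with z show ?thesis by simp
qed simp

lemma inverse_of_increasing_C1:
  fixes g :: "real \<Rightarrow> real"
  assumes le: "\<alpha> < \<beta>"
    and d: "\<And>s. s \<in> {\<alpha>..\<beta>} \<Longrightarrow> (g has_real_derivative g' s) (at s within {\<alpha>..\<beta>})"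
    and cont: "continuous_on {\<alpha>..\<beta>} g'" and pos: "\<And>s. s \<in> {\<alpha>..\<beta>} \<Longrightarrow> 0 < g' s"
  obtains h where "h ` {g \<alpha>..g \<beta>} \<subseteq> {\<alpha>..\<beta>}" "\<And>u. u \<in> {g \<alpha>..g \<beta>} \<Longrightarrow> g (h u) = u"
    "\<And>s. s \<in> {\<alpha>..\<beta>} \<Longrightarrow> h (g s) = s" "g \<alpha> < g \<beta>"
    "\<And>u. u \<in> {g \<alpha>..g \<beta>} \<Longrightarrow> (h has_real_derivative inverse (g' (h u))) (at u within {g \<alpha>..g \<beta>})"
    "continuous_on {g \<alpha>..g \<beta>} (\<lambda>u. inverse (g' (h u)))"
proof -
  let ?I = "{\<alpha>..\<beta>}"
  let ?J = "{g \<alpha>..g \<beta>}"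
  have mono: "g x < g y" if xy: "x \<in> ?I" "y \<in> ?I" "x < y" for x y
  proof -
    have "\<alpha> \<le> x" "y \<le> \<beta>" using xy by simp_all
    obtain z where z: "z \<in> {x<..<y}" "g y - g x = g' z * (y - x)"
      by (rule mean_value_within[OF d \<open>\<alpha> \<le> x\<close> xy(3) \<open>y \<le> \<beta>\<close>])
    have "0 < g' z * (y - x)" using z xy by (intro mult_pos_pos pos) auto
    with z show ?thesis by simp
  qed
  have inj: "inj_on g ?I" by (rule inj_onI) (metis mono less_irrefl linorder_less_linear)
  have gc: "continuous_on ?I g"
    using d by (meson DERIV_continuous continuous_on_eq_continuous_within)
  have img: "g ` ?I = ?J"
  proof
    show "g ` ?I \<subseteq> ?J"
    proof (rule image_subsetI)
      fix s assume s: "s \<in> ?I"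
      have "g \<alpha> \<le> g s" using mono[of \<alpha> s] s by (cases "s = \<alpha>") auto
      moreover have "g s \<le> g \<beta>" using mono[of s \<beta>] s by (cases "s = \<beta>") auto
      ultimately show "g s \<in> ?J" by simp
    qed
    show "?J \<subseteq> g ` ?I"
    proof
      fix u assume "u \<in> ?J"
      then obtain s where "\<alpha> \<le> s" "s \<le> \<beta>" "g s = u"
        using IVT'[of g \<alpha> u \<beta>] le gc by auto
      then show "u \<in> g ` ?I" by auto
    qed
  qed
  define h where "h = inv_into ?I g"
  have hI: "h u \<in> ?I" and gh: "g (h u) = u" if "u \<in> ?J" for u
    using that inv_into_into[of u g ?I] f_inv_into_f[of u g ?I] by (simp_all only: h_def img)
  have hg: "h (g s) = s" if "s \<in> ?I" for s
    unfolding h_def using inj that by (rule inv_into_f_f)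
  have hc: "continuous_on ?J h"
    using continuous_on_inv[OF gc compact_Icc, of h] hg img by simp
  have hd: "(h has_real_derivative inverse (g' (h u))) (at u within ?J)" if u: "u \<in> ?J" for u
  proof -
    \<comment> \<open>As \<open>h\<close> is continuous and injective, \<open>h y\<close> tends to
      \<open>h u\<close> without attaining it. The difference quotient of \<open>h\<close> is
      therefore the reciprocal of one of \<open>g\<close>, also at the ends of the interval.\<close>
    have "filterlim h (at (h u) within ?I) (at u within ?J)"
      unfolding filterlim_at
    proof
      show "(h \<longlongrightarrow> h u) (at u within ?J)" using hc u by (auto simp: continuous_on_def)
      show "\<forall>\<^sub>F x in at u within ?J. h x \<in> ?I \<and> h x \<noteq> h u"
        unfolding eventually_at_filter using hI gh u by (intro always_eventually) metis
    qed
    with d[OF hI[OF u]] have "((\<lambda>y. (g (h y) - g (h u)) / (h y - h u)) \<longlongrightarrow> g' (h u)) (at u within ?J)"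
      unfolding has_field_derivative_iff by (rule filterlim_compose)
    then have "((\<lambda>y. inverse ((g (h y) - g (h u)) / (h y - h u))) \<longlongrightarrow> inverse (g' (h u))) (at u within ?J)"
      using pos[OF hI[OF u]] by (intro tendsto_inverse) auto
    moreover have "\<forall>\<^sub>F y in at u within ?J. inverse ((g (h y) - g (h u)) / (h y - h u)) = (h y - h u) / (y - u)"
      unfolding eventually_at_filter using gh u by (intro always_eventually) simp
    ultimately show ?thesis
      unfolding has_field_derivative_iff by (rule Lim_transform_eventually)
  qed
  have "continuous_on ?J (\<lambda>u. g' (h u))"
    using hI by (intro continuous_on_compose2[OF cont hc]) auto
  then have "continuous_on ?J (\<lambda>u. inverse (g' (h u)))"
    using pos hI by (intro continuous_on_inverse) (force simp: less_irrefl)+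
  with that hI gh hg hd mono[of \<alpha> \<beta>] le show thesis by (metis atLeastAtMost_iff image_subsetI less_imp_le order_refl)
qed

text \<open>
  The integrand of the action at a point of a perturbed causal curve. The time component \<open>\<tau>\<close> is replaced
  by \<open>k * (\<tau> + \<delta>)\<close>, and primes mark the values at the perturbed time. The parameter \<open>\<mu>\<close> enters through
  \<open>2 \<mu> \<sigma> l \<le> l\<^sup>2 + \<mu>\<^sup>2 \<sigma>\<^sup>2\<close>.
\<close>

lemma perturbed_lagrangian_bound:
  fixes A A' B B' W W' K k l \<tau> P \<eta> \<delta> e c \<mu> :: real
  assumes "0 \<le> \<tau>" "0 \<le> P" "0 \<le> A" "A + l\<^sup>2 \<le> 2 * \<tau> * P" "0 < \<delta>" "0 < k" "inverse k = 1 + \<delta> * c" "0 \<le> c"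
    and "0 \<le> e" "e \<le> 1" "A' \<le> (1 + e) * A" "P = \<eta> - B + W * \<tau>" "\<bar>B' - B\<bar> \<le> e" "\<bar>W' - W\<bar> \<le> e"
    and "\<bar>W'\<bar> \<le> K" "P \<le> K" "\<tau> \<le> K"
  shows "A' / (2 * (k * (\<tau> + \<delta>))) + B' - W' * (k * (\<tau> + \<delta>)) \<le>
    \<eta> - \<mu> * l + \<mu>\<^sup>2 * \<tau> / 2 + (e * (2 * K + 1) + \<delta> * (\<mu>\<^sup>2 / 2 + 2 * c * K + c * K\<^sup>2 + K))"
proof -
  define \<sigma> where "\<sigma> = \<tau> + \<delta>"
  have \<sigma>: "0 < \<sigma>" "\<tau> \<le> \<sigma>" using assms by (auto simp: \<sigma>_def)
  have K: "0 \<le> K" using assms by linarith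
  have \<tau>P: "2 * \<tau> * P \<le> 2 * \<sigma> * P" using \<sigma> assms by (intro mult_right_mono) auto
  have "A \<le> 2 * \<sigma> * P" using \<tau>P assms(4) zero_le_power2[of l] by linarith
  then have "A / (2 * \<sigma>) \<le> P" using \<sigma> by (simp add: divide_le_eq mult.commute)
  \<comment> \<open>The kinetic term stays bounded however small \<sigma> is. This is what makes the
    relative error \<open>e\<close> of \<open>A\<close> cost no more than a multiple of
    \<open>K\<close>.\<close>
  then have A\<sigma>: "A / (2 * \<sigma>) \<le> K" "0 \<le> A / (2 * \<sigma>)" using assms \<sigma> by auto
  have "0 \<le> (l - \<mu> * \<sigma>)\<^sup>2" by simp
  then have "A + 2 * \<sigma> * (\<mu> * l) \<le> 2 * \<sigma> * P + \<mu>\<^sup>2 * \<sigma>\<^sup>2"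
    using \<tau>P assms(4) by (simp add: power2_diff power_mult_distrib algebra_simps)
  then have "(A + 2 * \<sigma> * (\<mu> * l)) / (2 * \<sigma>) \<le> (2 * \<sigma> * P + \<mu>\<^sup>2 * \<sigma>\<^sup>2) / (2 * \<sigma>)"
    using \<sigma> by (intro divide_right_mono) auto
  then have 2: "A / (2 * \<sigma>) + \<mu> * l \<le> P + \<mu>\<^sup>2 * \<sigma> / 2"
    using \<sigma> by (simp add: add_divide_distrib power2_eq_square)
  have "A' / (2 * (k * \<sigma>)) \<le> (1 + e) * A / (2 * (k * \<sigma>))"
    using assms \<sigma> by (intro divide_right_mono) auto
  also have "\<dots> = (1 + e) * inverse k * (A / (2 * \<sigma>))"
    using assms \<sigma> by (simp add: field_simps)
  also have "\<dots> = A / (2 * \<sigma>) + (e + \<delta> * c + e * (\<delta> * c)) * (A / (2 * \<sigma>))"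
    unfolding assms(7) by (simp add: algebra_simps add_divide_distrib)
  also have "\<dots> \<le> A / (2 * \<sigma>) + (e + 2 * (\<delta> * c)) * K"
  proof -
    have "e * (\<delta> * c) \<le> 1 * (\<delta> * c)" using assms by (intro mult_right_mono) auto
    then show ?thesis using assms A\<sigma> by (intro add_left_mono mult_mono) auto
  qed
  finally have 3: "A' / (2 * (k * \<sigma>)) \<le> A / (2 * \<sigma>) + (e + 2 * (\<delta> * c)) * K" .
  have "0 \<le> \<delta> * c" using assms by simp
  then have "0 \<le> k * (\<delta> * c)" using assms(6) by simp
  moreover have k1: "k * (1 + \<delta> * c) = 1" using assms(6,7) by (metis right_inverse less_irrefl)
  ultimately have k: "k * (1 + \<delta> * c) = 1" "k \<le> 1" by (simp_all add: distrib_left)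
  have k': "0 \<le> 1 - k" "1 - k \<le> \<delta> * c"
  proof -
    have "1 - k = k * (\<delta> * c)" using k by (simp add: algebra_simps)
    also have "\<dots> \<le> 1 * (\<delta> * c)" using k assms by (intro mult_right_mono) auto
    finally show "1 - k \<le> \<delta> * c" by simp
  qed (use k in simp)
  have "(1 - k) * \<tau> \<le> \<delta> * c * K" using k' assms by (intro mult_mono) auto
  moreover have "0 \<le> (1 - k) * \<tau>" "k * \<delta> \<le> 1 * \<delta>" "0 \<le> k * \<delta>"
    using k' k assms by (auto intro!: mult_right_mono mult_nonneg_nonneg)
  moreover have "0 \<le> \<delta> * c * K" using assms K by simp
  moreover have "\<tau> - k * \<sigma> = (1 - k) * \<tau> - k * \<delta>" by (simp add: \<sigma>_def algebra_simps)
  ultimately have "\<bar>\<tau> - k * \<sigma>\<bar> \<le> \<delta> * c * K + \<delta>" using assms(5) by linarith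
  then have "\<bar>W'\<bar> * \<bar>\<tau> - k * \<sigma>\<bar> \<le> K * (\<delta> * c * K + \<delta>)" using assms K by (intro mult_mono) auto
  then have 4: "W' * (\<tau> - k * \<sigma>) \<le> K * (\<delta> * c * K + \<delta>)"
    by (metis abs_le_D1 abs_mult)
  have "\<bar>W - W'\<bar> * \<tau> \<le> e * K" using assms by (intro mult_mono) auto
  then have 5: "(W - W') * \<tau> \<le> e * K" using assms(1) by (metis abs_ge_self mult_right_mono order_trans)
  have "W * \<tau> - W' * (k * \<sigma>) = (W - W') * \<tau> + W' * (\<tau> - k * \<sigma>)" by (simp add: algebra_simps)
  with 4 5 have 6: "W * \<tau> - W' * (k * \<sigma>) \<le> e * K + K * (\<delta> * c * K + \<delta>)" by linarith
  have "A' / (2 * (k * \<sigma>)) + B' - W' * (k * \<sigma>) \<le>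
      (P + \<mu>\<^sup>2 * \<sigma> / 2 - \<mu> * l) + (e + 2 * (\<delta> * c)) * K + (B + e) - W' * (k * \<sigma>)"
    using 2 3 assms(13) by linarith
  also have "\<dots> = \<eta> + \<mu>\<^sup>2 * \<sigma> / 2 - \<mu> * l + (e + 2 * (\<delta> * c)) * K + e + (W * \<tau> - W' * (k * \<sigma>))"
    using assms(12) by simp
  also have "\<dots> \<le> \<eta> + \<mu>\<^sup>2 * \<sigma> / 2 - \<mu> * l + (e + 2 * (\<delta> * c)) * K + e + (e * K + K * (\<delta> * c * K + \<delta>))"
    using 6 by simp
  \<comment> \<open>Origin of the error: \<open>e * (2 * K + 1)\<close> collects
    \<open>e * K\<close> from the metric, \<open>e\<close> from b and \<open>e * K\<close> from V.
    In the factor of \<delta>, the first term comes from \<sigma> = \<tau> + \<delta>, the second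
    from dividing the kinetic term by \<open>k\<close>, and the last two from replacing \<tau> by
    \<open>k * \<sigma>\<close> next to V.\<close>
  also have "\<dots> = \<eta> - \<mu> * l + \<mu>\<^sup>2 * \<tau> / 2 + (e * (2 * K + 1) + \<delta> * (\<mu>\<^sup>2 / 2 + 2 * c * K + c * K\<^sup>2 + K))"
    by (simp add: \<sigma>_def algebra_simps power2_eq_square add_divide_distrib)
  finally show ?thesis by (simp add: \<sigma>_def)
qed

section \<open>Comparison of the metrics at nearby times\<close>

context gw_spacetime
begin

text \<open>Uniform continuity would give an additive error, which is too weak where the velocity
  vanishes. A relative error comes from positive definiteness: along a sequence of counterexamples
  the velocities are normalized by homogeneity to component vectors in the compact set
  \<open>F\<close>, and in the limit a positive number would be at least \<open>1 + e\<close> times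
  itself.\<close>

lemma metric_comparison:
  assumes q: "C1_curve UNIV ch \<alpha> \<beta> q" "\<alpha> < \<beta>" and \<tau>: "continuous_on {\<alpha>..\<beta>} \<tau>" "\<tau> ` {\<alpha>..\<beta>} \<subseteq> T"
    and "0 < e"
  defines "v \<equiv> velocity ch {\<alpha>..\<beta>} q"
  shows "\<exists>\<delta>>0. \<forall>s\<in>{\<alpha>..\<beta>}. \<forall>t'\<in>T. \<bar>t' - \<tau> s\<bar> < \<delta> \<longrightarrow>
     a t' (q s) (v s) (v s) \<le> (1 + e) * a (\<tau> s) (q s) (v s) (v s)"
proof (rule ccontr)
  assume "\<not> ?thesis"
  then have "\<forall>n. \<exists>s t'. s \<in> {\<alpha>..\<beta>} \<and> t' \<in> T \<and> \<bar>t' - \<tau> s\<bar> < inverse (real (Suc n)) \<and>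
      (1 + e) * a (\<tau> s) (q s) (v s) (v s) < a t' (q s) (v s) (v s)"
    by (metis inverse_positive_iff_positive not_le of_nat_0_less_iff zero_less_Suc)
  then obtain s t' where s: "\<And>n. s n \<in> {\<alpha>..\<beta>}" "\<And>n. t' n \<in> T"
      "\<And>n. \<bar>t' n - \<tau> (s n)\<bar> < inverse (real (Suc n))"
      "\<And>n. (1 + e) * a (\<tau> (s n)) (q (s n)) (v (s n)) (v (s n)) < a (t' n) (q (s n)) (v (s n)) (v (s n))"
    by metis
  obtain s0 \<phi> where \<phi>: "s0 \<in> {\<alpha>..\<beta>}" "strict_mono \<phi>" "(s \<circ> \<phi>) \<longlonglongrightarrow> s0"
    using compact_Icc[of \<alpha> \<beta>] s(1) unfolding compact_def by metis
  \<comment> \<open>Velocities are compared in the one chart at the limit point, which contains the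
    points of the subsequence from some index \<open>N\<close> on.\<close>
  define p where "p = q s0"
  define S where "S = {s\<in>{\<alpha>..\<beta>}. q s \<in> cdom p}"
  define w where "w = comp_velocity p {\<alpha>..\<beta>} q"
  obtain B :: "'v set" where B: "finite B" "independent B" "span B = UNIV" using finite_basis by blast
  obtain F :: "'v set" where F: "compact F" "0 \<notin> F" "\<And>u. u \<noteq> 0 \<Longrightarrow> \<exists>k>0. \<exists>f\<in>F. u = k *\<^sub>R f"
    using compact_transversal[OF B] by metis
  have s0: "s0 \<in> S" using \<phi> chart_around by (simp add: S_def p_def)
  obtain O' where O': "open O'" "S = {\<alpha>..\<beta>} \<inter> O'"
    using openin_curve_dom[OF q(1), of p] unfolding S_def openin_open by blast
  have "\<forall>\<^sub>F n in sequentially. (s \<circ> \<phi>) n \<in> O'"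
    using topological_tendstoD[OF \<phi>(3) O'(1)] s0 O' by blast
  then obtain N where N: "\<And>n. n \<ge> N \<Longrightarrow> s (\<phi> n) \<in> S"
    using s(1) O' by (auto simp: eventually_sequentially)
  have v: "v x = toc p (q x) (w x)" if "x \<in> S" for x
    unfolding v_def w_def using that q by (intro velocity_eq_toc) (auto simp: S_def)
  \<comment> \<open>For zero velocity both sides of the strict inequality would be 0. So the
    velocities can be normalized.\<close>
  have G0: "w (s n) \<noteq> 0" if "s n \<in> S" for n
  proof
    assume "w (s n) = 0"
    then have "v (s n) = 0" using v[OF that] linear_0[OF linear_toc] that by (simp add: S_def)
    then show False using s(4)[of n] s(2)[of n] \<tau>(2) s(1)[of n] a_zero by (auto simp: image_subset_iff)
  qed
  define G where "G = (\<lambda>(x, t, u). a t (q x) (toc p (q x) u) (toc p (q x) u))"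
  have Gc: "continuous_on (S \<times> T \<times> UNIV) G"
  proof -
    have "continuous_on (S \<times> T \<times> UNIV) (\<lambda>x. q (fst x))"
      by (intro continuous_on_compose2[OF curve_continuous[OF q(1)]] continuous_intros) (auto simp: S_def)
    then show ?thesis
      unfolding G_def case_prod_unfold
      by (intro continuous_on_a_toc[where p = p and \<tau> = "\<lambda>x. fst (snd x)" and Q = "\<lambda>x. q (fst x)"] continuous_intros)
        (auto simp: S_def)
  qed
  \<comment> \<open>Both sides scale with the same factor \<open>k\<^sup>2\<close>, so the
    inequality passes to the representative in \<open>F\<close>.\<close>
  have "\<forall>n. \<exists>f. f \<in> F \<and> (1 + e) * G (s (\<phi> (n + N)), \<tau> (s (\<phi> (n + N))), f) < G (s (\<phi> (n + N)), t' (\<phi> (n + N)), f)"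
  proof
    fix n
    let ?m = "\<phi> (n + N)"
    have m: "s ?m \<in> S" using N by simp
    obtain k f where f: "0 < k" "f \<in> F" "w (s ?m) = k *\<^sub>R f" using F(3)[OF G0[OF m]] by blast
    have vs: "v (s ?m) = k *\<^sub>R toc p (q (s ?m)) f"
      using v[OF m] f linear_cmul[OF linear_toc] m by (simp add: S_def)
    have "a t (q (s ?m)) (v (s ?m)) (v (s ?m)) = k\<^sup>2 * G (s ?m, t, f)" if "t \<in> T" for t
      unfolding vs G_def using a_scale[OF that] by simp
    then have "k\<^sup>2 * ((1 + e) * G (s ?m, \<tau> (s ?m), f)) < k\<^sup>2 * G (s ?m, t' ?m, f)"
      using s(4)[of ?m] s(1,2)[of ?m] \<tau>(2) by (simp add: image_subset_iff algebra_simps)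
    then show "\<exists>f. f \<in> F \<and> (1 + e) * G (s ?m, \<tau> (s ?m), f) < G (s ?m, t' ?m, f)"
      using f by (intro exI[of _ f]) (simp add: mult_less_cancel_left)
  qed
  then obtain f where f: "\<And>n. f n \<in> F"
      "\<And>n. (1 + e) * G (s (\<phi> (n + N)), \<tau> (s (\<phi> (n + N))), f n) < G (s (\<phi> (n + N)), t' (\<phi> (n + N)), f n)"
    by metis
  obtain f0 \<psi> where \<psi>: "f0 \<in> F" "strict_mono \<psi>" "(f \<circ> \<psi>) \<longlonglongrightarrow> f0"
    using F(1) f(1) unfolding compact_def by metis
  define \<theta> where "\<theta> n = \<phi> (\<psi> n + N)" for n
  have \<theta>: "strict_mono \<theta>" using \<phi>(2) \<psi>(2) by (auto simp: \<theta>_def strict_mono_def)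
  have sl: "(\<lambda>n. s (\<theta> n)) \<longlonglongrightarrow> s0"
  proof -
    have "strict_mono (\<lambda>n. \<psi> n + N)" using \<psi>(2) by (auto simp: strict_mono_def)
    from LIMSEQ_subseq_LIMSEQ[OF \<phi>(3) this] show ?thesis by (simp add: \<theta>_def o_def)
  qed
  have tl: "(\<lambda>n. \<tau> (s (\<theta> n))) \<longlonglongrightarrow> \<tau> s0"
    using continuous_on_tendsto_compose[OF \<tau>(1) sl \<phi>(1)] s(1) by simp
  have "(\<lambda>n. t' n - \<tau> (s n)) \<longlonglongrightarrow> 0"
    using s(3) by (intro Lim_null_comparison[OF _ LIMSEQ_inverse_real_of_nat]) (auto intro: always_eventually less_imp_le)
  from LIMSEQ_subseq_LIMSEQ[OF this \<theta>] have "(\<lambda>n. t' (\<theta> n) - \<tau> (s (\<theta> n))) \<longlonglongrightarrow> 0" by (simp add: o_def)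
  from tendsto_add[OF this tl] have t'l: "(\<lambda>n. t' (\<theta> n)) \<longlonglongrightarrow> \<tau> s0" by simp
  have fl: "(\<lambda>n. f (\<psi> n)) \<longlonglongrightarrow> f0" using \<psi>(3) by (simp add: o_def)
  have S\<theta>: "s (\<theta> n) \<in> S" for n using N by (simp add: \<theta>_def)
  have T\<tau>: "\<tau> s0 \<in> T" "\<tau> (s n) \<in> T" for n using \<tau>(2) \<phi>(1) s(1) by auto
  have 1: "(\<lambda>n. G (s (\<theta> n), \<tau> (s (\<theta> n)), f (\<psi> n))) \<longlonglongrightarrow> G (s0, \<tau> s0, f0)"
    using continuous_on_tendsto_compose[OF Gc tendsto_Pair[OF sl tendsto_Pair[OF tl fl]]] s0 S\<theta> T\<tau> by simp
  have 2: "(\<lambda>n. G (s (\<theta> n), t' (\<theta> n), f (\<psi> n))) \<longlonglongrightarrow> G (s0, \<tau> s0, f0)"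
    using continuous_on_tendsto_compose[OF Gc tendsto_Pair[OF sl tendsto_Pair[OF t'l fl]]] s0 S\<theta> T\<tau> s(2) by simp
  have "(1 + e) * G (s0, \<tau> s0, f0) \<le> G (s0, \<tau> s0, f0)"
    using LIMSEQ_le[OF tendsto_mult_left[OF 1] 2] f(2) by (auto simp: \<theta>_def intro: less_imp_le)
  moreover have "0 < G (s0, \<tau> s0, f0)"
  proof -
    have "f0 \<noteq> 0" using \<psi>(1) F(2) by metis
    then show ?thesis using a_pos[OF T\<tau>(1), of f0 p] by (simp add: G_def toc_self p_def[symmetric])
  qed
  ultimately show False using \<open>0 < e\<close> by simp
qed

end

lemma compact_abs_bound:
  fixes f :: "'x::topological_space \<Rightarrow> real"
  assumes "compact S" "continuous_on S f"
  shows "\<exists>K. \<forall>x\<in>S. \<bar>f x\<bar> \<le> K"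
  using compact_imp_bounded[OF compact_continuous_image[OF assms(2,1)]] by (simp add: bounded_iff)

lemma uniformly_continuous_second:
  fixes f :: "'x::metric_space \<times> 'y::metric_space \<Rightarrow> real"
  assumes "continuous_on (I \<times> J) f" "compact I" "compact J" "0 < e"
  shows "\<exists>\<delta>>0. \<forall>s\<in>I. \<forall>x\<in>J. \<forall>y\<in>J. dist x y < \<delta> \<longrightarrow> \<bar>f (s, x) - f (s, y)\<bar> < e"
proof -
  have "uniformly_continuous_on (I \<times> J) f"
    using assms by (intro compact_uniformly_continuous compact_Times)
  then obtain \<delta> where \<delta>: "\<delta> > 0"
      "\<And>x x'. x \<in> I \<times> J \<Longrightarrow> x' \<in> I \<times> J \<Longrightarrow> dist x' x < \<delta> \<Longrightarrow> dist (f x') (f x) < e"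
    using assms(4) unfolding uniformly_continuous_on_def by metis
  have "\<bar>f (s, x) - f (s, y)\<bar> < e" if "s \<in> I" "x \<in> J" "y \<in> J" "dist x y < \<delta>" for s x y
    using \<delta>(2)[of "(s, y)" "(s, x)"] that by (simp add: dist_Pair_Pair dist_real_def)
  with \<delta>(1) show ?thesis by blast
qed

context gw_spacetime
begin

lemma causal_C1_derivatives:
  assumes "causal_C1 \<alpha> \<beta> q z" "s \<in> {\<alpha>..\<beta>}"
  defines "z' \<equiv> vector_derivative z (at s within {\<alpha>..\<beta>})"
  shows "((\<lambda>s. fst (z s)) has_real_derivative fst z') (at s within {\<alpha>..\<beta>})"
    "((\<lambda>s. fst (snd (z s))) has_real_derivative fst (snd z')) (at s within {\<alpha>..\<beta>})"
    "((\<lambda>s. snd (snd (z s))) has_real_derivative snd (snd z')) (at s within {\<alpha>..\<beta>})"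
proof -
  have d: "(z has_vector_derivative z') (at s within {\<alpha>..\<beta>})"
    unfolding z'_def using assms by (intro C1_on_has_vector_derivative) (auto simp: causal_C1_def)
  note f = bounded_linear.has_vector_derivative[OF bounded_linear_fst]
    and s = bounded_linear.has_vector_derivative[OF bounded_linear_snd]
  show "((\<lambda>s. fst (z s)) has_real_derivative fst z') (at s within {\<alpha>..\<beta>})"
    "((\<lambda>s. fst (snd (z s))) has_real_derivative fst (snd z')) (at s within {\<alpha>..\<beta>})"
    "((\<lambda>s. snd (snd (z s))) has_real_derivative snd (snd z')) (at s within {\<alpha>..\<beta>})"
    unfolding has_real_derivative_iff_has_vector_derivative using f[OF d] f[OF s[OF d]] s[OF s[OF d]] by simp_all
qed

lemma causal_C1_time_mono:
  assumes "causal_C1 \<alpha> \<beta> q z" "\<alpha> \<le> x" "x \<le> y" "y \<le> \<beta>"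
  shows "fst (z x) \<le> fst (z y)"
  by (rule nondecreasing_within[OF causal_C1_derivatives(1)[OF assms(1)] _ assms(2-4)])
    (use assms(1) in \<open>auto simp: causal_C1_def causal_vec_def\<close>)

lemma interval_T_subset:
  assumes "x \<in> T" "y \<in> T"
  shows "{x..y} \<subseteq> T"
proof
  fix u assume "u \<in> {x..y}"
  then have "x \<le> u" "u \<le> y" by simp_all
  then show "u \<in> T" by (rule mem_is_interval_1_I[OF interval_T assms])
qed

text \<open>
  The time function of a causal curve may be stationary. Adding \<open>\<delta> * (s - \<alpha>)\<close> and rescaling makes it
  invertible, and the inverse turns the curve on \<open>Q\<close> into a competitor for the least action.
\<close>

lemma action_le_causal:
  fixes \<mu> \<epsilon> :: real
  assumes z: "causal_C1 \<alpha> \<beta> q z" and lt: "fst (z \<alpha>) < fst (z \<beta>)" and "0 < \<epsilon>"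
  shows "\<exists>q'\<in>C1_paths ch (fst (z \<alpha>), q \<alpha>) (fst (z \<beta>), q \<beta>).
    action ch a b V (fst (z \<alpha>)) (fst (z \<beta>)) q' \<le> (fst (snd (z \<beta>)) - fst (snd (z \<alpha>)))
      - \<mu> * (snd (snd (z \<beta>)) - snd (snd (z \<alpha>))) + \<mu>\<^sup>2 / 2 * (fst (z \<beta>) - fst (z \<alpha>)) + \<epsilon>"
proof -
  define t y l where "t s = fst (z s)" and "y s = fst (snd (z s))" and "l s = snd (snd (z s))" for s
  define z' where "z' s = vector_derivative z (at s within {\<alpha>..\<beta>})" for s
  define \<tau> \<eta> \<kappa> where "\<tau> s = fst (z' s)" and "\<eta> s = fst (snd (z' s))" and "\<kappa> s = snd (snd (z' s))" for s
  define v where "v = velocity ch {\<alpha>..\<beta>} q"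
  define I where "I = {\<alpha>..\<beta>}"
  define J where "J = {t \<alpha>..t \<beta>}"
  \<comment> \<open>Position and velocity are those at \<open>s\<close>, while the time of
    evaluation \<open>x\<close> is free: it will be the perturbed time \<open>g s\<close>.\<close>
  define fa fb fV where "fa = (\<lambda>(s, x). a x (q s) (v s) (v s))" and "fb = (\<lambda>(s, x). b x (q s) (v s))"
    and "fV = (\<lambda>(s, x). V x (q s))"
  have le: "\<alpha> < \<beta>" and q: "C1_curve UNIV ch \<alpha> \<beta> q" and zC: "C1_on {\<alpha>..\<beta>} {\<alpha>..\<beta>} z"
    using z by (auto simp: causal_C1_def)
  have d: "(t has_real_derivative \<tau> s) (at s within I)" "(y has_real_derivative \<eta> s) (at s within I)"
      "(l has_real_derivative \<kappa> s) (at s within I)" if "s \<in> I" for s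
    using causal_C1_derivatives[OF z] that
    unfolding t_def y_def l_def \<tau>_def \<eta>_def \<kappa>_def z'_def I_def by blast+
  have tT: "t s \<in> T" and cv: "causal_vec (t s) (q s) (v s) (z' s)" if "s \<in> I" for s
    using z that by (auto simp: causal_C1_def t_def v_def z'_def I_def)
  have tJ: "t s \<in> J" if "s \<in> I" for s
    using causal_C1_time_mono[OF z] that by (auto simp: J_def I_def t_def)
  have JT: "J \<subseteq> T" unfolding J_def using le by (intro interval_T_subset tT) (auto simp: I_def)
  have fc: "continuous_on (I \<times> J) fa" "continuous_on (I \<times> J) fb" "continuous_on (I \<times> J) fV"
    using continuous_on_a_velocity[OF q le] continuous_on_b_velocity[OF q le] continuous_on_V_curve[OF q le] JT
    unfolding fa_def fb_def fV_def v_def I_def by (auto intro: continuous_on_subset)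
  have z'c: "continuous_on I z'" using zC unfolding z'_def I_def C1_on_def by blast
  then have \<tau>c: "continuous_on I \<tau>" and \<eta>c: "continuous_on I \<eta>"
    unfolding \<tau>_def \<eta>_def by (auto intro: continuous_intros)
  have tc: "continuous_on I t"
    using d(1) by (meson DERIV_continuous continuous_on_eq_continuous_within)
  define P where "P s = momentum (t s) (q s) (v s) (z' s)" for s
  have P_eq: "P s = \<eta> s - fb (s, t s) + fV (s, t s) * \<tau> s" for s
    by (simp add: P_def momentum_def fb_def fV_def \<tau>_def \<eta>_def)
  have "continuous_on I (\<lambda>s. f (s, t s))" if "continuous_on (I \<times> J) f" for f :: "real \<times> real \<Rightarrow> real"
    using tc tJ by (intro continuous_on_compose2[OF that] continuous_intros) auto
  then have "continuous_on I P"
    unfolding P_eq[abs_def] using fc \<tau>c \<eta>c by (intro continuous_intros) auto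
  then obtain K1 K2 K3 where K123: "\<And>s. s \<in> I \<Longrightarrow> \<bar>P s\<bar> \<le> K1" "\<And>s. s \<in> I \<Longrightarrow> \<bar>\<tau> s\<bar> \<le> K2"
      "\<And>x. x \<in> I \<times> J \<Longrightarrow> \<bar>fV x\<bar> \<le> K3"
    using compact_abs_bound[of I P] compact_abs_bound[of I \<tau>] compact_abs_bound[of "I \<times> J" fV] \<tau>c fc
    unfolding I_def J_def by (metis compact_Icc compact_Times)
  define K where "K = \<bar>K1\<bar> + \<bar>K2\<bar> + \<bar>K3\<bar>"
  have K: "0 \<le> K" "\<And>s. s \<in> I \<Longrightarrow> P s \<le> K" "\<And>s. s \<in> I \<Longrightarrow> \<tau> s \<le> K"
      "\<And>s x. s \<in> I \<Longrightarrow> x \<in> J \<Longrightarrow> \<bar>fV (s, x)\<bar> \<le> K"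
    using K123 unfolding K_def by (fastforce intro: order_trans)+
  \<comment> \<open>Adding \<delta> times the parameter stretches the time range from
    \<open>D\<close> to \<open>D * (1 + \<delta> * c)\<close>; the factor \<open>k\<close> below
    undoes this, so that both end times are kept.\<close>
  define D c where "D = t \<beta> - t \<alpha>" and "c = (\<beta> - \<alpha>) / D"
  have D: "0 < D" using lt by (simp add: D_def t_def)
  have c: "0 \<le> c" "c * D = \<beta> - \<alpha>" using D le by (auto simp: c_def)
  \<comment> \<open>The permitted error per unit of the parameter. One half is spent on
    \<open>e\<close>, the other half on \<delta>, following the two error terms of
    \<open>perturbed_lagrangian_bound\<close>.\<close>
  define \<epsilon>' where "\<epsilon>' = \<epsilon> / (\<beta> - \<alpha>)"
  have \<epsilon>': "0 < \<epsilon>'" "\<epsilon>' * (\<beta> - \<alpha>) = \<epsilon>" using assms le by (auto simp: \<epsilon>'_def)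
  have half: "x / (2 * m) * m = x / 2" if "0 < m" for x m :: real using that by simp
  define e where "e = min 1 (\<epsilon>' / (2 * (2 * K + 1)))"
  have e: "0 < e" "e \<le> 1" "e * (2 * K + 1) \<le> \<epsilon>' / 2"
  proof -
    have "e * (2 * K + 1) \<le> \<epsilon>' / (2 * (2 * K + 1)) * (2 * K + 1)"
      using K(1) by (intro mult_right_mono) (auto simp: e_def)
    also have "\<dots> = \<epsilon>' / 2" using K(1) by (intro half) simp
    finally show "e * (2 * K + 1) \<le> \<epsilon>' / 2" .
  qed (use \<epsilon>' K(1) in \<open>auto simp: e_def intro!: divide_pos_pos add_nonneg_pos\<close>)
  define C where "C = \<mu>\<^sup>2 / 2 + 2 * c * K + c * K\<^sup>2 + K"
  have C: "0 \<le> C" using K(1) c by (simp add: C_def)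
  obtain \<delta>1 where \<delta>1: "0 < \<delta>1" "\<And>s x. s \<in> I \<Longrightarrow> x \<in> T \<Longrightarrow> \<bar>x - t s\<bar> < \<delta>1 \<Longrightarrow> fa (s, x) \<le> (1 + e) * fa (s, t s)"
  proof -
    have "t ` {\<alpha>..\<beta>} \<subseteq> T" using tT by (auto simp: I_def)
    from metric_comparison[OF q le tc[unfolded I_def] this e(1)] that show ?thesis
      unfolding I_def fa_def v_def by auto
  qed
  obtain \<delta>2 where \<delta>2: "0 < \<delta>2" "\<And>s x x'. s \<in> I \<Longrightarrow> x \<in> J \<Longrightarrow> x' \<in> J \<Longrightarrow> dist x x' < \<delta>2 \<Longrightarrow> \<bar>fb (s, x) - fb (s, x')\<bar> < e"
    using uniformly_continuous_second[OF fc(2) _ _ e(1)] unfolding I_def J_def by (metis compact_Icc)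
  obtain \<delta>3 where \<delta>3: "0 < \<delta>3" "\<And>s x x'. s \<in> I \<Longrightarrow> x \<in> J \<Longrightarrow> x' \<in> J \<Longrightarrow> dist x x' < \<delta>3 \<Longrightarrow> \<bar>fV (s, x) - fV (s, x')\<bar> < e"
    using uniformly_continuous_second[OF fc(3) _ _ e(1)] unfolding I_def J_def by (metis compact_Icc)
  define \<delta>0 where "\<delta>0 = min \<delta>1 (min \<delta>2 \<delta>3)"
  \<comment> \<open>Chosen last, because \<open>\<delta>0\<close> depends on \<open>e\<close>. The
    first bound makes \<open>\<delta> * C\<close> small, with \<open>C + 1\<close> to avoid a zero
    denominator; the second keeps the perturbed time within \<open>\<delta>0\<close> of the original
    one.\<close>
  define \<delta> where "\<delta> = min (\<epsilon>' / (2 * (C + 1))) (\<delta>0 / (2 * (\<beta> - \<alpha>)))"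
  have \<delta>0: "0 < \<delta>0" using \<delta>1 \<delta>2 \<delta>3 by (simp add: \<delta>0_def)
  have \<delta>: "0 < \<delta>" "\<delta> * C \<le> \<epsilon>' / 2" "\<delta> * (\<beta> - \<alpha>) < \<delta>0"
  proof -
    show "0 < \<delta>" using \<epsilon>' C \<delta>0 le by (auto simp: \<delta>_def intro!: divide_pos_pos)
    have "\<delta> * C \<le> \<epsilon>' / (2 * (C + 1)) * (C + 1)"
      using C \<epsilon>' by (intro mult_mono) (auto simp: \<delta>_def)
    also have "\<dots> = \<epsilon>' / 2" using C by (intro half) simp
    finally show "\<delta> * C \<le> \<epsilon>' / 2" .
    have "\<delta> * (\<beta> - \<alpha>) \<le> \<delta>0 / (2 * (\<beta> - \<alpha>)) * (\<beta> - \<alpha>)"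
      using le by (intro mult_right_mono) (auto simp: \<delta>_def)
    also have "\<dots> = \<delta>0 / 2" using le by (intro half) simp
    finally show "\<delta> * (\<beta> - \<alpha>) < \<delta>0" using \<delta>0 by simp
  qed
  define k where "k = inverse (1 + \<delta> * c)"
  have \<delta>c: "0 \<le> \<delta> * c" using \<delta>(1) c by simp
  have k: "0 < k" "inverse k = 1 + \<delta> * c" "k \<le> 1"
    using \<delta>c by (auto simp: k_def inverse_le_1_iff intro: add_pos_nonneg)
  define g where "g s = t \<alpha> + k * (t s - t \<alpha> + \<delta> * (s - \<alpha>))" for s
  define g' where "g' s = k * (\<tau> s + \<delta>)" for s
  have \<tau>0: "0 \<le> \<tau> s" if "s \<in> I" for s using cv[OF that] by (simp add: causal_vec_def \<tau>_def)
  have g': "0 < g' s" if "s \<in> I" for s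
    unfolding g'_def using k \<tau>0[OF that] \<delta>(1) by (intro mult_pos_pos) auto
  have gd: "(g has_real_derivative g' s) (at s within I)" if "s \<in> I" for s
    unfolding g_def g'_def using d(1)[OF that] by (auto intro!: derivative_eq_intros)
  have g'c: "continuous_on I g'" unfolding g'_def using \<tau>c by (intro continuous_intros)
  have g\<alpha>: "g \<alpha> = t \<alpha>" by (simp add: g_def)
  have g\<beta>: "g \<beta> = t \<beta>"
  proof -
    have "D + \<delta> * (\<beta> - \<alpha>) = D * inverse k" unfolding k(2) c(2)[symmetric] by (simp add: algebra_simps)
    then have "k * (D + \<delta> * (\<beta> - \<alpha>)) = D" using k(1) by simp
    then show ?thesis by (simp add: g_def D_def)
  qed
  obtain h where h: "h ` J \<subseteq> I" "\<And>u. u \<in> J \<Longrightarrow> g (h u) = u" "\<And>s. s \<in> I \<Longrightarrow> h (g s) = s"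
      "\<And>u. u \<in> J \<Longrightarrow> (h has_real_derivative inverse (g' (h u))) (at u within J)"
      "continuous_on J (\<lambda>u. inverse (g' (h u)))"
    using inverse_of_increasing_C1[OF le gd[unfolded I_def] g'c[unfolded I_def] g'[unfolded I_def]]
    unfolding g\<alpha> g\<beta> I_def J_def by metis
  have hI: "h u \<in> I" if "u \<in> J" for u using h(1) that by blast
  define h' where "h' u = inverse (g' (h u))" for u
  define R where "R s = \<eta> s - \<mu> * \<kappa> s + \<mu>\<^sup>2 * \<tau> s / 2 + \<epsilon>'" for s
  have key: "fa (s, g s) / (2 * g' s) + fb (s, g s) - fV (s, g s) * g' s \<le> R s" if s: "s \<in> I" "g s \<in> J" for s
  proof -
    \<comment> \<open>The added drift and the rescaling shift the time in opposite directions, each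
      by at most \<open>\<delta> * (\<beta> - \<alpha>)\<close>, so the total shift has the same
      bound.\<close>
    have "0 \<le> 1 - k" "1 - k \<le> \<delta> * c"
    proof -
      have "1 - k = k * (\<delta> * c)" using k(1,2) by (simp add: inverse_eq_divide field_simps)
      also have "\<dots> \<le> 1 * (\<delta> * c)" using k \<delta>c by (intro mult_right_mono)
      finally show "1 - k \<le> \<delta> * c" by simp
    qed (use k in simp)
    moreover have "0 \<le> t s - t \<alpha>" "t s - t \<alpha> \<le> D" using tJ[OF s(1)] by (auto simp: J_def D_def)
    ultimately have 1: "0 \<le> (1 - k) * (t s - t \<alpha>)" "(1 - k) * (t s - t \<alpha>) \<le> \<delta> * c * D"
      using \<delta>c by (auto intro: mult_mono)
    have 2: "0 \<le> k * (\<delta> * (s - \<alpha>))"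
      using k \<delta>(1) s(1) by (auto simp: I_def)
    have 3: "k * (\<delta> * (s - \<alpha>)) \<le> 1 * (\<delta> * (\<beta> - \<alpha>))"
      using k \<delta>(1) s(1) by (intro mult_mono) (auto simp: I_def)
    have "\<delta> * c * D = \<delta> * (\<beta> - \<alpha>)" using c(2) by (simp add: mult.assoc)
    moreover have "g s - t s = k * (\<delta> * (s - \<alpha>)) - (1 - k) * (t s - t \<alpha>)" by (simp add: g_def algebra_simps)
    ultimately have "\<bar>g s - t s\<bar> < \<delta>0" using 1 2 3 \<delta>(3) by linarith
    then have close: "\<bar>g s - t s\<bar> < \<delta>1" "dist (g s) (t s) < \<delta>2" "dist (g s) (t s) < \<delta>3"
      by (auto simp: \<delta>0_def dist_real_def)
    have "fa (s, g s) / (2 * (k * (\<tau> s + \<delta>))) + fb (s, g s) - fV (s, g s) * (k * (\<tau> s + \<delta>)) \<le>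
      \<eta> s - \<mu> * \<kappa> s + \<mu>\<^sup>2 * \<tau> s / 2 + (e * (2 * K + 1) + \<delta> * (\<mu>\<^sup>2 / 2 + 2 * c * K + c * K\<^sup>2 + K))"
    proof (rule perturbed_lagrangian_bound)
      show "0 \<le> \<tau> s" "0 \<le> P s" "fa (s, t s) + (\<kappa> s)\<^sup>2 \<le> 2 * \<tau> s * P s"
        using cv[OF s(1)] by (auto simp: causal_vec_def P_def fa_def \<tau>_def \<kappa>_def)
      show "0 \<le> fa (s, t s)" using a_nonneg[OF tT[OF s(1)]] by (simp add: fa_def)
      show "fa (s, g s) \<le> (1 + e) * fa (s, t s)" using \<delta>1(2) s close JT by blast
      show "P s = \<eta> s - fb (s, t s) + fV (s, t s) * \<tau> s" by (rule P_eq)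
      show "\<bar>fb (s, g s) - fb (s, t s)\<bar> \<le> e" using \<delta>2(2) s close tJ by (simp add: less_imp_le)
      show "\<bar>fV (s, g s) - fV (s, t s)\<bar> \<le> e" using \<delta>3(2) s close tJ by (simp add: less_imp_le)
    qed (use \<delta>(1) k(1,2) c(1) e(1,2) K(2,3)[OF s(1)] K(4)[OF s] in auto)
    also have "\<dots> \<le> R s" using e(3) \<delta>(2) by (simp add: R_def C_def)
    finally show ?thesis by (simp add: g'_def)
  qed
  have lt': "t \<alpha> < t \<beta>" using lt by (simp add: t_def)
  have hC: "C1_on {t \<alpha>..t \<beta>} {t \<alpha>..t \<beta>} h" and hvd: "\<And>u. u \<in> J \<Longrightarrow> vector_derivative h (at u within J) = h' u"
    using C1_on_real[OF lt' h(4)[unfolded J_def] h(5)[unfolded J_def]] by (simp_all add: J_def h'_def)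
  have q'C: "C1_curve UNIV ch (t \<alpha>) (t \<beta>) (q \<circ> h)"
    using C1_curve_compose[OF q lt' _ hC] h(1) by (simp add: I_def J_def)
  have v': "velocity ch J (q \<circ> h) u = h' u *\<^sub>R v (h u)" if "u \<in> J" for u
    using velocity_compose[OF q lt' _ hC _ chart_around] h(1) hvd that by (simp add: I_def J_def v_def)
  have h_ends: "h (t \<alpha>) = \<alpha>" "h (t \<beta>) = \<beta>"
    using h(3)[of \<alpha>] h(3)[of \<beta>] le by (auto simp: I_def g\<alpha> g\<beta>)
  have path: "q \<circ> h \<in> C1_paths ch (fst (z \<alpha>), q \<alpha>) (fst (z \<beta>), q \<beta>)"
    using q'C h_ends by (simp add: C1_paths_def flip: t_def)
  define L where "L u = lagrangian a b V u ((q \<circ> h) u) (velocity ch J (q \<circ> h) u)" for u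
  have L_eq: "L u = 1/2 * (h' u)\<^sup>2 * fa (h u, u) + h' u * fb (h u, u) - fV (h u, u)" if "u \<in> J" for u
  proof -
    have "u \<in> T" using that JT by blast
    then show ?thesis by (simp add: L_def lagrangian_def v'[OF that] a_scale b_scale fa_def fb_def fV_def)
  qed
  have hc: "continuous_on J h"
    using h(4) by (meson DERIV_continuous continuous_on_eq_continuous_within)
  have comp: "continuous_on J (\<lambda>u. f (h u, u))" if "continuous_on (I \<times> J) f" for f :: "real \<times> real \<Rightarrow> real"
    using hc hI by (intro continuous_on_compose2[OF that] continuous_intros) auto
  have "continuous_on J (\<lambda>u. 1/2 * (h' u)\<^sup>2 * fa (h u, u) + h' u * fb (h u, u) - fV (h u, u))"
    using h(5)[folded h'_def] comp[OF fc(1)] comp[OF fc(2)] comp[OF fc(3)] by (intro continuous_intros)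
  then have "continuous_on J L" by (simp add: L_eq cong: continuous_on_cong)
  then have "L integrable_on J" unfolding J_def by (rule integrable_continuous_real)
  then have Lint: "(L has_integral action ch a b V (fst (z \<alpha>)) (fst (z \<beta>)) (q \<circ> h)) J"
    unfolding action_def L_def J_def t_def by (simp add: has_integral_integral o_def)
  \<comment> \<open>An antiderivative of \<open>R\<close> built from y, l, t and the parameter, so
    that integrating the bound leaves end values only.\<close>
  define \<Phi> where "\<Phi> s = y s - \<mu> * l s + \<mu>\<^sup>2 / 2 * t s + \<epsilon>' * s" for s
  have \<Phi>d: "(\<Phi> has_real_derivative R s) (at s within I)" if "s \<in> I" for s
    unfolding \<Phi>_def R_def using d[OF that] by (auto intro!: derivative_eq_intros)
  have "((\<lambda>u. R (h u) * h' u) has_integral (\<Phi> \<circ> h) (t \<beta>) - (\<Phi> \<circ> h) (t \<alpha>)) {t \<alpha>..t \<beta>}"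
  proof (rule fundamental_theorem_of_calculus)
    fix u assume "u \<in> {t \<alpha>..t \<beta>}"
    then have u: "u \<in> J" by (simp add: J_def)
    have "(\<Phi> has_real_derivative R (h u)) (at (h u) within h ` J)"
      using DERIV_subset[OF \<Phi>d[OF hI[OF u]] h(1)] .
    from DERIV_image_chain[OF this h(4)[OF u]]
    show "((\<Phi> \<circ> h) has_vector_derivative R (h u) * h' u) (at u within {t \<alpha>..t \<beta>})"
      unfolding J_def h'_def has_real_derivative_iff_has_vector_derivative .
  qed (use lt' in simp)
  then have Rint: "((\<lambda>u. R (h u) * h' u) has_integral \<Phi> \<beta> - \<Phi> \<alpha>) J"
    by (simp add: h_ends J_def)
  have "L u \<le> R (h u) * h' u" if u: "u \<in> J" for u
  proof -
    have X: "0 < g' (h u)" using g' hI[OF u] by blast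
    \<comment> \<open>Under u = g(s) the bracket is the Lagrangian per unit of s: the velocity is v
      / g', so one factor g' remains below the kinetic term.\<close>
    have "L u = (fa (h u, u) / (2 * g' (h u)) + fb (h u, u) - fV (h u, u) * g' (h u)) * h' u"
      unfolding L_eq[OF u] h'_def using X by (simp add: field_simps power2_eq_square)
    also have "\<dots> \<le> R (h u) * h' u"
      using key[OF hI[OF u]] h(2)[OF u] u X by (intro mult_right_mono) (auto simp: h'_def)
    finally show ?thesis .
  qed
  then have "action ch a b V (fst (z \<alpha>)) (fst (z \<beta>)) (q \<circ> h) \<le> \<Phi> \<beta> - \<Phi> \<alpha>"
    using has_integral_le[OF Lint Rint] by blast
  also have "\<dots> = (y \<beta> - y \<alpha>) - \<mu> * (l \<beta> - l \<alpha>) + \<mu>\<^sup>2 / 2 * (t \<beta> - t \<alpha>) + \<epsilon>' * (\<beta> - \<alpha>)"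
    by (simp add: \<Phi>_def field_simps)
  finally show ?thesis using path \<epsilon>'(2) by (intro bexI[of _ "q \<circ> h"]) (simp_all add: t_def y_def l_def)
qed

end

context gw_spacetime
begin

abbreviation "gwch \<equiv> gw_chart ch T"
abbreviation "gwM \<equiv> gw_points T :: (real \<times> 'q \<times> real) set"
abbreviation "gwg \<equiv> gw_metric a b V"
abbreviation "gwW \<equiv> gw_orientation V :: real \<times> 'q \<times> real \<Rightarrow> real \<times> 'v \<times> real"

section \<open>Curves in the spacetime\<close>

lemma gw_chart_simps:
  "chart_dom (gwch (t, q, y)) = T \<times> cdom q \<times> UNIV"
  "chart_map (gwch (t, q, y)) \<circ> (\<lambda>s. (\<tau> s, \<gamma> s, \<eta> s)) = (\<lambda>s. (\<tau> s, (cmap q \<circ> \<gamma>) s, \<eta> s))"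
  by (auto simp: gw_chart_def)

lemma gw_curve_components:
  assumes \<gamma>: "C1_curve gwM gwch \<alpha> \<beta> (\<lambda>s. (t s, q s, y s))" and le: "\<alpha> < \<beta>"
  shows "C1_curve UNIV ch \<alpha> \<beta> q" "C1_on {\<alpha>..\<beta>} {\<alpha>..\<beta>} t" "C1_on {\<alpha>..\<beta>} {\<alpha>..\<beta>} y"
    "\<And>s. s \<in> {\<alpha>..\<beta>} \<Longrightarrow> t s \<in> T"
    "\<And>s. s \<in> {\<alpha>..\<beta>} \<Longrightarrow> velocity gwch {\<alpha>..\<beta>} (\<lambda>s. (t s, q s, y s)) s =
      (vector_derivative t (at s within {\<alpha>..\<beta>}), velocity ch {\<alpha>..\<beta>} q s, vector_derivative y (at s within {\<alpha>..\<beta>}))"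
proof -
  let ?I = "{\<alpha>..\<beta>}"
  define S where "S p = {s\<in>?I. q s \<in> cdom p}" for p
  show tT: "t s \<in> T" if "s \<in> ?I" for s
    using \<gamma> that by (auto simp: C1_curve_iff gw_points_def image_subset_iff)
  have "t \<alpha> \<in> T" using tT le by simp
  have "continuous_on ?I (\<lambda>s. (t s, q s, y s))" using \<gamma> by (simp add: C1_curve_iff)
  then have qc: "continuous_on ?I q"
    using continuous_on_fst[OF continuous_on_snd] by fastforce
  have C: "C1_on ?I (S p) (\<lambda>s. (t s, (cmap p \<circ> q) s, y s))" for p
  proof -
    \<comment> \<open>Any point above \<open>p\<close> would do: its chart is the chart
      \<open>p\<close> of Q times the identity in t and y, and the times of the curve lie in
      \<open>T\<close> throughout.\<close>
    have "(t \<alpha>, p, 0) \<in> gwM" using \<open>t \<alpha> \<in> T\<close> by (simp add: gw_points_def)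
    then have "C1_on ?I {s\<in>?I. (t s, q s, y s) \<in> chart_dom (gwch (t \<alpha>, p, 0))}
        (chart_map (gwch (t \<alpha>, p, 0)) \<circ> (\<lambda>s. (t s, q s, y s)))"
      using \<gamma> unfolding C1_curve_iff by blast
    moreover have "{s\<in>?I. (t s, q s, y s) \<in> chart_dom (gwch (t \<alpha>, p, 0))} = S p"
      using tT by (auto simp: gw_chart_simps S_def)
    ultimately show ?thesis by (simp add: gw_chart_simps)
  qed
  have S: "S p \<subseteq> ?I" for p by (auto simp: S_def)
  have tS: "C1_on ?I (S p) t" for p
    using C1_on_bounded_linear(1)[OF bounded_linear_fst C le S] by simp
  have snd: "C1_on ?I (S p) (\<lambda>s. ((cmap p \<circ> q) s, y s))" for p
    using C1_on_bounded_linear(1)[OF bounded_linear_snd C le S] by simp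
  have qS: "C1_on ?I (S p) (cmap p \<circ> q)" for p
    using C1_on_bounded_linear(1)[OF bounded_linear_fst snd le S] by (simp add: o_def)
  have yS: "C1_on ?I (S p) y" for p
    using C1_on_bounded_linear(1)[OF bounded_linear_snd snd le S] by simp
  show "C1_curve UNIV ch \<alpha> \<beta> q" using qc qS by (auto simp: C1_curve_iff S_def)
  have op: "openin (top_of_set ?I) (S p)" for p
    using continuous_openin_preimage_gen[OF qc open_dom, of p] by (simp add: vimage_def Int_def S_def)
  have mem: "s \<in> S (q s)" if "s \<in> ?I" for s using that chart_around by (simp add: S_def)
  \<comment> \<open>In every chart t and y are the same functions, and the sets \<open>S p\<close>
    form a relatively open cover of the interval.\<close>
  show "C1_on ?I ?I t" by (rule C1_on_locally) (use op tS mem in blast)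
  show "C1_on ?I ?I y" by (rule C1_on_locally) (use op yS mem in blast)
  show "velocity gwch ?I (\<lambda>s. (t s, q s, y s)) s =
      (vector_derivative t (at s within ?I), velocity ch ?I q s, vector_derivative y (at s within ?I))"
    if s: "s \<in> ?I" for s
    unfolding velocity_def gw_chart_simps
    using C1_on_Pair(2)[OF tS snd le S mem[OF s]] C1_on_Pair(2)[OF qS yS le S mem[OF s]] by simp
qed

lemma gw_curve_intro:
  assumes q: "C1_curve UNIV ch \<alpha> \<beta> q" and t: "C1_on {\<alpha>..\<beta>} {\<alpha>..\<beta>} t" and y: "C1_on {\<alpha>..\<beta>} {\<alpha>..\<beta>} y"
    and T: "\<And>s. s \<in> {\<alpha>..\<beta>} \<Longrightarrow> t s \<in> T" and le: "\<alpha> < \<beta>"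
  shows "C1_curve gwM gwch \<alpha> \<beta> (\<lambda>s. (t s, q s, y s))"
  unfolding C1_curve_iff
proof (intro conjI ballI)
  show "(\<lambda>s. (t s, q s, y s)) ` {\<alpha>..\<beta>} \<subseteq> gwM" using T by (auto simp: gw_points_def)
  show "continuous_on {\<alpha>..\<beta>} (\<lambda>s. (t s, q s, y s))"
    using C1_on_imp_continuous_on[OF t] C1_on_imp_continuous_on[OF y] curve_continuous[OF q]
    by (intro continuous_intros) auto
  fix p :: "real \<times> 'q \<times> real" obtain pt pq py where p: "p = (pt, pq, py)" by (cases p)
  let ?S = "{s\<in>{\<alpha>..\<beta>}. q s \<in> cdom pq}"
  have S: "{s\<in>{\<alpha>..\<beta>}. (t s, q s, y s) \<in> chart_dom (gwch p)} = ?S"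
    using T by (auto simp: p gw_chart_simps)
  have sub: "?S \<subseteq> {\<alpha>..\<beta>}" by auto
  have "C1_on {\<alpha>..\<beta>} ?S (\<lambda>s. (t s, (cmap pq \<circ> q) s, y s))"
    by (intro C1_on_Pair(1) C1_on_subset[OF t] C1_on_subset[OF y] curve_C1_on[OF q] le sub)
  then show "C1_on {\<alpha>..\<beta>} {s\<in>{\<alpha>..\<beta>}. (t s, q s, y s) \<in> chart_dom (gwch p)}
      (chart_map (gwch p) \<circ> (\<lambda>s. (t s, q s, y s)))"
    unfolding S unfolding p gw_chart_simps .
qed

section \<open>From future causal vectors and curves to length coordinates\<close>

lemma gw_metric_eq:
  "gwg (t, q, y) (\<tau>, v, \<eta>) (\<tau>, v, \<eta>) = a t q v v - 2 * \<tau> * momentum t q v (\<tau>, \<eta>, l)"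
  by (simp add: gw_metric_def momentum_def algebra_simps)

text \<open>\<open>W\<close> is the sum of \<open>\<partial>\<^sub>t - V \<partial>\<^sub>y\<close>
  and half of \<open>\<partial>\<^sub>y\<close>, whose products with the vector are -P and
  -\<tau>.\<close>

lemma gw_orientation_eq:
  assumes "t \<in> T"
  shows "gwg (t, q, y) (gwW (t, q, y)) (\<tau>, v, \<eta>) = - momentum t q v (\<tau>, \<eta>, l) - \<tau> / 2"
proof -
  have "a t q 0 v = 0" "b t q 0 = 0"
    using bilinear_lzero[OF bilinear_a[OF assms]] linear_0[OF linear_b[OF assms]] by auto
  then show ?thesis by (simp add: gw_metric_def gw_orientation_def momentum_def algebra_simps)
qed

text \<open>Causality gives \<tau> P \<ge> 0, so \<tau> and P cannot have opposite signs; the time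
  orientation makes P + \<tau>/2 positive and excludes the negative choice.\<close>

lemma future_causal_imp_causal_vec:
  assumes "future_causal_vector gwg gwW (t, q, y) (\<tau>, v, \<eta>)" "t \<in> T"
  shows "causal_vec t q v (\<tau>, \<eta>, sqrt (- gwg (t, q, y) (\<tau>, v, \<eta>) (\<tau>, v, \<eta>)))"
proof -
  define P where "P = momentum t q v (\<tau>, \<eta>, 0)"
  have P: "momentum t q v (\<tau>, \<eta>, l) = P" for l by (simp add: P_def momentum_def)
  have g: "gwg (t, q, y) (\<tau>, v, \<eta>) (\<tau>, v, \<eta>) = a t q v v - 2 * \<tau> * P"
    using gw_metric_eq[of t q y \<tau> v \<eta> 0] by (simp add: P)
  have 1: "a t q v v \<le> 2 * \<tau> * P" "0 < P + \<tau> / 2"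
    using assms gw_orientation_eq[OF assms(2), of q y \<tau> v \<eta> 0] by (auto simp: future_causal_vector_def g P)
  have "0 \<le> \<tau> * P" using 1 a_nonneg[OF assms(2), of q v] by simp
  then have "0 \<le> \<tau>" "0 \<le> P" using 1(2) by (auto simp: zero_le_mult_iff)
  with 1 show ?thesis by (simp add: causal_vec_def P g)
qed

text \<open>The Lorentzian arc length serves as the length coordinate. It is of class
  \<open>C^1\<close>, since its derivative \<open>F\<close> remains continuous where the curve is
  null.\<close>

lemma causal_piece_joined:
  assumes \<gamma>: "C1_curve gwM gwch \<alpha> \<beta> \<gamma>" and le: "\<alpha> < \<beta>"
    and causal: "\<And>s. s \<in> {\<alpha>..\<beta>} \<Longrightarrow> future_causal_vector gwg gwW (\<gamma> s) (velocity gwch {\<alpha>..\<beta>} \<gamma> s)"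
  defines "F \<equiv> \<lambda>s. sqrt (- gwg (\<gamma> s) (velocity gwch {\<alpha>..\<beta>} \<gamma> s) (velocity gwch {\<alpha>..\<beta>} \<gamma> s))"
  shows "continuous_on {\<alpha>..\<beta>} F" "joined (\<gamma> \<alpha>) (\<gamma> \<beta>) (integral {\<alpha>..\<beta>} F)"
proof -
  let ?I = "{\<alpha>..\<beta>}"
  define t q y where "t s = fst (\<gamma> s)" and "q s = fst (snd (\<gamma> s))" and "y s = snd (snd (\<gamma> s))" for s
  have \<gamma>_eq: "\<gamma> = (\<lambda>s. (t s, q s, y s))" by (simp add: fun_eq_iff t_def q_def y_def)
  have \<gamma>s: "\<gamma> s = (t s, q s, y s)" for s by (simp add: t_def q_def y_def)
  note C = gw_curve_components[OF \<gamma>[unfolded \<gamma>_eq] le]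
  define \<tau> \<eta> v where "\<tau> s = vector_derivative t (at s within ?I)"
    and "\<eta> s = vector_derivative y (at s within ?I)" and "v = velocity ch ?I q" for s
  have vel: "velocity gwch ?I \<gamma> s = (\<tau> s, v s, \<eta> s)" if "s \<in> ?I" for s
    using C(5)[OF that] by (simp add: \<gamma>_eq \<tau>_def \<eta>_def v_def)
  have F: "F s = sqrt (2 * \<tau> s * (\<eta> s - b (t s) (q s) (v s) + V (t s) (q s) * \<tau> s) - a (t s) (q s) (v s) (v s))"
    if "s \<in> ?I" for s
    unfolding F_def vel[OF that] \<gamma>s gw_metric_eq[where l = 0] momentum_def by simp
  have tc: "continuous_on ?I t" using C1_on_imp_continuous_on[OF C(2)] by simp
  have comp: "continuous_on ?I (\<lambda>s. f (s, t s))" if "continuous_on (?I \<times> T) f" for f :: "real \<times> real \<Rightarrow> real"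
    using tc C(4) by (intro continuous_on_compose2[OF that] continuous_intros) auto
  have cont: "continuous_on ?I \<tau>" "continuous_on ?I \<eta>"
    using C(2,3) unfolding C1_on_def \<tau>_def \<eta>_def by auto
  have "continuous_on ?I (\<lambda>s. sqrt (2 * \<tau> s * (\<eta> s - b (t s) (q s) (v s) + V (t s) (q s) * \<tau> s) - a (t s) (q s) (v s) (v s)))"
    using comp[OF continuous_on_a_velocity[OF C(1) le]] comp[OF continuous_on_b_velocity[OF C(1) le]]
      comp[OF continuous_on_V_curve[OF C(1) le]] cont
    by (intro continuous_intros) (simp_all add: v_def)
  then show Fc: "continuous_on ?I F" by (rule continuous_on_eq) (simp add: F)
  define l where "l s = integral {\<alpha>..s} F" for s
  have ld: "(l has_real_derivative F s) (at s within ?I)" if "s \<in> ?I" for s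
    unfolding l_def by (rule integral_has_real_derivative[OF Fc that])
  have lC: "C1_on ?I ?I l" by (rule C1_on_real(1)[OF le ld Fc])
  have lv: "vector_derivative l (at s within ?I) = F s" if "s \<in> ?I" for s
    using C1_on_real(2)[OF le ld Fc that] by simp
  define z where "z s = (t s, y s, l s)" for s
  note Z = C1_on_Pair[OF C(2) C1_on_Pair(1)[OF C(3) lC le order_refl] le order_refl]
  have zC: "C1_on ?I ?I z" using Z(1) by (simp add: z_def[abs_def])
  have zv: "vector_derivative z (at s within ?I) = (\<tau> s, \<eta> s, F s)" if "s \<in> ?I" for s
    using Z(2)[OF that] C1_on_Pair(2)[OF C(3) lC le order_refl that] lv[OF that]
    by (simp add: z_def[abs_def] \<tau>_def \<eta>_def)
  have "causal_vec (t s) (q s) (v s) (\<tau> s, \<eta> s, F s)" if "s \<in> ?I" for s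
    using future_causal_imp_causal_vec[OF _ C(4)[OF that], of "q s" "y s" "\<tau> s" "v s" "\<eta> s"] causal[OF that]
    unfolding F_def vel[OF that] \<gamma>s .
  then have "causal_C1 \<alpha> \<beta> q z"
    unfolding causal_C1_def using le C(1,4) zC zv by (auto simp: z_def v_def)
  moreover have "l \<alpha> = 0" by (simp add: l_def)
  ultimately show "joined (\<gamma> \<alpha>) (\<gamma> \<beta>) (integral ?I F)"
    unfolding joined_def by (intro exI[of _ \<alpha>] exI[of _ \<beta>] exI[of _ q] exI[of _ z])
      (simp add: z_def \<gamma>_eq l_def)
qed

lemma causal_curve_joined:
  assumes "future_causal_curve gwM gwch gwg gwW \<alpha> \<beta> \<gamma>"
  shows "joined (\<gamma> \<alpha>) (\<gamma> \<beta>) (lorentzian_length gwch gwg \<alpha> \<beta> \<gamma>)"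
proof -
  obtain n \<sigma> where "\<alpha> < \<beta>" and \<sigma>: "\<sigma> 0 = \<alpha>" "\<sigma> n = \<beta>" "\<And>i. i < n \<Longrightarrow> \<sigma> i < \<sigma> (Suc i)"
    and pc: "\<And>i. i < n \<Longrightarrow> C1_curve gwM gwch (\<sigma> i) (\<sigma> (Suc i)) \<gamma>"
      "\<And>i s. i < n \<Longrightarrow> s \<in> {\<sigma> i..\<sigma> (Suc i)} \<Longrightarrow>
        future_causal_vector gwg gwW (\<gamma> s) (velocity gwch {\<sigma> i..\<sigma> (Suc i)} \<gamma> s)"
    using assms unfolding future_causal_curve_def by metis
  define F where "F J s = sqrt (- gwg (\<gamma> s) (velocity gwch J \<gamma> s) (velocity gwch J \<gamma> s))" for J s
  have lo: "\<alpha> \<le> \<sigma> k" if "k \<le> n" for k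
    using that
  proof (induction k)
    case (Suc k)
    then show ?case using \<sigma>(3)[of k] by simp
  qed (simp add: \<sigma>)
  have hi: "\<sigma> k \<le> \<beta>" if "k \<le> n" for k
    using that
  proof (induction k rule: inc_induct)
    case (step k)
    then show ?case using \<sigma>(3)[of k] by simp
  qed (simp add: \<sigma>)
  have piece: "joined (\<gamma> (\<sigma> i)) (\<gamma> (\<sigma> (Suc i))) (integral {\<sigma> i..\<sigma> (Suc i)} (F {\<alpha>..\<beta>}))"
    "F {\<alpha>..\<beta>} integrable_on {\<sigma> i..\<sigma> (Suc i)}" if i: "i < n" for i
  proof -
    let ?J = "{\<sigma> i..\<sigma> (Suc i)}"
    note c = causal_piece_joined[OF pc(1)[OF i] \<sigma>(3)[OF i] pc(2)[OF i], folded F_def]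
    \<comment> \<open>The velocity within the whole interval agrees with the one within the piece
      except at its two ends, a negligible set for the integral.\<close>
    have eq: "F {\<alpha>..\<beta>} s = F ?J s" if "s \<in> ?J - {\<sigma> i, \<sigma> (Suc i)}" for s
    proof -
      have "at s within {\<alpha>..\<beta>} = at s within ?J"
        using that lo[of i] hi[of "Suc i"] i by (intro at_within_nhd[of s "{\<sigma> i<..<\<sigma> (Suc i)}"]) auto
      then show ?thesis by (simp add: F_def velocity_def)
    qed
    have "integral ?J (F {\<alpha>..\<beta>}) = integral ?J (F ?J)"
      using eq by (intro integral_spike[of "{\<sigma> i, \<sigma> (Suc i)}"]) auto
    then show "joined (\<gamma> (\<sigma> i)) (\<gamma> (\<sigma> (Suc i))) (integral ?J (F {\<alpha>..\<beta>}))"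
      using c(2) by simp
    show "F {\<alpha>..\<beta>} integrable_on ?J"
      using integrable_spike_finite[OF _ _ integrable_continuous_real[OF c(1)], of "{\<sigma> i, \<sigma> (Suc i)}"] eq by simp
  qed
  \<comment> \<open>The induction starts with one piece, as \<open>causal_C1\<close> requires a
    nondegenerate interval; there is at least one because \<alpha> < \<beta>.\<close>
  have "joined (\<gamma> \<alpha>) (\<gamma> (\<sigma> (Suc k))) (integral {\<alpha>..\<sigma> (Suc k)} (F {\<alpha>..\<beta>})) \<and>
      F {\<alpha>..\<beta>} integrable_on {\<alpha>..\<sigma> (Suc k)}" if "k < n" for k
    using that
  proof (induction k)
    case 0
    then show ?case using piece[of 0] \<sigma>(1) by simp
  next
    case (Suc k)
    have le: "\<alpha> \<le> \<sigma> (Suc k)" "\<sigma> (Suc k) \<le> \<sigma> (Suc (Suc k))"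
      using lo[of "Suc k"] \<sigma>(3)[OF Suc.prems] Suc.prems by auto
    note IH = Suc.IH[OF Suc_lessD[OF Suc.prems]]
    have int: "F {\<alpha>..\<beta>} integrable_on {\<alpha>..\<sigma> (Suc (Suc k))}"
      by (rule Henstock_Kurzweil_Integration.integrable_combine[OF le conjunct2[OF IH] piece(2)[OF Suc.prems]])
    show ?case
      using joined_trans[OF conjunct1[OF IH] piece(1)[OF Suc.prems]] int
      unfolding Henstock_Kurzweil_Integration.integral_combine[OF le int] by blast
  qed
  moreover obtain k where "n = Suc k" using \<open>\<alpha> < \<beta>\<close> \<sigma> by (cases n) auto
  ultimately show ?thesis using \<sigma>(2) by (auto simp: lorentzian_length_def F_def[abs_def])
qed

end

section \<open>Lorentzian distance and least action\<close>

lemma ereal_sqrt_infinity: "ereal_sqrt \<infinity> = \<infinity>"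
  unfolding ereal_sqrt_def infinity_ereal_def by (simp only: ereal.case)

lemma ereal_sqrt_ereal: "ereal_sqrt (ereal x) = ereal (sqrt x)"
  by (simp add: ereal_sqrt_def)

context gw_spacetime
begin

lemma causal_lift:
  assumes q: "q \<in> C1_paths ch (t0, q0) (t1, q1)" and T: "t0 \<in> T" "t1 \<in> T" and lt: "t0 < t1"
    and A: "action ch a b V t0 t1 q < y1 - y0"
  obtains \<gamma> where "(t0, t1, \<gamma>) \<in> future_causal_curves_between gwM gwch gwg gwW (t0, q0, y0) (t1, q1, y1)"
    "lorentzian_length gwch gwg t0 t1 \<gamma> = sqrt (2 * (y1 - y0 - action ch a b V t0 t1 q) * (t1 - t0))"
proof -
  let ?I = "{t0..t1}"
  \<comment> \<open>The constant value of \<eta> - L that makes the lift end at \<open>y1\<close>.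
    Along the lift, P = a(v, v)/2 + \<mu> and - g = 2 \<mu>.\<close>
  define \<mu> where "\<mu> = (y1 - y0 - action ch a b V t0 t1 q) / (t1 - t0)"
  have \<mu>: "0 < \<mu>" "\<mu> * (t1 - t0) = y1 - y0 - action ch a b V t0 t1 q" using lt A by (auto simp: \<mu>_def)
  define v where "v = velocity ch ?I q"
  define L where "L s = lagrangian a b V s (q s) (v s)" for s
  have qC: "C1_curve UNIV ch t0 t1 q" and ends: "q t0 = q0" "q t1 = q1"
    using q by (auto simp: C1_paths_def)
  have IT: "?I \<subseteq> T" using T by (rule interval_T_subset)
  have comp: "continuous_on ?I (\<lambda>s. f (s, s))" if "continuous_on (?I \<times> T) f" for f :: "real \<times> real \<Rightarrow> real"
    using IT by (intro continuous_on_compose2[OF that] continuous_intros) auto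
  have "continuous_on ?I (\<lambda>s. 1/2 * a s (q s) (v s) (v s) + b s (q s) (v s) - V s (q s))"
    using comp[OF continuous_on_a_velocity[OF qC lt]] comp[OF continuous_on_b_velocity[OF qC lt]]
      comp[OF continuous_on_V_curve[OF qC lt]]
    by (intro continuous_intros) (simp_all add: v_def)
  then have Lc: "continuous_on ?I L" by (simp add: L_def[abs_def] lagrangian_def)
  define y where "y s = y0 + integral {t0..s} L + \<mu> * (s - t0)" for s
  have yd: "(y has_real_derivative L s + \<mu>) (at s within ?I)" if "s \<in> ?I" for s
    unfolding y_def using integral_has_real_derivative[OF Lc that]
    by (auto intro!: derivative_eq_intros)
  have Lc': "continuous_on ?I (\<lambda>s. L s + \<mu>)" using Lc by (intro continuous_intros)
  have yC: "C1_on ?I ?I y" by (rule C1_on_real(1)[OF lt yd Lc'])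
  have y': "vector_derivative y (at s within ?I) = L s + \<mu>" if "s \<in> ?I" for s
    using C1_on_real(2)[OF lt yd Lc' that] by simp
  have idd: "((\<lambda>s. s) has_real_derivative 1) (at s within ?I)" for s by simp
  have tC: "C1_on ?I ?I (\<lambda>s. s)" by (rule C1_on_real(1)[OF lt idd]) simp
  have t': "vector_derivative (\<lambda>s. s) (at s within ?I) = 1" if "s \<in> ?I" for s
    using C1_on_real(2)[OF lt idd _ that] by simp
  define \<gamma> where "\<gamma> s = (s, q s, y s)" for s
  have tT: "s \<in> T" if "s \<in> ?I" for s using that IT by blast
  have \<gamma>C: "C1_curve gwM gwch t0 t1 \<gamma>"
    unfolding \<gamma>_def by (rule gw_curve_intro[OF qC tC yC tT lt])
  have vel: "velocity gwch ?I \<gamma> s = (1, v s, L s + \<mu>)" if "s \<in> ?I" for s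
    using gw_curve_components(5)[OF \<gamma>C[unfolded \<gamma>_def] lt that] t'[OF that] y'[OF that]
    by (simp add: \<gamma>_def[abs_def] v_def)
  have P: "momentum s (q s) (v s) (1, L s + \<mu>, 0) = 1/2 * a s (q s) (v s) (v s) + \<mu>" for s
    by (simp add: momentum_def L_def lagrangian_def)
  have g: "gwg (\<gamma> s) (velocity gwch ?I \<gamma> s) (velocity gwch ?I \<gamma> s) = - 2 * \<mu>" if "s \<in> ?I" for s
    unfolding vel[OF that] \<gamma>_def gw_metric_eq[where l = 0] P by simp
  have W: "gwg (\<gamma> s) (gwW (\<gamma> s)) (velocity gwch ?I \<gamma> s) < 0" if "s \<in> ?I" for s
    unfolding vel[OF that] \<gamma>_def gw_orientation_eq[where l = 0, OF tT[OF that]] P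
    using a_nonneg[OF tT[OF that], of "q s" "v s"] \<mu>(1) by simp
  have "future_causal_vector gwg gwW (\<gamma> s) (velocity gwch ?I \<gamma> s)" if "s \<in> ?I" for s
    using g[OF that] W[OF that] \<mu>(1) unfolding future_causal_vector_def
    by (simp add: vel[OF that] prod_eq_iff)
  then have "future_causal_curve gwM gwch gwg gwW t0 t1 \<gamma>"
    unfolding future_causal_curve_def using lt \<gamma>C
    by (intro conjI exI[of _ 1] exI[of _ "\<lambda>i::nat. if i = 0 then t0 else t1"]) auto
  moreover have "integral ?I L = action ch a b V t0 t1 q"
    by (simp add: action_def L_def[abs_def] v_def)
  then have "\<gamma> t0 = (t0, q0, y0)" "\<gamma> t1 = (t1, q1, y1)"
    using \<mu>(2) by (simp_all add: \<gamma>_def y_def ends)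
  ultimately have 1: "(t0, t1, \<gamma>) \<in> future_causal_curves_between gwM gwch gwg gwW (t0, q0, y0) (t1, q1, y1)"
    by (simp add: future_causal_curves_between_def)
  have "lorentzian_length gwch gwg t0 t1 \<gamma> = integral ?I (\<lambda>s. sqrt (2 * \<mu>))"
    unfolding lorentzian_length_def by (rule Henstock_Kurzweil_Integration.integral_cong) (simp add: g)
  also have "\<dots> = sqrt (2 * \<mu>) * sqrt ((t1 - t0)\<^sup>2)" using lt by simp
  also have "\<dots> = sqrt (2 * (\<mu> * (t1 - t0)) * (t1 - t0))"
    by (simp add: power2_eq_square algebra_simps flip: real_sqrt_mult)
  finally show thesis using that 1 \<mu>(2) by simp
qed

lemma joined_time_le:
  assumes "joined x0 x1 l"
  shows "fst x0 \<le> fst x1"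
proof -
  obtain \<alpha> \<beta> q z where z: "causal_C1 \<alpha> \<beta> q z" "fst x0 = fst (z \<alpha>)" "fst x1 = fst (z \<beta>)"
    using assms unfolding joined_def by fastforce
  then have "\<alpha> < \<beta>" by (simp add: causal_C1_def)
  then show ?thesis using causal_C1_time_mono[OF z(1), of \<alpha> \<beta>] z by simp
qed

lemma joined_least_action:
  assumes "joined (t0, q0, y0) (t1, q1, y1) l" "t0 < t1"
  shows "least_action ch a b V (t0, q0) (t1, q1) \<le> ereal (y1 - y0 - l\<^sup>2 / (2 * (t1 - t0)))"
proof (rule ereal_le_epsilon2)
  fix e :: real assume "0 < e"
  \<comment> \<open>The minimizer of - \<mu> l + \<open>\<mu>\<^sup>2 / 2 * (t1 - t0)\<close>, the
    bound from \<open>action_le_causal\<close>.\<close>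
  define \<mu> where "\<mu> = l / (t1 - t0)"
  obtain \<alpha> \<beta> q z where z: "causal_C1 \<alpha> \<beta> q z" "(t0, q0, y0) = (fst (z \<alpha>), q \<alpha>, fst (snd (z \<alpha>)))"
     "(t1, q1, y1) = (fst (z \<beta>), q \<beta>, fst (snd (z \<beta>)))" "l = snd (snd (z \<beta>)) - snd (snd (z \<alpha>))"
    using assms(1) unfolding joined_def by blast
  obtain q' where q': "q' \<in> C1_paths ch (t0, q0) (t1, q1)"
    "action ch a b V t0 t1 q' \<le> (y1 - y0) - \<mu> * l + \<mu>\<^sup>2 / 2 * (t1 - t0) + e"
    using action_le_causal[OF z(1) _ \<open>0 < e\<close>, of \<mu>] z(2-4) assms(2) by auto
  have "- (l / x) * l + (l / x)\<^sup>2 / 2 * x = - (l\<^sup>2 / (2 * x))" if "0 < x" for x :: real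
    using that by (simp add: field_simps power2_eq_square)
  from this[of "t1 - t0"] have "- \<mu> * l + \<mu>\<^sup>2 / 2 * (t1 - t0) = - (l\<^sup>2 / (2 * (t1 - t0)))"
    using assms(2) by (simp add: \<mu>_def)
  then have "action ch a b V t0 t1 q' \<le> y1 - y0 - l\<^sup>2 / (2 * (t1 - t0)) + e" using q'(2) by linarith
  then have "ereal (action ch a b V t0 t1 q') \<le> ereal (y1 - y0 - l\<^sup>2 / (2 * (t1 - t0))) + ereal e" by simp
  moreover have "least_action ch a b V (t0, q0) (t1, q1) \<le> ereal (action ch a b V t0 t1 q')"
    using assms(2) q'(1) by (auto simp: least_action_def intro: INF_lower)
  ultimately show "least_action ch a b V (t0, q0) (t1, q1) \<le> ereal (y1 - y0 - l\<^sup>2 / (2 * (t1 - t0))) + ereal e"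
    by (rule order_trans[rotated])
qed

text \<open>There is no global chart in which to integrate. In a chart the curve is locally
  constant, and connectedness of the parameter interval does the rest.\<close>

lemma C1_curve_zero_velocity_constant:
  assumes q: "C1_curve UNIV ch \<alpha> \<beta> q" and le: "\<alpha> < \<beta>"
    and v0: "\<And>s. s \<in> {\<alpha>..\<beta>} \<Longrightarrow> velocity ch {\<alpha>..\<beta>} q s = 0"
  shows "q \<alpha> = q \<beta>"
proof -
  let ?I = "{\<alpha>..\<beta>}"
  have "q constant_on ?I"
  proof (rule locally_constant_imp_constant)
    fix s assume s: "s \<in> ?I"
    define p where "p = q s"
    define S where "S = {s\<in>?I. q s \<in> cdom p}"
    have "openin (top_of_set ?I) S" "s \<in> S"
      using openin_curve_dom[OF q, of p] s chart_around by (auto simp: S_def p_def)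
    then obtain e where e: "e > 0" "ball s e \<inter> ?I \<subseteq> S" by (auto simp: openin_contains_ball)
    have "\<exists>c. \<forall>x\<in>ball s e \<inter> ?I. (cmap p \<circ> q) x = c"
    proof (rule has_derivative_zero_constant)
      show "convex (ball s e \<inter> ?I)" by (intro convex_Int convex_ball convex_real_interval)
      fix x assume x: "x \<in> ball s e \<inter> ?I"
      then have xS: "x \<in> S" using e by blast
      have "comp_velocity p ?I q x = 0"
        using comp_velocity_eq_0[OF q le _ _ v0] xS x by (auto simp: S_def)
      then have "((cmap p \<circ> q) has_vector_derivative 0) (at x within ?I)"
        using C1_on_has_vector_derivative[OF curve_C1_on[OF q, of p], of x] xS by (simp add: S_def)
      then have "((cmap p \<circ> q) has_vector_derivative 0) (at x within ball s e \<inter> ?I)"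
        by (rule has_vector_derivative_within_subset) simp
      then show "((cmap p \<circ> q) has_derivative (\<lambda>h. 0)) (at x within ball s e \<inter> ?I)"
        by (simp add: has_vector_derivative_def)
    qed
    then obtain c where c: "\<And>x. x \<in> ball s e \<inter> ?I \<Longrightarrow> cmap p (q x) = c" by auto
    have "q x = cinv p c" if "x \<in> ball s e \<inter> ?I" for x
      using c[OF that] cinv_cmap[of "q x" p] e(2) that by (auto simp: S_def)
    moreover have "s \<in> ball s e \<inter> ?I" using e s by simp
    moreover have "openin (top_of_set ?I) (ball s e \<inter> ?I)"
      by (metis Int_commute open_ball openin_open_Int)
    ultimately show "\<exists>U. openin (top_of_set ?I) U \<and> s \<in> U \<and> (\<forall>x\<in>U. q x = q s)"
      by metis
  qed simp
  then show ?thesis using le by (auto simp: constant_on_def)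
qed

text \<open>Time is nondecreasing, hence constant, so \<tau> = 0. Causality then bounds the sum of
  a(v, v) and the squared length component by 0, and both vanish; motion is possible along
  \<open>\<partial>\<^sub>y\<close> only.\<close>

lemma joined_same_time:
  assumes "joined (t0, q0, y0) (t0, q1, y1) l"
  shows "q1 = q0" "l = 0"
proof -
  obtain \<alpha> \<beta> q z where z: "causal_C1 \<alpha> \<beta> q z" "(t0, q0, y0) = (fst (z \<alpha>), q \<alpha>, fst (snd (z \<alpha>)))"
     "(t0, q1, y1) = (fst (z \<beta>), q \<beta>, fst (snd (z \<beta>)))" "l = snd (snd (z \<beta>)) - snd (snd (z \<alpha>))"
    using assms(1) unfolding joined_def by blast
  let ?I = "{\<alpha>..\<beta>}"
  have le: "\<alpha> < \<beta>" and q: "C1_curve UNIV ch \<alpha> \<beta> q" using z(1) by (auto simp: causal_C1_def)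
  have t: "fst (z s) = t0" if "s \<in> ?I" for s
    using causal_C1_time_mono[OF z(1), of \<alpha> s] causal_C1_time_mono[OF z(1), of s \<beta>] that z(2,3) by auto
  define z' where "z' s = vector_derivative z (at s within ?I)" for s
  define v where "v = velocity ch ?I q"
  have stop: "v s = 0 \<and> snd (snd (z' s)) = 0" if s: "s \<in> ?I" for s
  proof -
    have "((\<lambda>s. fst (z s)) has_vector_derivative fst (z' s)) (at s within ?I)"
      using causal_C1_derivatives(1)[OF z(1) s] unfolding z'_def has_real_derivative_iff_has_vector_derivative .
    moreover have "((\<lambda>s. fst (z s)) has_vector_derivative 0) (at s within ?I)"
      by (rule has_vector_derivative_transform[OF s, of _ "\<lambda>s. t0"]) (use t in auto)
    ultimately have \<tau>: "fst (z' s) = 0" using vector_derivative_within_Icc[OF le s] by metis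
    have tT: "t0 \<in> T" and cv: "causal_vec t0 (q s) (v s) (z' s)"
      using z(1) s t[OF s] by (auto simp: causal_C1_def v_def z'_def)
    have "a t0 (q s) (v s) (v s) + (snd (snd (z' s)))\<^sup>2 \<le> 0" using cv \<tau> by (simp add: causal_vec_def)
    moreover have "0 \<le> a t0 (q s) (v s) (v s)" "0 \<le> (snd (snd (z' s)))\<^sup>2" using a_nonneg[OF tT] by auto
    ultimately have "a t0 (q s) (v s) (v s) = 0" "(snd (snd (z' s)))\<^sup>2 = 0" by linarith+
    then show ?thesis using a_pos[OF tT, of "v s" "q s"] by (cases "v s = 0") auto
  qed
  show "q1 = q0"
    using C1_curve_zero_velocity_constant[OF q le] stop z(2,3) by (simp add: v_def)
  have d: "((\<lambda>s. snd (snd (z s))) has_real_derivative 0) (at s within ?I)" if "s \<in> ?I" for s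
    using causal_C1_derivatives(3)[OF z(1) that] stop[OF that] by (simp add: z'_def)
  have d': "((\<lambda>s. - snd (snd (z s))) has_real_derivative 0) (at s within ?I)" if "s \<in> ?I" for s
    using DERIV_minus[OF d[OF that]] by simp
  have "snd (snd (z \<alpha>)) \<le> snd (snd (z \<beta>))" by (rule nondecreasing_within[OF d]) (use le in auto)
  moreover have "- snd (snd (z \<alpha>)) \<le> - snd (snd (z \<beta>))" by (rule nondecreasing_within[OF d']) (use le in auto)
  ultimately show "l = 0" using z(4) by simp
qed

text \<open>Both estimates use the threshold \<open>Y - w\<^sup>2 / (2 * \<Delta>)\<close>: a causal
  curve of length w forces \<open>S\<close> to be at most this number, and if \<open>S\<close> is
  strictly below it, some path has action below it and lifts to a causal curve of length at least w,
  for w \<ge> 0. Solving for w gives the distance.\<close>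

lemma distance_formula:
  fixes t0 t1 y0 y1 :: real and q0 q1 :: 'q
  defines "\<C> \<equiv> future_causal_curves_between gwM gwch gwg gwW (t0, q0, y0) (t1, q1, y1)"
    and "S \<equiv> least_action ch a b V (t0, q0) (t1, q1)"
    and "D \<equiv> gw_distance ch T a b V (t0, q0, y0) (t1, q1, y1)"
  assumes T: "t0 \<in> T" "t1 \<in> T" and lt: "t0 < t1"
  shows "\<C> \<noteq> {} \<Longrightarrow> D = ereal_sqrt (2 * (ereal (y1 - y0) - S) * ereal (t1 - t0))"
    and "\<C> \<noteq> {} \<Longrightarrow> S < \<infinity>"
    and "S = -\<infinity> \<Longrightarrow> \<C> \<noteq> {}"
proof -
  define Y \<Delta> where "Y = y1 - y0" and "\<Delta> = t1 - t0"
  have \<Delta>: "0 < \<Delta>" using lt by (simp add: \<Delta>_def)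
  have upper: "S \<le> ereal (Y - (lorentzian_length gwch gwg \<alpha> \<beta> \<gamma>)\<^sup>2 / (2 * \<Delta>))" if "(\<alpha>, \<beta>, \<gamma>) \<in> \<C>" for \<alpha> \<beta> \<gamma>
  proof -
    have "joined (t0, q0, y0) (t1, q1, y1) (lorentzian_length gwch gwg \<alpha> \<beta> \<gamma>)"
      using that causal_curve_joined[of \<alpha> \<beta> \<gamma>] by (auto simp: \<C>_def future_causal_curves_between_def)
    from joined_least_action[OF this lt] show ?thesis by (simp add: S_def Y_def \<Delta>_def)
  qed
  have lower: "\<exists>\<alpha> \<beta> \<gamma>. (\<alpha>, \<beta>, \<gamma>) \<in> \<C> \<and> w \<le> lorentzian_length gwch gwg \<alpha> \<beta> \<gamma>"
    if w: "S < ereal (Y - w\<^sup>2 / (2 * \<Delta>))" for w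
  proof -
    obtain q where q: "q \<in> C1_paths ch (t0, q0) (t1, q1)" "action ch a b V t0 t1 q < Y - w\<^sup>2 / (2 * \<Delta>)"
      using w lt by (auto simp: S_def least_action_def INF_less_iff)
    have "0 \<le> w\<^sup>2 / (2 * \<Delta>)" using \<Delta> by simp
    then have "action ch a b V t0 t1 q < y1 - y0" using q(2) by (simp add: Y_def)
    from causal_lift[OF q(1) T lt this] obtain \<gamma> where \<gamma>: "(t0, t1, \<gamma>) \<in> \<C>"
      "lorentzian_length gwch gwg t0 t1 \<gamma> = sqrt (2 * (Y - action ch a b V t0 t1 q) * \<Delta>)"
      unfolding \<C>_def Y_def \<Delta>_def by blast
    have "w\<^sup>2 / (2 * \<Delta>) < Y - action ch a b V t0 t1 q" using q(2) by linarith
    then have "w\<^sup>2 \<le> 2 * (Y - action ch a b V t0 t1 q) * \<Delta>" using \<Delta> by (simp add: field_simps)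
    then have "w \<le> lorentzian_length gwch gwg t0 t1 \<gamma>" unfolding \<gamma>(2) by (rule real_le_rsqrt)
    with \<gamma>(1) show ?thesis by blast
  qed
  show fin: "S < \<infinity>" if ne: "\<C> \<noteq> {}"
  proof -
    obtain \<alpha> \<beta> \<gamma> where "(\<alpha>, \<beta>, \<gamma>) \<in> \<C>" using ne by (metis all_not_in_conv prod_cases3)
    from upper[OF this] show ?thesis by (rule le_less_trans) simp
  qed
  \<comment> \<open>Below every threshold, in particular the one for length 0, so some path
    lifts.\<close>
  show "\<C> \<noteq> {}" if "S = -\<infinity>" using lower[of 0] that by auto
  show "D = ereal_sqrt (2 * (ereal (y1 - y0) - S) * ereal (t1 - t0))" if ne: "\<C> \<noteq> {}"
  proof -
    have D: "D = (SUP (\<alpha>, \<beta>, \<gamma>)\<in>\<C>. ereal (lorentzian_length gwch gwg \<alpha> \<beta> \<gamma>))"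
      using ne unfolding D_def lorentzian_distance_def \<C>_def by simp
    show ?thesis
    proof (cases S)
      case PInf
      then show ?thesis using fin[OF ne] by simp
    next
      case MInf
      have "\<exists>x\<in>\<C>. ereal (real n) \<le> (case x of (\<alpha>, \<beta>, \<gamma>) \<Rightarrow> ereal (lorentzian_length gwch gwg \<alpha> \<beta> \<gamma>))" for n :: nat
      proof -
        have "S < ereal (Y - (real n)\<^sup>2 / (2 * \<Delta>))" using MInf by simp
        from lower[OF this] obtain \<alpha> \<beta> \<gamma> where "(\<alpha>, \<beta>, \<gamma>) \<in> \<C>"
            "real n \<le> lorentzian_length gwch gwg \<alpha> \<beta> \<gamma>" by blast
        then show ?thesis by (intro bexI[of _ "(\<alpha>, \<beta>, \<gamma>)"]) simp_all
      qed
      then have "D = \<infinity>" unfolding D by (rule SUP_PInfty)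
      moreover have "2 * (ereal (y1 - y0) - S) * ereal (t1 - t0) = \<infinity>" using MInf lt by simp
      ultimately show ?thesis by (simp only: ereal_sqrt_infinity)
    next
      case (real r)
      let ?R = "sqrt (2 * (Y - r) * \<Delta>)"
      have le: "(lorentzian_length gwch gwg \<alpha> \<beta> \<gamma>)\<^sup>2 \<le> 2 * (Y - r) * \<Delta>" if "(\<alpha>, \<beta>, \<gamma>) \<in> \<C>" for \<alpha> \<beta> \<gamma>
        using upper[OF that] \<Delta> unfolding real by (simp add: field_simps)
      have "D = ereal ?R"
      proof (rule antisym)
        show "D \<le> ereal ?R"
          unfolding D using le by (auto intro!: SUP_least real_le_rsqrt)
        obtain \<alpha> \<beta> \<gamma> where \<gamma>: "(\<alpha>, \<beta>, \<gamma>) \<in> \<C>" using ne by (metis all_not_in_conv prod_cases3)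
        have "0 \<le> 2 * (Y - r) * \<Delta>" using le[OF \<gamma>] zero_le_power2 order_trans by blast
        then consider "2 * (Y - r) * \<Delta> = 0" | "0 < 2 * (Y - r) * \<Delta>" by linarith
        then show "ereal ?R \<le> D"
        proof cases
          \<comment> \<open>Here \<open>S\<close> equals \<open>Y\<close>, no threshold lies
            strictly above it, and \<open>lower\<close> gives nothing. The given causal curve has
            length 0 and attains the bound.\<close>
          case 1
          have "(lorentzian_length gwch gwg \<alpha> \<beta> \<gamma>)\<^sup>2 \<le> 0" using le[OF \<gamma>] unfolding 1 .
          then have "lorentzian_length gwch gwg \<alpha> \<beta> \<gamma> = 0" by simp
          then show ?thesis unfolding D 1 by (intro SUP_upper2[OF \<gamma>]) simp
        next
          case 2
          show ?thesis
          proof (rule dense_le)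
            fix w' assume w': "w' < ereal ?R"
            \<comment> \<open>The maximum with 0 covers negative \<open>w'\<close> and -
              \<infinity>, and makes squaring monotone.\<close>
            define w where "w = max 0 (real_of_ereal w')"
            have "w' \<le> ereal w" "w < ?R"
              using w' 2 by (cases w'; auto simp: w_def)+
            have "0 \<le> w" by (simp add: w_def)
            then have "w\<^sup>2 < ?R\<^sup>2" using \<open>w < ?R\<close> by (intro power_strict_mono) auto
            then have "w\<^sup>2 < 2 * (Y - r) * \<Delta>" using 2 by simp
            then have "S < ereal (Y - w\<^sup>2 / (2 * \<Delta>))" using \<Delta> unfolding real by (simp add: field_simps)
            from lower[OF this] obtain \<alpha> \<beta> \<gamma> where "(\<alpha>, \<beta>, \<gamma>) \<in> \<C>" "w \<le> lorentzian_length gwch gwg \<alpha> \<beta> \<gamma>" by blast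
            then have "ereal w \<le> D" unfolding D by (intro SUP_upper2[of "(\<alpha>, \<beta>, \<gamma>)"]) auto
            with \<open>w' \<le> ereal w\<close> show "w' \<le> D" by simp
          qed
        qed
      qed
      then show ?thesis by (simp add: real ereal_sqrt_ereal Y_def \<Delta>_def)
    qed
  qed
qed

text \<open>Causal curves cannot decrease t, so any curve between the points has constant t and
  length 0 by \<open>joined_same_time\<close>. If there is none, the distance is 0 by
  definition.\<close>

lemma distance_same_time:
  assumes "\<not> t0 < t1"
  shows "gw_distance ch T a b V (t0, q0, y0) (t1, q1, y1) = 0"
    "future_causal_curves_between gwM gwch gwg gwW (t0, q0, y0) (t1, q1, y1) \<noteq> {} \<Longrightarrow> (t1, q1) = (t0, q0)"
proof -
  let ?C = "future_causal_curves_between gwM gwch gwg gwW (t0, q0, y0) (t1, q1, y1)"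
  have *: "t1 = t0 \<and> q1 = q0 \<and> lorentzian_length gwch gwg \<alpha> \<beta> \<gamma> = 0" if "(\<alpha>, \<beta>, \<gamma>) \<in> ?C" for \<alpha> \<beta> \<gamma>
  proof -
    have j: "joined (t0, q0, y0) (t1, q1, y1) (lorentzian_length gwch gwg \<alpha> \<beta> \<gamma>)"
      using that causal_curve_joined[of \<alpha> \<beta> \<gamma>] by (auto simp: future_causal_curves_between_def)
    have "t1 = t0" using joined_time_le[OF j] assms by simp
    then show ?thesis using joined_same_time j by blast
  qed
  then show "?C \<noteq> {} \<Longrightarrow> (t1, q1) = (t0, q0)" by auto
  have "(case x of (\<alpha>, \<beta>, \<gamma>) \<Rightarrow> ereal (lorentzian_length gwch gwg \<alpha> \<beta> \<gamma>)) = 0" if "x \<in> ?C" for x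
    using * that by (cases x) (auto simp: zero_ereal_def)
  then show "gw_distance ch T a b V (t0, q0, y0) (t1, q1, y1) = 0"
    unfolding lorentzian_distance_def by (simp cong: SUP_cong)
qed

end

theorem theorem2p7:
  fixes d r :: nat
    and ch :: "'q::t2_space \<Rightarrow> ('q, 'v::real_inner) chart"
    and T :: "real set"
    and a :: "real \<Rightarrow> 'q \<Rightarrow> 'v \<Rightarrow> 'v \<Rightarrow> real"
    and b :: "real \<Rightarrow> 'q \<Rightarrow> 'v \<Rightarrow> real"
    and V :: "real \<Rightarrow> 'q \<Rightarrow> real"
    and t0 t1 y0 y1 :: real
    and q0 q1 :: 'q
  assumes "2 \<le> r"
    and "gw_data d r ch T a b V"
    and "t0 \<in> T" and "t1 \<in> T"
  shows "((t1, q1, y1) \<in> gw_causal_future ch T a b V (t0, q0, y0) \<longrightarrow>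
           gw_distance ch T a b V (t0, q0, y0) (t1, q1, y1) =
             ereal_sqrt (2 * (ereal (y1 - y0) - least_action ch a b V (t0, q0) (t1, q1))
                           * ereal (t1 - t0))) \<and>
         (least_action ch a b V (t0, q0) (t1, q1) = - \<infinity> \<longleftrightarrow>
           gw_distance ch T a b V (t0, q0, y0) (t1, q1, y1) = \<infinity>)"
proof -
  interpret gw_spacetime d r ch T a b V by standard (rule assms(2))
  let ?C = "future_causal_curves_between gwM gwch gwg gwW (t0, q0, y0) (t1, q1, y1)"
  let ?S = "least_action ch a b V (t0, q0) (t1, q1)"
  let ?D = "gw_distance ch T a b V (t0, q0, y0) (t1, q1, y1)"
  show ?thesis
  proof (cases "t0 < t1")
    case True
    note F = distance_formula[OF assms(3,4) True, where ?q0.0 = q0 and ?y0.0 = y0 and ?q1.0 = q1 and ?y1.0 = y1]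
    have "?S = - \<infinity> \<longleftrightarrow> ?D = \<infinity>"
    proof
      assume S: "?S = - \<infinity>"
      have "2 * (ereal (y1 - y0) - ?S) * ereal (t1 - t0) = \<infinity>" using S True by simp
      \<comment> \<open>The equivalence is claimed for arbitrary end points; the causal curve comes
        from the infinite action itself, by \<open>F(3)\<close>.\<close>
      then show "?D = \<infinity>" using F(1)[OF F(3)[OF S]] by (simp only: ereal_sqrt_infinity)
    next
      assume D: "?D = \<infinity>"
      then have ne: "?C \<noteq> {}" by (auto simp: lorentzian_distance_def)
      show "?S = - \<infinity>"
      proof (cases ?S)
        case (real s)
        then show ?thesis using F(1)[OF ne] D by (simp add: ereal_sqrt_ereal)
      qed (use F(2)[OF ne] in simp_all)
    qed
    moreover have "(t1, q1, y1) \<in> gw_causal_future ch T a b V (t0, q0, y0) \<Longrightarrow> ?C \<noteq> {}"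
      using True by (auto simp: causal_future_def)
    ultimately show ?thesis using F(1) by blast
  next
    case False
    note Z = distance_same_time[OF False, of q0 y0 q1 y1]
    have "?D = ereal_sqrt (2 * (ereal (y1 - y0) - ?S) * ereal (t1 - t0))"
      if "(t1, q1, y1) \<in> gw_causal_future ch T a b V (t0, q0, y0)"
    proof -
      have "(t1, q1) = (t0, q0)" using that Z(2) by (auto simp: causal_future_def)
      \<comment> \<open>With equal events the action is 0, hence finite, and the factor
        \<open>t1 - t0\<close> makes the right-hand side 0.\<close>
      then show ?thesis using Z(1) by (simp add: least_action_def ereal_sqrt_ereal zero_ereal_def)
    qed
    moreover have "?S \<noteq> - \<infinity>" using False by (simp add: least_action_def)
    ultimately show ?thesis using Z(1) by simp
  qed
qed

end
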